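(* Let $\mathbf{k}$ be a field and let $\mathrm{K}$ be the Grothendieck group of the abelian category $\mathcal{A}^{\mathrm{fg}}$ of finitely generated objects of $\mathcal{A}$. Then the classes $[\mathbf{I}^r]$, $r\ge0$, form a $\mathbf{Z}$-basis of $\mathrm{K}$.
   Context: Let $\mathfrak{S}=\bigcup_{n\ge1}\mathfrak{S}_n$ be the infinite symmetric group (finitary permutations of $\{1,2,\ldots\}$), and $\mathfrak{S}^n\subset\mathfrak{S}$ the subgroup fixing each of $1,\ldots,n$. Let $\mathbf{K}=\mathbf{k}(\xi_1,\xi_2,\ldots)$, on which $\mathfrak{S}$ acts by permuting variables. $\mathcal{A}$ is the category of smooth $\mathbf{K}$-semilinear representations of $\mathfrak{S}$: $\mathbf{K}$-vector spaces $M$ with an additive action of $\mathfrak{S}$ satisfying $\sigma(av)=(\sigma a)(\sigma v)$, such that every $v\in M$ is fixed by $\mathfrak{S}^n$ for some $n$. Morphisms are $\mathbf{K}$-linear $\mathfrak{S}$-equivariant maps. $M$ is finitely generated if it is the $\mathbf{K}$-span of the $\mathfrak{S}$-orbits of finitely many elements. $\mathbf{I}^r=\mathbf{K}\otimes_{\mathbf{k}}\mathbf{V}^r$, where $\mathbf{V}^r$ is the $\mathbf{k}$-vector space with basis $\{e_S\}$ indexed by the $r$-element subsets $S$ of $\{1,2,\ldots\}$, permuted by $\mathfrak{S}$. *)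

theory Defs
  imports
    "HOL-Combinatorics.Perm"
    "HOL-Library.Poly_Mapping"
    "HOL-Computational_Algebra.Fraction_Field"
    "HOL-Algebra.Free_Abelian_Groups"
    "HOL-Algebra.Generated_Groups"
    "HOL-Algebra.AbelCoset"
    "HOL-Algebra.Module"
    "HOL-Algebra.Algebraic_Closure_Type"
begin

text \<open>Variables are indexed from 0: index \<open>i\<close> stands for $\xi_{i+1}$, and the infinite symmetric group
  is the type \<open>nat perm\<close> of finitary permutations of the index set.\<close>

type_synonym 'k mpoly = "(nat \<Rightarrow>\<^sub>0 nat) \<Rightarrow>\<^sub>0 'k"

type_synonym 'k ratfun = "'k mpoly fract"

definition ratvar :: "nat \<Rightarrow> 'k::field ratfun" where
  "ratvar i = Fract (Poly_Mapping.single (Poly_Mapping.single i 1) 1) 1"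

definition ratconst :: "'k::field \<Rightarrow> 'k ratfun" where
  "ratconst c = Fract (Poly_Mapping.single 0 c) 1"

text \<open>The action sends $\xi_i$ to $\xi_{\sigma(i)}$, so exponents are precomposed with $\sigma^{-1}$; see
  \<open>perm_ratfun_ratvar\<close>.\<close>

definition perm_mon :: "nat perm \<Rightarrow> (nat \<Rightarrow>\<^sub>0 nat) \<Rightarrow> (nat \<Rightarrow>\<^sub>0 nat)" where
  "perm_mon \<sigma> = Poly_Mapping.map_key (Perm.apply (inverse \<sigma>))"

definition perm_mpoly :: "nat perm \<Rightarrow> 'k::field mpoly \<Rightarrow> 'k mpoly" where
  "perm_mpoly \<sigma> = Poly_Mapping.map_key (perm_mon (inverse \<sigma>))"

lemma inj_apply: "inj (Perm.apply \<sigma>)"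
  by (simp add: bij_is_inj)

lemma lookup_perm_mon: "Poly_Mapping.lookup (perm_mon \<sigma> m) i = Poly_Mapping.lookup m (Perm.apply (inverse \<sigma>) i)"
  by (simp add: perm_mon_def map_key.rep_eq inj_apply)

lemma perm_mon_one [simp]: "perm_mon 1 m = m"
  by (rule poly_mapping_eqI) (simp add: lookup_perm_mon)

lemma perm_mon_times: "perm_mon (\<sigma> * \<tau>) m = perm_mon \<sigma> (perm_mon \<tau> m)"
  by (rule poly_mapping_eqI) (simp add: lookup_perm_mon apply_times)

lemma perm_mon_inverse [simp]:
  "perm_mon \<sigma> (perm_mon (inverse \<sigma>) m) = m" "perm_mon (inverse \<sigma>) (perm_mon \<sigma> m) = m"
  by (simp_all flip: perm_mon_times)

lemma perm_mon_add: "perm_mon \<sigma> (m + n) = perm_mon \<sigma> m + perm_mon \<sigma> n"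
  by (rule poly_mapping_eqI) (simp add: lookup_perm_mon lookup_add)

lemma bij_perm_mon: "bij (perm_mon \<sigma>)"
  by (rule o_bij[where g = "perm_mon (inverse \<sigma>)"]) (simp_all add: fun_eq_iff)

lemma inj_perm_mon: "inj (perm_mon \<sigma>)"
  by (rule bij_is_inj[OF bij_perm_mon])

lemma lookup_perm_mpoly: "Poly_Mapping.lookup (perm_mpoly \<sigma> p) m = Poly_Mapping.lookup p (perm_mon (inverse \<sigma>) m)"
  by (simp add: perm_mpoly_def map_key.rep_eq inj_perm_mon)

lemma perm_mpoly_one [simp]: "perm_mpoly 1 p = p"
  by (rule poly_mapping_eqI) (simp add: lookup_perm_mpoly)

lemma perm_mpoly_times: "perm_mpoly (\<sigma> * \<tau>) p = perm_mpoly \<sigma> (perm_mpoly \<tau> p)"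
  by (rule poly_mapping_eqI) (simp add: lookup_perm_mpoly perm_mon_times)

lemma perm_mpoly_zero [simp]: "perm_mpoly \<sigma> 0 = 0"
  by (rule poly_mapping_eqI) (simp add: lookup_perm_mpoly)

lemma perm_mpoly_add: "perm_mpoly \<sigma> (p + q) = perm_mpoly \<sigma> p + perm_mpoly \<sigma> q"
  by (rule poly_mapping_eqI) (simp add: lookup_perm_mpoly lookup_add)

lemma perm_mpoly_single:
  "perm_mpoly \<sigma> (Poly_Mapping.single m c) = Poly_Mapping.single (perm_mon \<sigma> m) c"
  by (rule poly_mapping_eqI) (auto simp: lookup_perm_mpoly lookup_single when_def)

lemma perm_mon_zero [simp]: "perm_mon \<sigma> 0 = 0"
  by (rule poly_mapping_eqI) (simp add: lookup_perm_mon)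

lemma perm_mon_single [simp]:
  "perm_mon \<sigma> (Poly_Mapping.single i n) = Poly_Mapping.single (Perm.apply \<sigma> i) n"
  by (rule poly_mapping_eqI)
    (auto simp: lookup_perm_mon lookup_single when_def apply_inverse inv_f_eq inj_apply
        bij_inv_eq_iff[OF bij_apply])

lemma perm_mpoly_1 [simp]: "perm_mpoly \<sigma> 1 = 1"
  by (simp add: perm_mpoly_single flip: single_one)

lemma perm_mpoly_mult: "perm_mpoly \<sigma> (p * q) = perm_mpoly \<sigma> p * perm_mpoly \<sigma> q"
proof (rule poly_mapping_eqI)
  fix m
  let ?h = "perm_mon (inverse \<sigma>)"
  have bij: "bij ?h" by (rule bij_perm_mon)
  have "Poly_Mapping.lookup (perm_mpoly \<sigma> (p * q)) m =
      (\<Sum>l. Poly_Mapping.lookup p l * (\<Sum>n. (Poly_Mapping.lookup q n when ?h m = l + n)))"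
    by (simp add: lookup_perm_mpoly times_poly_mapping.rep_eq prod_fun_def)
  also have "\<dots> = (\<Sum>l. Poly_Mapping.lookup p (?h l) * (\<Sum>n. (Poly_Mapping.lookup q n when ?h m = ?h l + n)))"
    by (rule Sum_any.reindex_cong[OF bij]) (simp add: fun_eq_iff)
  also have "\<dots> = (\<Sum>l. Poly_Mapping.lookup p (?h l) *
      (\<Sum>n. (Poly_Mapping.lookup q (?h n) when ?h m = ?h l + ?h n)))"
  proof (rule arg_cong[where f = Sum_any], rule ext)
    fix l
    have "(\<Sum>n. (Poly_Mapping.lookup q n when ?h m = ?h l + n)) =
        (\<Sum>n. (Poly_Mapping.lookup q (?h n) when ?h m = ?h l + ?h n))"
      by (rule Sum_any.reindex_cong[OF bij]) (simp add: fun_eq_iff)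
    then show "Poly_Mapping.lookup p (?h l) * (\<Sum>n. (Poly_Mapping.lookup q n when ?h m = ?h l + n)) =
        Poly_Mapping.lookup p (?h l) * (\<Sum>n. (Poly_Mapping.lookup q (?h n) when ?h m = ?h l + ?h n))"
      by simp
  qed
  also have "\<dots> = Poly_Mapping.lookup (perm_mpoly \<sigma> p * perm_mpoly \<sigma> q) m"
    by (simp add: lookup_perm_mpoly times_poly_mapping.rep_eq prod_fun_def
        inj_eq[OF inj_perm_mon] flip: perm_mon_add)
  finally show "Poly_Mapping.lookup (perm_mpoly \<sigma> (p * q)) m = Poly_Mapping.lookup (perm_mpoly \<sigma> p * perm_mpoly \<sigma> q) m" .
qed

lemma perm_mpoly_eq_0_iff [simp]: "perm_mpoly \<sigma> p = 0 \<longleftrightarrow> p = 0"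
  by (metis perm.left_inverse perm_mpoly_one perm_mpoly_times perm_mpoly_zero)

text \<open>Well defined by \<open>perm_ratfun_Fract\<close>.\<close>

definition perm_ratfun :: "nat perm \<Rightarrow> 'k::field ratfun \<Rightarrow> 'k ratfun" where
  "perm_ratfun \<sigma> a =
    (THE b. \<exists>p q. q \<noteq> 0 \<and> a = Fract p q \<and> b = Fract (perm_mpoly \<sigma> p) (perm_mpoly \<sigma> q))"

lemma perm_ratfun_Fract:
  assumes "q \<noteq> 0"
  shows "perm_ratfun \<sigma> (Fract p q) = Fract (perm_mpoly \<sigma> p) (perm_mpoly \<sigma> q)"
  unfolding perm_ratfun_def
proof (rule the_equality)
  show "\<exists>p' q'. q' \<noteq> 0 \<and> Fract p q = Fract p' q' \<and>
      Fract (perm_mpoly \<sigma> p) (perm_mpoly \<sigma> q) = Fract (perm_mpoly \<sigma> p') (perm_mpoly \<sigma> q')"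
    using assms by blast
next
  fix b
  assume "\<exists>p' q'. q' \<noteq> 0 \<and> Fract p q = Fract p' q' \<and>
      b = Fract (perm_mpoly \<sigma> p') (perm_mpoly \<sigma> q')"
  then show "b = Fract (perm_mpoly \<sigma> p) (perm_mpoly \<sigma> q)"
    using assms by (auto simp: eq_fract simp flip: perm_mpoly_mult)
qed

lemma perm_ratfun_ratvar: "perm_ratfun \<sigma> (ratvar i) = ratvar (Perm.apply \<sigma> i)"
  by (simp add: ratvar_def perm_ratfun_Fract perm_mpoly_single)

lemma perm_ratfun_ratconst: "perm_ratfun \<sigma> (ratconst c) = ratconst c"
  by (simp add: ratconst_def perm_ratfun_Fract perm_mpoly_single)

lemma perm_ratfun_add: "perm_ratfun \<sigma> (a + b) = perm_ratfun \<sigma> a + perm_ratfun \<sigma> b"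
  by (cases a, cases b) (simp add: perm_ratfun_Fract perm_mpoly_add perm_mpoly_mult)

lemma perm_ratfun_mult: "perm_ratfun \<sigma> (a * b) = perm_ratfun \<sigma> a * perm_ratfun \<sigma> b"
  by (cases a, cases b) (simp add: perm_ratfun_Fract perm_mpoly_mult)

lemma perm_ratfun_1 [simp]: "perm_ratfun \<sigma> 1 = 1"
  by (simp add: One_fract_def perm_ratfun_Fract)

lemma perm_ratfun_0 [simp]: "perm_ratfun \<sigma> 0 = 0"
  by (simp add: Zero_fract_def perm_ratfun_Fract)

lemma perm_ratfun_one [simp]: "perm_ratfun 1 a = a"
  by (cases a) (simp add: perm_ratfun_Fract)

lemma perm_ratfun_times: "perm_ratfun (\<sigma> * \<tau>) a = perm_ratfun \<sigma> (perm_ratfun \<tau> a)"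
  by (cases a) (simp add: perm_ratfun_Fract perm_mpoly_times)

text \<open>With indices from 0, the pointwise stabiliser of the first \<open>n\<close> indices.\<close>

definition sym_fix :: "nat \<Rightarrow> nat perm set" where
  "sym_fix n = {\<sigma>. \<forall>i<n. Perm.apply \<sigma> i = i}"

lemma sym_fix_inverse: "\<sigma> \<in> sym_fix n \<Longrightarrow> inverse \<sigma> \<in> sym_fix n"
  by (simp add: sym_fix_def apply_inverse inv_f_eq inj_apply)

lemma sym_fix_mono: "n \<le> m \<Longrightarrow> sym_fix m \<subseteq> sym_fix n"
  by (auto simp: sym_fix_def)

lemma perm_mon_fix:
  assumes "Poly_Mapping.keys m \<subseteq> {..<n}" "\<sigma> \<in> sym_fix n"
  shows "perm_mon \<sigma> m = m"
proof (rule poly_mapping_eqI)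
  fix i
  have "Perm.apply (inverse \<sigma>) i = i" if "i < n"
    using sym_fix_inverse[OF assms(2)] that by (simp add: sym_fix_def)
  moreover have "\<not> Perm.apply (inverse \<sigma>) i < n" if "\<not> i < n"
  proof
    assume "Perm.apply (inverse \<sigma>) i < n"
    then have "Perm.apply \<sigma> (Perm.apply (inverse \<sigma>) i) = Perm.apply (inverse \<sigma>) i"
      using assms(2) by (auto simp: sym_fix_def)
    then show False
      using that \<open>Perm.apply (inverse \<sigma>) i < n\<close> by (simp add: apply_sequence)
  qed
  moreover have "Poly_Mapping.lookup m j = 0" if "\<not> j < n" for j
    using assms(1) that by (auto simp flip: not_in_keys_iff_lookup_eq_zero)
  ultimately show "Poly_Mapping.lookup (perm_mon \<sigma> m) i = Poly_Mapping.lookup m i"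
    unfolding lookup_perm_mon by (cases "i < n") simp_all
qed

lemma smooth_mpoly: "\<exists>n. \<forall>\<sigma>\<in>sym_fix n. perm_mpoly \<sigma> p = p"
proof -
  define n where "n = Suc (Max (\<Union> (Poly_Mapping.keys ` Poly_Mapping.keys p)))"
  have n: "Poly_Mapping.keys m \<subseteq> {..<n}" if "m \<in> Poly_Mapping.keys p" for m
    using that by (auto simp: n_def less_Suc_eq_le intro!: Max_ge)
  have "perm_mpoly \<sigma> p = p" if "\<sigma> \<in> sym_fix n" for \<sigma>
  proof (rule poly_mapping_eqI)
    fix m
    let ?m = "perm_mon (inverse \<sigma>) m"
    show "Poly_Mapping.lookup (perm_mpoly \<sigma> p) m = Poly_Mapping.lookup p m"
    proof (cases "m \<in> Poly_Mapping.keys p \<or> ?m \<in> Poly_Mapping.keys p")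
      case True
      then have "?m = m"
        by (metis n perm_mon_fix perm_mon_inverse(1) sym_fix_inverse that)
      then show ?thesis by (simp add: lookup_perm_mpoly)
    qed (simp add: lookup_perm_mpoly in_keys_iff)
  qed
  then show ?thesis by blast
qed

lemma smooth_ratfun: "\<exists>n. \<forall>\<sigma>\<in>sym_fix n. perm_ratfun \<sigma> a = a"
proof (cases a)
  case (Fract p q)
  obtain n1 n2 where n: "\<forall>\<sigma>\<in>sym_fix n1. perm_mpoly \<sigma> p = p" "\<forall>\<sigma>\<in>sym_fix n2. perm_mpoly \<sigma> q = q"
    using smooth_mpoly[of p] smooth_mpoly[of q] by blast
  have "perm_ratfun \<sigma> a = a" if "\<sigma> \<in> sym_fix (max n1 n2)" for \<sigma>
  proof -
    have "\<sigma> \<in> sym_fix n1" "\<sigma> \<in> sym_fix n2"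
      using that sym_fix_mono[of n1 "max n1 n2"] sym_fix_mono[of n2 "max n1 n2"] by auto
    then show ?thesis using n Fract by (simp add: perm_ratfun_Fract)
  qed
  then show ?thesis by blast
qed

text \<open>As always for HOL-Algebra modules, the fields \<open>mult\<close> and \<open>one\<close> of the record are not used.\<close>

record ('a, 'v) sym_module = "('a, 'v) module" +
  act :: "nat perm \<Rightarrow> 'v \<Rightarrow> 'v"

locale smooth_rep = module "ring_of_type_algebra :: 'k::field ratfun ring" M
  for M :: "('k::field ratfun, 'v) sym_module" (structure) +
  assumes act_closed: "v \<in> carrier M \<Longrightarrow> act M g v \<in> carrier M"
    and act_one: "v \<in> carrier M \<Longrightarrow> act M 1 v = v"
    and act_times: "v \<in> carrier M \<Longrightarrow> act M (g * h) v = act M g (act M h v)"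
    and act_add: "\<lbrakk>v \<in> carrier M; w \<in> carrier M\<rbrakk> \<Longrightarrow> act M g (v \<oplus> w) = act M g v \<oplus> act M g w"
    and act_smult: "v \<in> carrier M \<Longrightarrow> act M g (a \<odot> v) = perm_ratfun g a \<odot> act M g v"
    and smooth: "v \<in> carrier M \<Longrightarrow> \<exists>n. \<forall>g\<in>sym_fix n. act M g v = v"

definition fin_gen :: "('k::field ratfun, 'v) sym_module \<Rightarrow> bool" where
  "fin_gen M \<longleftrightarrow> (\<exists>F. finite F \<and> F \<subseteq> carrier M \<and>
    (\<lambda>H. submodule H ring_of_type_algebra M) hull {act M \<sigma> v |\<sigma> v. v \<in> F} = carrier M)"

definition rep_hom ::
    "('k::field ratfun, 'v) sym_module \<Rightarrow> ('k ratfun, 'w) sym_module \<Rightarrow> ('v \<Rightarrow> 'w) set" where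
  "rep_hom M N = {f \<in> hom (add_monoid M) (add_monoid N).
    (\<forall>a. \<forall>v\<in>carrier M. f (a \<odot>\<^bsub>M\<^esub> v) = a \<odot>\<^bsub>N\<^esub> f v) \<and>
    (\<forall>\<sigma>. \<forall>v\<in>carrier M. f (act M \<sigma> v) = act N \<sigma> (f v))}"

definition rep_iso ::
    "('k::field ratfun, 'v) sym_module \<Rightarrow> ('k ratfun, 'w) sym_module \<Rightarrow> bool" where
  "rep_iso M N \<longleftrightarrow> (\<exists>f\<in>rep_hom M N. bij_betw f (carrier M) (carrier N))"

text \<open>Exactness on underlying sets.  It is exactness in the category of finitely generated objects
  because that category is closed under subobjects and quotients.\<close>

definition short_exact ::
    "('k::field ratfun, 'u) sym_module \<Rightarrow> ('k ratfun, 'v) sym_module \<Rightarrow> ('k ratfun, 'w) sym_module \<Rightarrow> bool" where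
  "short_exact L M N \<longleftrightarrow> (\<exists>f\<in>rep_hom L M. \<exists>g\<in>rep_hom M N.
    inj_on f (carrier L) \<and> f ` carrier L = a_kernel M N g \<and> g ` carrier M = carrier N)"

text \<open>The objects of the category of finitely generated smooth representations whose underlying set
  lies in the type \<open>'v\<close>.  Below \<open>'v\<close> is \<open>nat set \<Rightarrow>\<^sub>0 'k ratfun\<close>, which is large enough
  to contain every finitely generated smooth representation, on whatever type, up to isomorphism:
  see \<open>fg_rep_iso_in_universe\<close>.\<close>

definition fg_reps :: "('k::field ratfun, 'v) sym_module set" where
  "fg_reps = {M. smooth_rep M \<and> fin_gen M}"

text \<open>The Grothendieck group: the free abelian group on the objects modulo $[M] = [L] + [N]$ for every
  short exact sequence $0 \to L \to M \to N \to 0$.  The relations for $0 \to 0 \to M \to N \to 0$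
  identify isomorphic objects.  Quotient groups are written multiplicatively in HOL-Algebra.\<close>

definition groth_relations :: "(('k::field ratfun, 'v) sym_module \<Rightarrow>\<^sub>0 int) set" where
  "groth_relations = {frag_of M - (frag_of L + frag_of N) |L M N.
    L \<in> fg_reps \<and> M \<in> fg_reps \<and> N \<in> fg_reps \<and> short_exact L M N}"

definition groth_kernel :: "(('k::field ratfun, 'v) sym_module \<Rightarrow>\<^sub>0 int) set" where
  "groth_kernel = generate (free_Abelian_group fg_reps) groth_relations"

definition groth_group :: "(('k::field ratfun, 'v) sym_module \<Rightarrow>\<^sub>0 int) set monoid" where
  "groth_group = free_Abelian_group fg_reps Mod groth_kernel"

definition groth_class ::
    "('k::field ratfun, 'v) sym_module \<Rightarrow> (('k ratfun, 'v) sym_module \<Rightarrow>\<^sub>0 int) set" where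
  "groth_class M = groth_kernel #>\<^bsub>free_Abelian_group fg_reps\<^esub> frag_of M"

text \<open>A basis of the abelian group \<open>G\<close> over the integers, as a family: it generates \<open>G\<close> and is linearly
  independent.  Since \<open>G\<close> is multiplicative, $\sum_i c_i b_i$ becomes a product of powers.\<close>

definition Z_basis :: "('g, 'm) monoid_scheme \<Rightarrow> 'i set \<Rightarrow> ('i \<Rightarrow> 'g) \<Rightarrow> bool" where
  "Z_basis G I b \<longleftrightarrow> b \<in> I \<rightarrow> carrier G \<and> generate G (b ` I) = carrier G \<and>
    (\<forall>F (c::'i \<Rightarrow> int). finite F \<and> F \<subseteq> I \<and> finprod G (\<lambda>i. b i [^]\<^bsub>G\<^esub> c i) F = \<one>\<^bsub>G\<^esub>
      \<longrightarrow> (\<forall>i\<in>F. c i = 0))"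

definition r_subsets :: "nat \<Rightarrow> nat set set" where
  "r_subsets r = {S. finite S \<and> card S = r}"

definition V_rep :: "nat \<Rightarrow> ('k::field, nat set \<Rightarrow>\<^sub>0 'k) sym_module" where
  "V_rep r = \<lparr>carrier = {f. Poly_Mapping.keys f \<subseteq> r_subsets r}, monoid.mult = (\<lambda>_ _. 0), one = 0,
    zero = 0, add = (+), module.smult = (\<lambda>a. Poly_Mapping.map ((*) a)),
    act = (\<lambda>\<sigma>. Poly_Mapping.map_key ((`) (Perm.apply (inverse \<sigma>))))\<rparr>"

text \<open>$K \otimes_k V^r$ in coordinates: \<open>f\<close> stands for $\sum_S f(S) \otimes e_S$.  The map
  \<open>pure_tensor\<close> below is $(a, v) \mapsto a \otimes v$; it has the universal property of the tensor product
  (\<open>I_rep_tensor_universal\<close>), and \<open>K\<close> and the group act on pure tensors as they should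
  (\<open>pure_tensor_smult\<close>, \<open>pure_tensor_act\<close>).\<close>

definition I_rep :: "nat \<Rightarrow> ('k::field ratfun, nat set \<Rightarrow>\<^sub>0 'k ratfun) sym_module" where
  "I_rep r = \<lparr>carrier = {f. Poly_Mapping.keys f \<subseteq> r_subsets r}, monoid.mult = (\<lambda>_ _. 0), one = 0,
    zero = 0, add = (+), module.smult = (\<lambda>a. Poly_Mapping.map ((*) a)),
    act = (\<lambda>\<sigma> f. Poly_Mapping.map (perm_ratfun \<sigma>)
      (Poly_Mapping.map_key ((`) (Perm.apply (inverse \<sigma>))) f))\<rparr>"

lemma abelian_groth_group: "comm_group groth_group"
proof -
  interpret comm_group "free_Abelian_group fg_reps" by (rule abelian_free_Abelian_group)
  have "groth_relations \<subseteq> carrier (free_Abelian_group fg_reps)"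
    by (auto simp: groth_relations_def
        dest!: subsetD[OF keys_diff] subsetD[OF keys_add] split: if_splits)
  then show ?thesis
    unfolding groth_group_def groth_kernel_def
    by (intro abelian_FactGroup generate_is_subgroup)
qed

lemma groth_class_closed: "M \<in> fg_reps \<Longrightarrow> groth_class M \<in> carrier groth_group"
  unfolding groth_class_def groth_group_def
  by (auto simp: FactGroup_def RCOSETS_def intro!: bexI[where x = "frag_of M"])

lemma inj_image_perm: "inj ((`) (Perm.apply \<sigma>))"
  by (rule injI) (simp add: inj_image_eq_iff[OF inj_apply])

lemma sym_fix_image: "g \<in> sym_fix n \<Longrightarrow> A \<subseteq> {..<n} \<Longrightarrow> Perm.apply g ` A = A"
  by (subst image_cong[OF refl, where g = id]) (auto simp: sym_fix_def)

lemma lookup_smult: "Poly_Mapping.lookup (Poly_Mapping.map ((*) a) f) S = a * Poly_Mapping.lookup f S"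
  for a :: "'a::semiring_0"
  by (simp add: map.rep_eq when_def)

lemma lookup_act_I_rep: "Poly_Mapping.lookup (act (I_rep r) \<sigma> f) S =
    perm_ratfun \<sigma> (Poly_Mapping.lookup f (Perm.apply (inverse \<sigma>) ` S))"
  by (simp add: I_rep_def map.rep_eq map_key.rep_eq inj_image_perm when_def)

lemma image_r_subsets: "Perm.apply \<sigma> ` S \<in> r_subsets r \<longleftrightarrow> S \<in> r_subsets r"
  by (simp add: r_subsets_def finite_image_iff card_image inj_on_subset[OF inj_apply])

lemma module_I_rep: "module ring_of_type_algebra (I_rep r)"
proof (rule moduleI)
  show "cring (ring_of_type_algebra :: 'a ratfun ring)" by (rule cring_from_type_algebra)
  show "abelian_group (I_rep r :: ('a ratfun, _) sym_module)"
  proof (rule abelian_groupI)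
    fix f :: "nat set \<Rightarrow>\<^sub>0 'a ratfun"
    assume "f \<in> carrier (I_rep r)"
    then show "\<exists>g\<in>carrier (I_rep r). g \<oplus>\<^bsub>I_rep r\<^esub> f = \<zero>\<^bsub>I_rep r\<^esub>"
      by (intro bexI[where x = "- f"]) (auto simp: I_rep_def)
  qed (use keys_add in \<open>fastforce simp: I_rep_def add_ac\<close>)+
qed (auto simp: I_rep_def ring_of_type_algebra_def in_keys_iff lookup_smult lookup_add algebra_simps
    intro!: poly_mapping_eqI)

lemma smooth_rep_I_rep: "smooth_rep (I_rep r)"
proof -
  interpret module ring_of_type_algebra "I_rep r :: ('a ratfun, _) sym_module"
    by (rule module_I_rep)
  show "smooth_rep (I_rep r :: ('a ratfun, _) sym_module)"
  proof
    fix f :: "nat set \<Rightarrow>\<^sub>0 'a ratfun" and \<sigma>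
    assume "f \<in> carrier (I_rep r)"
    then show "act (I_rep r) \<sigma> f \<in> carrier (I_rep r)"
      by (auto simp: I_rep_def image_r_subsets in_keys_iff map.rep_eq map_key.rep_eq inj_image_perm when_def
          dest!: subsetD[where A = "Poly_Mapping.keys f"] split: if_splits)
  next
    fix f :: "nat set \<Rightarrow>\<^sub>0 'a ratfun"
    show "act (I_rep r) 1 f = f"
      by (rule poly_mapping_eqI) (simp add: lookup_act_I_rep)
  next
    fix f :: "nat set \<Rightarrow>\<^sub>0 'a ratfun" and \<sigma> \<tau>
    show "act (I_rep r) (\<sigma> * \<tau>) f = act (I_rep r) \<sigma> (act (I_rep r) \<tau> f)"
      by (rule poly_mapping_eqI) (simp add: lookup_act_I_rep perm_ratfun_times image_image apply_times)
  next
    fix f g :: "nat set \<Rightarrow>\<^sub>0 'a ratfun" and \<sigma>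
    show "act (I_rep r) \<sigma> (f \<oplus>\<^bsub>I_rep r\<^esub> g) = act (I_rep r) \<sigma> f \<oplus>\<^bsub>I_rep r\<^esub> act (I_rep r) \<sigma> g"
    proof -
      have [simp]: "(\<oplus>\<^bsub>I_rep r\<^esub>) = ((+) :: _ \<Rightarrow> _ \<Rightarrow> nat set \<Rightarrow>\<^sub>0 'a ratfun)"
        by (simp add: I_rep_def)
      show ?thesis
        by (rule poly_mapping_eqI) (simp add: lookup_act_I_rep lookup_add perm_ratfun_add)
    qed
  next
    fix f :: "nat set \<Rightarrow>\<^sub>0 'a ratfun" and \<sigma> a
    show "act (I_rep r) \<sigma> (a \<odot>\<^bsub>I_rep r\<^esub> f) = perm_ratfun \<sigma> a \<odot>\<^bsub>I_rep r\<^esub> act (I_rep r) \<sigma> f"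
    proof -
      have [simp]: "(\<odot>\<^bsub>I_rep r\<^esub>) = (\<lambda>a::'a ratfun. Poly_Mapping.map ((*) a))"
        by (simp add: I_rep_def)
      show ?thesis
        by (rule poly_mapping_eqI) (simp add: lookup_act_I_rep lookup_smult perm_ratfun_mult)
    qed
  next
    fix f :: "nat set \<Rightarrow>\<^sub>0 'a ratfun"
    define m where "m = Suc (Max (\<Union> (Poly_Mapping.keys f)))"
    have keys: "S \<subseteq> {..<m}" if "S \<in> Poly_Mapping.keys f" "f \<in> carrier (I_rep r)" for S
    proof -
      have "finite (\<Union> (Poly_Mapping.keys f))"
        using that(2) by (auto simp: I_rep_def r_subsets_def)
      then show ?thesis
        using that(1) by (auto simp: m_def less_Suc_eq_le intro!: Max_ge)
    qed
    have "\<exists>n. \<forall>\<sigma>\<in>sym_fix n. \<forall>S\<in>A. perm_ratfun \<sigma> (Poly_Mapping.lookup f S) = Poly_Mapping.lookup f S"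
      if "finite A" for A
      using that
    proof induction
      case (insert S A)
      then obtain n1 n2
        where "\<forall>\<sigma>\<in>sym_fix n1. \<forall>S\<in>A. perm_ratfun \<sigma> (Poly_Mapping.lookup f S) = Poly_Mapping.lookup f S"
          "\<forall>\<sigma>\<in>sym_fix n2. perm_ratfun \<sigma> (Poly_Mapping.lookup f S) = Poly_Mapping.lookup f S"
        using smooth_ratfun by blast
      then show ?case
        using sym_fix_mono[of n1 "max n1 n2"] sym_fix_mono[of n2 "max n1 n2"]
        by (intro exI[of _ "max n1 n2"]) auto
    qed auto
    then obtain n where n: "\<And>\<sigma> S. \<sigma> \<in> sym_fix n \<Longrightarrow> S \<in> Poly_Mapping.keys f \<Longrightarrow>
        perm_ratfun \<sigma> (Poly_Mapping.lookup f S) = Poly_Mapping.lookup f S"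
      by (metis finite_keys)
    assume f: "f \<in> carrier (I_rep r)"
    have "act (I_rep r) \<sigma> f = f" if \<sigma>: "\<sigma> \<in> sym_fix (max m n)" for \<sigma>
    proof (rule poly_mapping_eqI)
      fix S
      let ?T = "Perm.apply (inverse \<sigma>) ` S"
      have \<sigma>': "inverse \<sigma> \<in> sym_fix m" "\<sigma> \<in> sym_fix m" "\<sigma> \<in> sym_fix n"
        using \<sigma> sym_fix_mono[of m "max m n"] sym_fix_mono[of n "max m n"] sym_fix_inverse by auto
      show "Poly_Mapping.lookup (act (I_rep r) \<sigma> f) S = Poly_Mapping.lookup f S"
      proof (cases "S \<in> Poly_Mapping.keys f \<or> ?T \<in> Poly_Mapping.keys f")
        case True
        have "?T = S"
        proof (cases "S \<in> Poly_Mapping.keys f")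
          case True
          then show ?thesis using keys[OF True f] \<sigma>'(1) by (rule_tac sym_fix_image)
        next
          case False
          with True have "?T \<subseteq> {..<m}" using keys f by blast
          then have "Perm.apply \<sigma> ` ?T = ?T"
            using \<sigma>'(2) by (rule_tac sym_fix_image)
          then show ?thesis by (simp add: image_image apply_sequence)
        qed
        then show ?thesis using True n[OF \<sigma>'(3)] by (auto simp: lookup_act_I_rep)
      qed (simp add: lookup_act_I_rep in_keys_iff)
    qed
    then show "\<exists>n. \<forall>\<sigma>\<in>sym_fix n. act (I_rep r) \<sigma> f = f" by blast
  qed
qed

lemma ex_perm_image:
  assumes "finite A" "finite B" "card A = card B"
  shows "\<exists>g. Perm.apply g ` A = B"
proof -
  define N where "N = A \<union> B"
  have N: "finite N" "A \<subseteq> N" "B \<subseteq> N" using assms by (auto simp: N_def)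
  obtain f where f: "bij_betw f A B"
    using assms finite_same_card_bij by blast
  have "card (N - A) = card (N - B)"
    using assms N by (simp add: card_Diff_subset)
  then obtain h where h: "bij_betw h (N - A) (N - B)"
    using finite_same_card_bij[of "N - A" "N - B"] N by blast
  define p where "p x = (if x \<in> N then if x \<in> A then f x else h x else x)" for x
  have "bij_betw p A B" using f N by (subst bij_betw_cong[where g = f]) (auto simp: p_def)
  moreover have "bij_betw p (N - A) (N - B)"
    using h by (subst bij_betw_cong[where g = h]) (auto simp: p_def)
  ultimately have "bij_betw p (A \<union> (N - A)) (B \<union> (N - B))"
    by (rule bij_betw_combine) auto
  then have "bij_betw p N N" using N by (simp add: Un_absorb1)
  moreover have "bij_betw p (- N) (- N)"
    by (subst bij_betw_cong[where g = id]) (auto simp: p_def)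
  ultimately have "bij_betw p (N \<union> - N) (N \<union> - N)"
    by (rule bij_betw_combine) auto
  then have "bij p" by simp
  moreover have "finite {x. p x \<noteq> x}"
    by (rule finite_subset[OF _ N(1)]) (auto simp: p_def)
  ultimately have "Perm.apply (Perm p) = p" by (simp add: Perm_inverse)
  then show ?thesis
    using \<open>bij_betw p A B\<close> by (intro exI[where x = "Perm p"]) (simp add: bij_betw_def)
qed

lemma act_I_rep_single: "act (I_rep r) g (Poly_Mapping.single S a) =
    Poly_Mapping.single (Perm.apply g ` S) (perm_ratfun g a)"
proof (rule poly_mapping_eqI)
  fix T
  have "Perm.apply (inverse g) ` T = S \<longleftrightarrow> Perm.apply g ` S = T"
    by (auto simp: image_image apply_sequence)
  then show "Poly_Mapping.lookup (act (I_rep r) g (Poly_Mapping.single S a)) T =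
      Poly_Mapping.lookup (Poly_Mapping.single (Perm.apply g ` S) (perm_ratfun g a)) T"
    by (auto simp: lookup_act_I_rep lookup_single when_def)
qed

lemma poly_mapping_eq_sum: "f = (\<Sum>S\<in>Poly_Mapping.keys f. Poly_Mapping.single S (Poly_Mapping.lookup f S))"
proof (rule poly_mapping_eqI)
  fix T
  show "Poly_Mapping.lookup f T = Poly_Mapping.lookup (\<Sum>S\<in>Poly_Mapping.keys f. Poly_Mapping.single S (Poly_Mapping.lookup f S)) T"
    by (simp add: lookup_sum lookup_single when_def in_keys_iff)
qed

lemma map_times_single: "Poly_Mapping.map ((*) a) (Poly_Mapping.single S b) = Poly_Mapping.single S (a * b)"
  for a :: "'a::semiring_0"
  by (rule poly_mapping_eqI) (simp add: lookup_smult lookup_single when_def)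

lemma I_rep_in_fg_reps: "I_rep r \<in> fg_reps"
proof -
  let ?M = "I_rep r :: ('a ratfun, _) sym_module"
  let ?e = "\<lambda>S. Poly_Mapping.single S (1::'a ratfun)"
  let ?O = "{act ?M g v |g v. v \<in> {?e {..<r}}}"
  interpret smooth_rep ?M by (rule smooth_rep_I_rep)
  have e: "?e {..<r} \<in> carrier ?M" by (simp add: I_rep_def r_subsets_def)
  have "carrier ?M \<subseteq> H" if H: "submodule H ring_of_type_algebra ?M" "?O \<subseteq> H" for H
  proof
    fix f
    assume "f \<in> carrier ?M"
    then have f: "Poly_Mapping.keys f \<subseteq> r_subsets r" by (simp add: I_rep_def)
    have eS: "?e S \<in> H" if "S \<in> r_subsets r" for S
    proof -
      obtain g where "Perm.apply g ` {..<r} = S"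
        using ex_perm_image[of "{..<r}" S] \<open>S \<in> r_subsets r\<close> by (auto simp: r_subsets_def)
      then have "act ?M g (?e {..<r}) = ?e S" by (simp add: act_I_rep_single)
      then have "?e S \<in> ?O" by (metis (mono_tags, lifting) mem_Collect_eq singletonI)
      then show ?thesis using H(2) by blast
    qed
    have "Poly_Mapping.single S a \<in> H" if "S \<in> r_subsets r" for S a
      using submodule.smult_closed[OF H(1), of a "?e S"] eS[OF that]
      by (simp add: ring_of_type_algebra_def I_rep_def map_times_single)
    note eH = this
    have addH: "u + v \<in> H" if "u \<in> H" "v \<in> H" for u v
      using submoduleE(5)[OF H(1)] that by (simp add: I_rep_def)
    have zeroH: "0 \<in> H"
      using subgroup.one_closed[OF submodule.axioms(1)[OF H(1)]] by (simp add: I_rep_def)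
    have "(\<Sum>S\<in>A. Poly_Mapping.single S (Poly_Mapping.lookup f S)) \<in> H"
      if "finite A" "A \<subseteq> r_subsets r" for A
      using that(1,2)
    proof (induction rule: finite_induct)
      case (insert S A)
      then show ?case using eH addH by simp
    qed (simp add: zeroH)
    then show "f \<in> H" by (subst poly_mapping_eq_sum) (use f in auto)
  qed
  moreover have "?O \<subseteq> carrier ?M" using e act_closed by auto
  ultimately have "(\<lambda>H. submodule H ring_of_type_algebra ?M) hull ?O = carrier ?M"
    by (intro hull_unique carrier_is_submodule) auto
  then have "fin_gen ?M"
    unfolding fin_gen_def using e by (intro exI[where x = "{?e {..<r}}"]) auto
  then show ?thesis by (simp add: fg_reps_def smooth_rep_axioms)
qed

definition pure_tensor :: "'k::field ratfun \<Rightarrow> (nat set \<Rightarrow>\<^sub>0 'k) \<Rightarrow> (nat set \<Rightarrow>\<^sub>0 'k ratfun)" where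
  "pure_tensor a v = Poly_Mapping.map (\<lambda>c. a * ratconst c) v"

lemma ratconst_0 [simp]: "ratconst 0 = 0"
  and ratconst_1 [simp]: "ratconst 1 = 1"
  and ratconst_add: "ratconst (c + d) = ratconst c + ratconst d"
  and ratconst_mult: "ratconst (c * d) = ratconst c * ratconst d"
  by (simp_all add: ratconst_def Zero_fract_def One_fract_def single_add mult_single)

lemma ratconst_eq_0_iff [simp]: "ratconst c = 0 \<longleftrightarrow> c = 0"
  by (auto simp: ratconst_def Zero_fract_def eq_fract dest: arg_cong[where f = "\<lambda>p. Poly_Mapping.lookup p 0"])

lemma lookup_pure_tensor:
  "Poly_Mapping.lookup (pure_tensor a v) S = a * ratconst (Poly_Mapping.lookup v S)"
  by (simp add: pure_tensor_def map.rep_eq when_def)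

lemma pure_tensor_closed: "v \<in> carrier (V_rep r) \<Longrightarrow> pure_tensor a v \<in> carrier (I_rep r)"
  by (auto simp: V_rep_def I_rep_def in_keys_iff lookup_pure_tensor)

lemma pure_tensor_add_left: "pure_tensor (a + b) v = pure_tensor a v \<oplus>\<^bsub>I_rep r\<^esub> pure_tensor b v"
  by (rule poly_mapping_eqI) (simp add: I_rep_def lookup_add lookup_pure_tensor algebra_simps)

lemma pure_tensor_add_right:
  "pure_tensor a (v \<oplus>\<^bsub>V_rep r\<^esub> w) = pure_tensor a v \<oplus>\<^bsub>I_rep r\<^esub> pure_tensor a w"
  by (rule poly_mapping_eqI)
    (simp add: I_rep_def V_rep_def lookup_add lookup_pure_tensor ratconst_add algebra_simps)

lemma pure_tensor_balanced: "pure_tensor (a * ratconst c) v = pure_tensor a (c \<odot>\<^bsub>V_rep r\<^esub> v)"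
  by (rule poly_mapping_eqI)
    (simp add: V_rep_def lookup_pure_tensor lookup_smult ratconst_mult algebra_simps)

lemma pure_tensor_smult: "pure_tensor (a * b) v = a \<odot>\<^bsub>I_rep r\<^esub> pure_tensor b v"
  by (rule poly_mapping_eqI) (simp add: I_rep_def lookup_pure_tensor lookup_smult)

lemma pure_tensor_act: "act (I_rep r) g (pure_tensor a v) =
    pure_tensor (perm_ratfun g a) (act (V_rep r) g v)"
  by (rule poly_mapping_eqI)
    (simp add: lookup_act_I_rep V_rep_def lookup_pure_tensor map_key.rep_eq inj_image_perm
      perm_ratfun_mult perm_ratfun_ratconst)

lemma I_rep_tensor_universal:
  fixes G :: "('g, 'm) monoid_scheme" (structure)
    and b :: "'k::field ratfun \<Rightarrow> (nat set \<Rightarrow>\<^sub>0 'k) \<Rightarrow> 'g"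
  assumes "comm_group G"
    and closed: "\<And>a v. v \<in> carrier (V_rep r) \<Longrightarrow> b a v \<in> carrier G"
    and left: "\<And>a a' v. v \<in> carrier (V_rep r) \<Longrightarrow> b (a + a') v = b a v \<otimes> b a' v"
    and right: "\<And>a v w. v \<in> carrier (V_rep r) \<Longrightarrow> w \<in> carrier (V_rep r) \<Longrightarrow>
      b a (v \<oplus>\<^bsub>V_rep r\<^esub> w) = b a v \<otimes> b a w"
    and balanced: "\<And>a c v. v \<in> carrier (V_rep r) \<Longrightarrow> b (a * ratconst c) v = b a (c \<odot>\<^bsub>V_rep r\<^esub> v)"
  shows "\<exists>!h. h \<in> hom (add_monoid (I_rep r)) G \<and> h \<in> extensional (carrier (I_rep r)) \<and>
    (\<forall>a. \<forall>v\<in>carrier (V_rep r). h (pure_tensor a v) = b a v)"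
proof (rule ex_ex1I)
  interpret comm_group G by fact
  let ?V = "V_rep r :: ('k, _) sym_module" and ?I = "I_rep r :: ('k ratfun, _) sym_module"
  let ?R = "r_subsets r"
  let ?e = "\<lambda>S. Poly_Mapping.single S (1::'k)"
  have V: "v \<in> carrier ?V \<longleftrightarrow> Poly_Mapping.keys v \<subseteq> ?R" for v by (simp add: V_rep_def)
  have I: "f \<in> carrier ?I \<longleftrightarrow> Poly_Mapping.keys f \<subseteq> ?R" for f by (simp add: I_rep_def)
  have e: "S \<in> ?R \<Longrightarrow> ?e S \<in> carrier ?V" for S by (simp add: V)
  have b0: "b 0 v = \<one>" if "v \<in> carrier ?V" for v
    using left[OF that, of 0 0] closed[OF that, of 0] by (simp add: r_cancel_one')
  have b0': "b a 0 = \<one>" for a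
    using right[of 0 0 a] closed[of 0 a] by (simp add: V_rep_def r_cancel_one')
  define h where "h = restrict (\<lambda>f. \<Otimes>S\<in>Poly_Mapping.keys f. b (Poly_Mapping.lookup f S) (?e S)) (carrier ?I)"
  have h: "h f = (\<Otimes>S\<in>A. b (Poly_Mapping.lookup f S) (?e S))"
    if "finite A" "Poly_Mapping.keys f \<subseteq> A" "A \<subseteq> ?R" for f A
  proof -
    have "(\<Otimes>S\<in>Poly_Mapping.keys f. b (Poly_Mapping.lookup f S) (?e S)) =
        (\<Otimes>S\<in>A. b (Poly_Mapping.lookup f S) (?e S))"
      by (rule finprod_mono_neutral_cong_left) (use that in \<open>auto simp: in_keys_iff b0 e closed\<close>)
    moreover have "f \<in> carrier ?I" using that by (auto simp: I)
    ultimately show ?thesis by (simp add: h_def)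
  qed
  have "h \<in> hom (add_monoid ?I) G"
  proof (rule homI)
    fix f g
    assume "f \<in> carrier (add_monoid ?I)" "g \<in> carrier (add_monoid ?I)"
    then have fg: "Poly_Mapping.keys f \<subseteq> ?R" "Poly_Mapping.keys g \<subseteq> ?R" by (simp_all add: I)
    let ?A = "Poly_Mapping.keys f \<union> Poly_Mapping.keys g"
    have "h (f + g) = (\<Otimes>S\<in>?A. b (Poly_Mapping.lookup (f + g) S) (?e S))"
      by (rule h) (use fg keys_add[of f g] in auto)
    also have "\<dots> = (\<Otimes>S\<in>?A. b (Poly_Mapping.lookup f S) (?e S) \<otimes> b (Poly_Mapping.lookup g S) (?e S))"
      by (rule finprod_cong') (use fg in \<open>auto simp: lookup_add left e closed\<close>)
    also have "\<dots> = (\<Otimes>S\<in>?A. b (Poly_Mapping.lookup f S) (?e S)) \<otimes> (\<Otimes>S\<in>?A. b (Poly_Mapping.lookup g S) (?e S))"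
      by (rule finprod_multf) (use fg in \<open>auto simp: e closed\<close>)
    also have "\<dots> = h f \<otimes> h g"
      using fg h[of ?A f] h[of ?A g] by auto
    finally show "h (f \<otimes>\<^bsub>add_monoid ?I\<^esub> g) = h f \<otimes> h g" by (simp add: I_rep_def)
  next
    fix f
    assume "f \<in> carrier (add_monoid ?I)"
    then show "h f \<in> carrier G"
      by (auto simp: h_def I intro!: finprod_closed closed e)
  qed
  moreover have "h (pure_tensor a v) = b a v" if v: "v \<in> carrier ?V" for a v
  proof -
    have *: "(\<Otimes>S\<in>A. b a (Poly_Mapping.single S (c S))) = b a (\<Sum>S\<in>A. Poly_Mapping.single S (c S)) \<and>
        Poly_Mapping.keys (\<Sum>S\<in>A. Poly_Mapping.single S (c S)) \<subseteq> ?R"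
      if "finite A" "A \<subseteq> ?R" for A and c :: "nat set \<Rightarrow> 'k"
      using that
    proof induction
      case (insert S A)
      let ?s = "Poly_Mapping.single S (c S)" and ?t = "\<Sum>S\<in>A. Poly_Mapping.single S (c S)"
      have st: "Poly_Mapping.keys ?s \<subseteq> ?R" "Poly_Mapping.keys ?t \<subseteq> ?R"
        using insert by auto
      have "(\<Otimes>S\<in>insert S A. b a (Poly_Mapping.single S (c S))) = b a ?s \<otimes> b a ?t"
        using insert by (subst finprod_insert) (auto intro!: closed simp: V)
      also have "\<dots> = b a (?s + ?t)"
        using right[of ?s ?t a] st by (simp add: V) (simp add: V_rep_def)
      finally show ?case
        using insert(1,2) st keys_add[of ?s ?t] by auto
    qed (simp add: b0')
    let ?K = "Poly_Mapping.keys v"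
    have vK: "?K \<subseteq> ?R" using v by (simp add: V)
    have "h (pure_tensor a v) = (\<Otimes>S\<in>?K. b (Poly_Mapping.lookup (pure_tensor a v) S) (?e S))"
      by (rule h) (use vK in \<open>auto simp: in_keys_iff lookup_pure_tensor\<close>)
    also have "\<dots> = (\<Otimes>S\<in>?K. b a (Poly_Mapping.single S (Poly_Mapping.lookup v S)))"
    proof (rule finprod_cong')
      fix S
      assume "S \<in> ?K"
      then have "S \<in> ?R" using vK by auto
      then show "b (Poly_Mapping.lookup (pure_tensor a v) S) (?e S) = b a (Poly_Mapping.single S (Poly_Mapping.lookup v S))"
        using balanced[OF e] by (simp add: lookup_pure_tensor) (simp add: V_rep_def map_times_single)
    qed (use vK in \<open>auto simp: V intro!: closed\<close>)
    also have "\<dots> = b a (\<Sum>S\<in>?K. Poly_Mapping.single S (Poly_Mapping.lookup v S))"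
      using *[OF _ vK] by simp
    also have "\<dots> = b a v" by (simp flip: poly_mapping_eq_sum)
    finally show ?thesis .
  qed
  ultimately show "\<exists>h. h \<in> hom (add_monoid ?I) G \<and> h \<in> extensional (carrier ?I) \<and>
      (\<forall>a. \<forall>v\<in>carrier ?V. h (pure_tensor a v) = b a v)"
    by (intro exI[where x = h]) (auto simp: h_def)
next
  interpret comm_group G by fact
  let ?V = "V_rep r :: ('k, _) sym_module" and ?I = "I_rep r :: ('k ratfun, _) sym_module"
  let ?R = "r_subsets r"
  fix h h'
  assume h: "h \<in> hom (add_monoid ?I) G \<and> h \<in> extensional (carrier ?I) \<and>
      (\<forall>a. \<forall>v\<in>carrier ?V. h (pure_tensor a v) = b a v)"
    and h': "h' \<in> hom (add_monoid ?I) G \<and> h' \<in> extensional (carrier ?I) \<and>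
      (\<forall>a. \<forall>v\<in>carrier ?V. h' (pure_tensor a v) = b a v)"
  have I: "f \<in> carrier ?I \<longleftrightarrow> Poly_Mapping.keys f \<subseteq> ?R" for f by (simp add: I_rep_def)
  have add: "k (f + g) = k f \<otimes> k g"
    if "k \<in> hom (add_monoid ?I) G" "f \<in> carrier ?I" "g \<in> carrier ?I" for k f g
    using hom_mult[OF that(1), of f g] that(2,3) by (simp add: I_rep_def)
  have zero: "k 0 = \<one>" if "k \<in> hom (add_monoid ?I) G" for k
    using add[OF that, of 0 0] hom_in_carrier[OF that, of 0] by (simp add: I r_cancel_one')
  have single: "h (Poly_Mapping.single S a) = h' (Poly_Mapping.single S a)" if "S \<in> ?R" for S a
  proof -
    have "Poly_Mapping.single S a = pure_tensor a (Poly_Mapping.single S (1::'k))"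
      by (rule poly_mapping_eqI) (simp add: lookup_pure_tensor lookup_single when_def)
    moreover have "Poly_Mapping.single S (1::'k) \<in> carrier ?V" using that by (simp add: V_rep_def)
    ultimately show ?thesis using h h' by simp
  qed
  have *: "h (\<Sum>S\<in>A. Poly_Mapping.single S (c S)) = h' (\<Sum>S\<in>A. Poly_Mapping.single S (c S)) \<and>
      Poly_Mapping.keys (\<Sum>S\<in>A. Poly_Mapping.single S (c S)) \<subseteq> ?R"
    if "finite A" "A \<subseteq> ?R" for A c
    using that
  proof induction
    case (insert S A)
    let ?s = "Poly_Mapping.single S (c S)" and ?t = "\<Sum>S\<in>A. Poly_Mapping.single S (c S)"
    have st: "Poly_Mapping.keys ?s \<subseteq> ?R" "Poly_Mapping.keys ?t \<subseteq> ?R" using insert by auto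
    then have "h (?s + ?t) = h' (?s + ?t)"
      using add[of h ?s ?t] add[of h' ?s ?t] h h' insert single[of S "c S"] by (simp add: I)
    then show ?case using insert(1,2) st keys_add[of ?s ?t] by auto
  qed (use zero[of h] zero[of h'] h h' in simp)
  show "h = h'"
  proof (rule extensionalityI)
    fix f
    assume "f \<in> carrier ?I"
    then show "h f = h' f"
      using *[of "Poly_Mapping.keys f" "Poly_Mapping.lookup f"] by (simp add: I flip: poly_mapping_eq_sum)
  qed (use h h' in auto)
qed

lemma Fract_1_eq_iff [simp]: "Fract p 1 = Fract q 1 \<longleftrightarrow> p = q"
  by (simp add: eq_fract)

lemma infinite_ratfun: "infinite (UNIV :: 'k::field ratfun set)"
proof -
  have "inj (ratvar :: nat \<Rightarrow> 'k ratfun)"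
  proof (rule injI)
    fix i j
    assume "ratvar i = (ratvar j :: 'k ratfun)"
    then have "Poly_Mapping.single (Poly_Mapping.single i 1) (1::'k) = Poly_Mapping.single (Poly_Mapping.single j (1::nat)) 1"
      by (simp add: ratvar_def)
    then have "Poly_Mapping.single i (1::nat) = Poly_Mapping.single j 1"
      by (metis keys_single singleton_inject zero_neq_one)
    then show "i = j"
      by (metis keys_single singleton_inject zero_neq_one)
  qed
  then show ?thesis using infinite_UNIV_nat finite_imageD by (metis finite_subset subset_UNIV)
qed

lemma perm_lepoll_ratfun: "\<exists>e :: nat perm \<Rightarrow> 'k::field ratfun. inj e"
proof -
  define m where "m g = Abs_poly_mapping (\<lambda>i. if Perm.apply g i = i then 0 else Suc (Perm.apply g i))" for g :: "nat perm"
  have m: "Poly_Mapping.lookup (m g) i = (if Perm.apply g i = i then 0 else Suc (Perm.apply g i))" for g i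
    unfolding m_def by (subst Abs_poly_mapping_inverse) (simp_all flip: affected.rep_eq)
  have "inj m"
  proof (rule injI)
    fix g h
    assume *: "m g = m h"
    show "g = h"
    proof (rule perm_eqI)
      fix i
      show "Perm.apply g i = Perm.apply h i"
        using arg_cong[OF *, of "\<lambda>x. Poly_Mapping.lookup x i"] by (auto simp: m split: if_splits)
    qed
  qed
  moreover have "inj (\<lambda>m. Fract (Poly_Mapping.single m (1::'k)) 1 :: 'k ratfun)"
    by (rule injI) (metis Fract_1_eq_iff keys_single singleton_inject zero_neq_one)
  ultimately show ?thesis by (metis inj_compose)
qed

lemma (in smooth_rep) fin_gen_small:
  assumes "fin_gen M"
  shows "\<exists>\<phi> :: 'v \<Rightarrow> (nat set \<Rightarrow>\<^sub>0 'k ratfun). inj_on \<phi> (carrier M)"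
proof -
  obtain F where F: "finite F" "F \<subseteq> carrier M"
    "(\<lambda>H. submodule H ring_of_type_algebra M) hull {act M g v |g v. v \<in> F} = carrier M"
    using assms by (auto simp: fin_gen_def)
  define v where "v = from_nat_into (insert \<zero> F)"
  have v: "range v = insert \<zero> F"
    unfolding v_def by (rule range_from_nat_into) (use F in \<open>auto intro: countable_finite\<close>)
  have vc: "v i \<in> carrier M" for i using rangeI[of v i] v F by auto
  define t where "t = (\<lambda>(a, g, i). a \<odot> act M g (v i))"
  define lc where "lc xs = foldr (\<lambda>x w. t x \<oplus> w) xs \<zero>" for xs
  have t: "t x \<in> carrier M" for x
    by (auto simp: t_def vc act_closed ring_of_type_algebra_def split: prod.split intro!: smult_closed)
  have lc: "lc xs \<in> carrier M" for xs by (induction xs) (auto simp: lc_def t)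
  have lc_Cons: "lc (x # xs) = t x \<oplus> lc xs" for x xs by (simp add: lc_def)
  have lc_append: "lc (xs @ ys) = lc xs \<oplus> lc ys" for xs ys
  proof (induction xs)
    case Nil
    show ?case using lc[of ys] by (simp add: lc_def[of "[]"])
  next
    case (Cons x xs)
    then show ?case by (simp add: lc_Cons lc t a_assoc)
  qed
  have tm: "a \<odot> t (b, g, i) = t (a * b, g, i)" for a b g i
    using smult_assoc1[of a b "act M g (v i)"] vc act_closed
    by (simp add: t_def ring_of_type_algebra_def)
  have lc_smult: "a \<odot> lc xs = lc (map (\<lambda>(b, g, i). (a * b, g, i)) xs)" for a xs
  proof (induction xs)
    case Nil
    show ?case by (simp add: lc_def ring_of_type_algebra_def)
  next
    case (Cons x xs)
    obtain b g i where "x = (b, g, i)" by (cases x)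
    with Cons show ?case
      using smult_r_distr[of a "t x" "lc xs"] lc t
      by (simp add: lc_Cons tm ring_of_type_algebra_def)
  qed
  have neg: "\<ominus> w = (- 1) \<odot> w" if "w \<in> carrier M" for w
  proof -
    have "(- 1) \<odot> w \<oplus> w = \<zero>"
      using smult_l_distr[of "-1" 1 w] smult_one[OF that] smult_l_null[OF that] that
      by (simp add: ring_of_type_algebra_def)
    then show ?thesis
      using that smult_closed[of "-1" w] minus_equality[of "(-1) \<odot> w" w]
      by (simp add: ring_of_type_algebra_def)
  qed
  have "submodule (range lc) ring_of_type_algebra M"
  proof (rule submoduleI)
    show "range lc \<subseteq> carrier M" using lc by auto
    show "\<zero> \<in> range lc" by (rule range_eqI[of _ _ "[]"]) (simp add: lc_def)
    show "\<ominus> a \<in> range lc" if "a \<in> range lc" for a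
      using that neg lc by (auto simp: lc_smult)
    show "a \<oplus> b \<in> range lc" if "a \<in> range lc" "b \<in> range lc" for a b
      using that by (auto simp flip: lc_append)
    show "a \<odot> x \<in> range lc" if "x \<in> range lc" for a x
      using that by (auto simp: lc_smult)
  qed
  moreover have "{act M g v |g v. v \<in> F} \<subseteq> range lc"
  proof clarify
    fix g w
    assume "w \<in> F"
    then obtain i where "w = v i" using v by (metis insertI2 rangeE)
    then have "act M g w = lc [(1, g, i)]"
      using vc act_closed smult_one[of "act M g w"]
      by (simp add: lc_def t_def ring_of_type_algebra_def)
    then show "act M g w \<in> range lc" by blast
  qed
  ultimately have sub: "carrier M \<subseteq> range lc"
    using F(3) hull_minimal[where S = "\<lambda>H. submodule H ring_of_type_algebra M"] by blast
  let ?K = "UNIV :: 'k ratfun set"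
  obtain e :: "nat perm \<Rightarrow> 'k ratfun" where e: "inj e" using perm_lepoll_ratfun by blast
  obtain n :: "nat \<Rightarrow> 'k ratfun" where n: "inj n"
    using infinite_ratfun infinite_countable_subset by blast
  have "inj (\<lambda>(a, g, i). (a, e g, n i))" using e n by (auto simp: inj_def)
  then have "|UNIV :: ('k ratfun \<times> nat perm \<times> nat) set| \<le>o |?K \<times> ?K \<times> ?K|"
    by (intro card_of_ordLeqI) auto
  also have "|?K \<times> ?K \<times> ?K| \<le>o |?K|"
    by (intro card_of_Times_ordLeq_infinite infinite_ratfun) (simp_all del: UNIV_Times_UNIV)
  finally have X: "|UNIV :: ('k ratfun \<times> nat perm \<times> nat) set| \<le>o |?K|" .
  have "infinite (UNIV :: ('k ratfun \<times> nat perm \<times> nat) set)"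
    by (simp add: infinite_ratfun finite_prod)
  then have "|lists (UNIV :: ('k ratfun \<times> nat perm \<times> nat) set)| =o |UNIV :: ('k ratfun \<times> nat perm \<times> nat) set|"
    by (rule card_of_lists_infinite)
  then have "|UNIV :: ('k ratfun \<times> nat perm \<times> nat) list set| \<le>o |?K|"
    using X ordIso_ordLeq_trans by fastforce
  moreover have "|carrier M| \<le>o |UNIV :: ('k ratfun \<times> nat perm \<times> nat) list set|"
    using sub card_of_mono1 card_of_image ordLeq_transitive by blast
  ultimately have "|carrier M| \<le>o |?K|" using ordLeq_transitive by blast
  then obtain \<phi> :: "'v \<Rightarrow> 'k ratfun" where \<phi>: "inj_on \<phi> (carrier M)"
    by (auto simp flip: card_of_ordLeq)
  have "inj (\<lambda>a :: 'k ratfun. Poly_Mapping.single ({} :: nat set) a)"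
    by (rule inj_single)
  then have "inj_on (Poly_Mapping.single ({} :: nat set) \<circ> \<phi>) (carrier M)"
    by (rule comp_inj_on[OF \<phi> inj_on_subset[OF _ subset_UNIV]])
  then show ?thesis by blast
qed

lemma fg_rep_transport:
  fixes M :: "('k::field ratfun, 'v) sym_module" and \<phi> :: "'v \<Rightarrow> 'w"
  assumes "smooth_rep M" "fin_gen M" and inj: "inj_on \<phi> (carrier M)"
  shows "\<exists>N :: ('k ratfun, 'w) sym_module. N \<in> fg_reps \<and> rep_iso M N"
proof -
  interpret M: smooth_rep M by fact
  define \<psi> where "\<psi> = the_inv_into (carrier M) \<phi>"
  have \<psi>\<phi> [simp]: "\<psi> (\<phi> v) = v" if "v \<in> carrier M" for v
    using inj that by (simp add: \<psi>_def the_inv_into_f_f)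
  define N :: "('k ratfun, 'w) sym_module" where
    "N = \<lparr>carrier = \<phi> ` carrier M, monoid.mult = (\<lambda>_ _. \<phi> \<zero>\<^bsub>M\<^esub>), one = \<phi> \<zero>\<^bsub>M\<^esub>,
      zero = \<phi> \<zero>\<^bsub>M\<^esub>, add = (\<lambda>x y. \<phi> (\<psi> x \<oplus>\<^bsub>M\<^esub> \<psi> y)),
      module.smult = (\<lambda>a x. \<phi> (a \<odot>\<^bsub>M\<^esub> \<psi> x)), act = (\<lambda>g x. \<phi> (act M g (\<psi> x)))\<rparr>"
  have N [simp]: "carrier N = \<phi> ` carrier M" "\<zero>\<^bsub>N\<^esub> = \<phi> \<zero>\<^bsub>M\<^esub>" "x \<oplus>\<^bsub>N\<^esub> y = \<phi> (\<psi> x \<oplus>\<^bsub>M\<^esub> \<psi> y)"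
    "a \<odot>\<^bsub>N\<^esub> x = \<phi> (a \<odot>\<^bsub>M\<^esub> \<psi> x)" "act N g x = \<phi> (act M g (\<psi> x))" for x y a g
    by (simp_all add: N_def)
  have sc [simp]: "a \<odot>\<^bsub>M\<^esub> x \<in> carrier M" if "x \<in> carrier M" for a x
    using M.smult_closed[of a x] that by (simp add: ring_of_type_algebra_def)
  note [simp] = M.act_closed
  have "module ring_of_type_algebra N"
  proof (rule moduleI)
    show "cring (ring_of_type_algebra :: 'k ratfun ring)" by (rule cring_from_type_algebra)
    show "abelian_group N"
    proof (rule abelian_groupI)
      fix x
      assume "x \<in> carrier N"
      then show "\<exists>y\<in>carrier N. y \<oplus>\<^bsub>N\<^esub> x = \<zero>\<^bsub>N\<^esub>"
        by (intro bexI[where x = "\<phi> (\<ominus>\<^bsub>M\<^esub> \<psi> x)"]) (auto simp: M.l_neg)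
    qed (auto simp: M.a_ac)
  next
    fix a b x
    assume "x \<in> carrier N"
    then show "(a \<oplus>\<^bsub>ring_of_type_algebra\<^esub> b) \<odot>\<^bsub>N\<^esub> x = a \<odot>\<^bsub>N\<^esub> x \<oplus>\<^bsub>N\<^esub> b \<odot>\<^bsub>N\<^esub> x"
      "(a \<otimes>\<^bsub>ring_of_type_algebra\<^esub> b) \<odot>\<^bsub>N\<^esub> x = a \<odot>\<^bsub>N\<^esub> (b \<odot>\<^bsub>N\<^esub> x)"
      using M.smult_l_distr[of a b] M.smult_assoc1[of a b]
      by (auto simp: ring_of_type_algebra_def)
  next
    fix a x y
    assume "x \<in> carrier N" "y \<in> carrier N"
    then show "a \<odot>\<^bsub>N\<^esub> (x \<oplus>\<^bsub>N\<^esub> y) = a \<odot>\<^bsub>N\<^esub> x \<oplus>\<^bsub>N\<^esub> a \<odot>\<^bsub>N\<^esub> y"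
      using M.smult_r_distr[of a] by (auto simp: ring_of_type_algebra_def)
  qed auto
  then have sN: "smooth_rep N"
  proof (rule smooth_rep.intro, unfold_locales)
    fix x
    assume "x \<in> carrier N"
    then show "\<exists>n. \<forall>g\<in>sym_fix n. act N g x = x"
      using M.smooth by fastforce
  qed (auto simp: M.act_one M.act_times M.act_add M.act_smult)
  then interpret N: smooth_rep N .
  obtain F where F: "finite F" "F \<subseteq> carrier M"
    "(\<lambda>H. submodule H ring_of_type_algebra M) hull {act M g v |g v. v \<in> F} = carrier M"
    using assms(2) by (auto simp: fin_gen_def)
  have "carrier N \<subseteq> H"
    if H: "submodule H ring_of_type_algebra N" and orb: "{act N g v |g v. v \<in> \<phi> ` F} \<subseteq> H" for H
  proof -
    note HE = N.submoduleE[OF H]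
    let ?H = "{v \<in> carrier M. \<phi> v \<in> H}"
    have "submodule ?H ring_of_type_algebra M"
    proof (rule M.submoduleI)
      show "\<zero>\<^bsub>M\<^esub> \<in> ?H"
        using subgroup.one_closed[OF submodule.axioms(1)[OF H]] by simp
      show "a \<oplus>\<^bsub>M\<^esub> b \<in> ?H" if "a \<in> ?H" "b \<in> ?H" for a b
        using that HE(5)[of "\<phi> a" "\<phi> b"] by auto
      show "a \<odot>\<^bsub>M\<^esub> x \<in> ?H" if "x \<in> ?H" for a x
        using that submodule.smult_closed[OF H, of a "\<phi> x"]
        by (auto simp: ring_of_type_algebra_def)
      show "\<ominus>\<^bsub>M\<^esub> a \<in> ?H" if "a \<in> ?H" for a
      proof -
        have "\<ominus>\<^bsub>N\<^esub> \<phi> a = \<phi> (\<ominus>\<^bsub>M\<^esub> a)"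
          using that by (intro N.minus_equality) (auto simp: M.l_neg)
        then show ?thesis using that HE(3)[of "\<phi> a"] by auto
      qed
    qed auto
    moreover have "{act M g v |g v. v \<in> F} \<subseteq> ?H"
      using orb F(2) by (force simp: subset_iff)
    ultimately have "carrier M \<subseteq> ?H"
      using F(3) hull_minimal[where S = "\<lambda>H. submodule H ring_of_type_algebra M"] by blast
    then show ?thesis by auto
  qed
  moreover have "{act N g v |g v. v \<in> \<phi> ` F} \<subseteq> carrier N"
    using F(2) by auto
  ultimately have "(\<lambda>H. submodule H ring_of_type_algebra N) hull {act N g v |g v. v \<in> \<phi> ` F} = carrier N"
    by (intro hull_unique N.carrier_is_submodule) auto
  then have "fin_gen N"
    unfolding fin_gen_def using F by (intro exI[where x = "\<phi> ` F"]) auto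
  moreover have "rep_iso M N"
    unfolding rep_iso_def
  proof
    show "\<phi> \<in> rep_hom M N" by (auto simp: rep_hom_def intro!: homI)
    show "bij_betw \<phi> (carrier M) (carrier N)" using inj by (simp add: bij_betw_def)
  qed
  ultimately show ?thesis using sN by (auto simp: fg_reps_def)
qed

lemma fg_rep_iso_in_universe:
  fixes M :: "('k::field ratfun, 'v) sym_module"
  assumes "smooth_rep M" "fin_gen M"
  shows "\<exists>N :: ('k ratfun, nat set \<Rightarrow>\<^sub>0 'k ratfun) sym_module. N \<in> fg_reps \<and> rep_iso M N"
  using fg_rep_transport[OF assms] smooth_rep.fin_gen_small[OF assms] by blast

end

theory Submission
  imports Defs "HOL-Combinatorics.Multiset_Permutations"
begin

text \<open>Write $G_n$ for \<open>sym_fix n\<close> and let $I_n^d$ be the induced module on the \<open>d\<close>-subsets of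
  $\{n, n+1, \ldots\}$, a representation of $G_n$.  Objects are treated as subquotients \<open>U / L\<close> of a semilinear
  representation on a type; a generator of $I_n^d$ becomes an equivariant family indexed by \<open>d\<close>-subsets.

  A nontrivial relation between the members of a family becomes, after restriction to a smaller $G_{n'}$,
  a rewriting of that family in terms of families of smaller degree.  Induction on the degree then
  shows that finitely generated objects are noetherian, and that the restriction of such an object to a suitable
  $G_n$ has a finite filtration with graded pieces $I_n^{d_1}, I_n^{d_2}, \ldots$  Its invariants
  under $G_N$, for $N \ge n$, span a space of dimension $\sum_j \binom{N - n}{d_j}$.  For large \<open>N\<close> this is an
  additive function of the object with value $\binom{N}{r}$ at \<open>I_rep r\<close>, so the classes of the \<open>I_rep r\<close> are
  independent.

  For generation, let \<open>d\<close> be the largest of the $d_j$ and let $I_n^d$ be the top piece.  The quotient map to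
  $I_n^d$ is only $G_n$-equivariant, but by taking leading coefficients in one variable after
  another it yields a nonzero equivariant map from \<open>M\<close> to \<open>I_rep d\<close>.  Hence
  $[M] = [\ker] + [I^d] - [\mathrm{coker}]$, where the cokernel only involves degrees below \<open>d\<close> and the kernel
  involves \<open>d\<close> one time less than \<open>M\<close>.\<close>

section \<open>Finitary permutations\<close>

text \<open>Two obstacles shape the proof. A vector fixed by $G_{n+d}$ has translates under $G_n$
  that are indexed by ordered \<open>d\<close>-tuples, whereas the modules $I_n^d$ know only
  subsets. Semilinearity removes the order: the scalars contain elements that tell the orderings of
  a set apart, so that sums over all orderings, weighted by powers of these elements, span the same
  space. The second obstacle is that the filtration exists only after restriction to some $G_n$.
  Noetherianity tolerates this, because a larger group has larger orbits, and so does counting,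
  because only large \<open>N\<close> matter. A map to \<open>I_rep d\<close>, however, must be
  equivariant for the whole group, and averaging over infinitely many translates is impossible.
  Instead an index \<open>b\<close> tends to infinity and its variable is set to 0; one common power
  of that variable clears the poles for finitely many generators, which keeps the limit linear and
  nonzero. The multiplicity of the top degree is read off from the growth of the dimension of the
  invariants, hence does not depend on the filtration, and the induction can run over pairs of
  degree and multiplicity.\<close>

lemma ex_perm_extending:
  assumes "finite V" "inj_on f V"
  shows "\<exists>g. (\<forall>x\<in>V. Perm.apply g x = f x) \<and> (\<forall>i. i \<notin> V \<union> f ` V \<longrightarrow> Perm.apply g i = i)"
proof -
  \<comment> \<open>\<open>V\<close> and its image have equal size, so the two differences do as
    well; a bijection \<open>h\<close> from the second set back to the first closes \<open>f\<close>
    up to a permutation of the union.\<close>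
  have "card (f ` V - V) = card (V - f ` V)"
    using assms by (metis card_Diff_subset_Int card_image finite_Int finite_imageI inf_commute)
  then obtain h where h: "bij_betw h (f ` V - V) (V - f ` V)"
    using assms finite_same_card_bij[of "f ` V - V" "V - f ` V"] by blast
  define p where "p x = (if x \<in> V then f x else if x \<in> f ` V then h x else x)" for x
  have "bij_betw p V (f ` V)"
    using assms(2) by (subst bij_betw_cong[where g = f]) (auto simp: p_def bij_betw_def)
  moreover have "bij_betw p (f ` V - V) (V - f ` V)"
    using h by (subst bij_betw_cong[where g = h]) (auto simp: p_def)
  ultimately have "bij_betw p (V \<union> (f ` V - V)) (f ` V \<union> (V - f ` V))"
    by (rule bij_betw_combine) auto
  then have "bij_betw p (V \<union> f ` V) (V \<union> f ` V)" by (simp add: Un_commute)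
  moreover have "bij_betw p (- (V \<union> f ` V)) (- (V \<union> f ` V))"
    by (subst bij_betw_cong[where g = id]) (auto simp: p_def)
  ultimately have "bij_betw p ((V \<union> f ` V) \<union> - (V \<union> f ` V)) ((V \<union> f ` V) \<union> - (V \<union> f ` V))"
    by (rule bij_betw_combine) auto
  then have "bij p" by (simp only: Compl_partition)
  moreover have "finite {x. p x \<noteq> x}"
    by (rule finite_subset[of _ "V \<union> f ` V"]) (use assms in \<open>auto simp: p_def\<close>)
  ultimately have "Perm.apply (Perm p) = p" by (simp add: Perm_inverse)
  then show ?thesis by (intro exI[where x = "Perm p"]) (auto simp: p_def)
qed

lemma sym_fix_one [simp]: "1 \<in> sym_fix n"
  by (simp add: sym_fix_def)

lemma sym_fix_times: "g \<in> sym_fix n \<Longrightarrow> h \<in> sym_fix n \<Longrightarrow> g * h \<in> sym_fix n"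
  by (simp add: sym_fix_def apply_times)

lemma apply_inverse_apply [simp]:
  "Perm.apply (inverse g) (Perm.apply g i) = i" "Perm.apply g (Perm.apply (inverse g) i) = i"
  by (simp_all add: apply_sequence)

lemma apply_eq_iff [simp]: "Perm.apply g i = Perm.apply g j \<longleftrightarrow> i = j"
  by (rule inj_eq[OF inj_apply])

lemma sym_fix_le: "g \<in> sym_fix n \<Longrightarrow> n \<le> i \<Longrightarrow> n \<le> Perm.apply g i"
proof (rule ccontr)
  assume *: "g \<in> sym_fix n" "n \<le> i" "\<not> n \<le> Perm.apply g i"
  then have "Perm.apply g (Perm.apply g i) = Perm.apply g i" by (simp add: sym_fix_def)
  then show False using * by simp
qed

lemma swap_in_sym_fix: "n \<le> i \<Longrightarrow> n \<le> j \<Longrightarrow> Perm.swap i j \<in> sym_fix n"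
  by (auto simp: sym_fix_def swap.rep_eq transpose_def)

lemma apply_swap: "Perm.apply (Perm.swap i j) k = (if k = i then j else if k = j then i else k)"
  by (simp add: swap.rep_eq transpose_def)

lemma swap_times_swap [simp]: "Perm.swap i j * Perm.swap i j = 1"
  by (rule perm_eqI) (simp add: apply_times apply_swap)

lemma image_swap_fixed: "i \<notin> T \<Longrightarrow> j \<notin> T \<Longrightarrow> Perm.apply (Perm.swap i j) ` T = T"
  by (subst image_cong[OF refl, where g = id]) (auto simp: apply_swap)

lemma image_inverse_image [simp]:
  "Perm.apply (inverse g) ` Perm.apply g ` S = S" "Perm.apply g ` Perm.apply (inverse g) ` S = S"
  by (simp_all add: image_image)

section \<open>Specialising a variable to zero\<close>

text \<open>Substituting 0 for a variable deletes the monomials that contain it. The equation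
  \<open>spec_zero b p = p\<close> is used below to express that \<open>p\<close> does not involve
  the variable \<open>b\<close>.\<close>

definition spec_zero :: "nat \<Rightarrow> 'k::field mpoly \<Rightarrow> 'k mpoly" where
  "spec_zero b p = Abs_poly_mapping (\<lambda>m. Poly_Mapping.lookup p m when Poly_Mapping.lookup m b = 0)"

lemma lookup_spec_zero:
  "Poly_Mapping.lookup (spec_zero b p) m = (Poly_Mapping.lookup p m when Poly_Mapping.lookup m b = 0)"
proof -
  have "finite {m. (Poly_Mapping.lookup p m when Poly_Mapping.lookup m b = 0) \<noteq> 0}"
    by (rule finite_subset[OF _ finite_keys[of p]]) (auto simp: when_def in_keys_iff)
  then show ?thesis unfolding spec_zero_def by (subst Abs_poly_mapping_inverse) auto
qed

lemma spec_zero_add: "spec_zero b (p + q) = spec_zero b p + spec_zero b q"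
  by (rule poly_mapping_eqI) (simp add: lookup_spec_zero lookup_add when_def)

lemma spec_zero_0 [simp]: "spec_zero b 0 = 0"
  by (rule poly_mapping_eqI) (simp add: lookup_spec_zero)

lemma spec_zero_single:
  "spec_zero b (Poly_Mapping.single m c) = (if Poly_Mapping.lookup m b = 0 then Poly_Mapping.single m c else 0)"
  by (rule poly_mapping_eqI) (auto simp: lookup_spec_zero lookup_single when_def)

lemma spec_zero_1 [simp]: "spec_zero b 1 = 1"
  by (simp add: spec_zero_single flip: single_one)

lemma spec_zero_sum: "spec_zero b (\<Sum>i\<in>A. f i) = (\<Sum>i\<in>A. spec_zero b (f i))"
  by (induction A rule: infinite_finite_induct) (simp_all add: spec_zero_add)

text \<open>Exponents are natural numbers, so the exponent of \<open>b\<close> in a product of two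
  monomials vanishes only if it vanishes in both; the general case follows by bilinearity.\<close>

lemma spec_zero_mult: "spec_zero b (p * q) = spec_zero b p * spec_zero b q"
proof -
  let ?s = "\<lambda>p m. Poly_Mapping.single m (Poly_Mapping.lookup p m)"
  have "spec_zero b (p * q) = spec_zero b ((\<Sum>m\<in>Poly_Mapping.keys p. ?s p m) * (\<Sum>n\<in>Poly_Mapping.keys q. ?s q n))"
    by (simp flip: poly_mapping_eq_sum)
  also have "\<dots> = (\<Sum>m\<in>Poly_Mapping.keys p. \<Sum>n\<in>Poly_Mapping.keys q. spec_zero b (?s p m) * spec_zero b (?s q n))"
    unfolding sum_product spec_zero_sum
    by (intro sum.cong refl) (simp add: mult_single spec_zero_single lookup_add)
  also have "\<dots> = spec_zero b (\<Sum>m\<in>Poly_Mapping.keys p. ?s p m) * spec_zero b (\<Sum>n\<in>Poly_Mapping.keys q. ?s q n)"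
    by (simp add: sum_product spec_zero_sum)
  finally show ?thesis by (simp flip: poly_mapping_eq_sum)
qed

lemma spec_zero_idem [simp]: "spec_zero b (spec_zero b p) = spec_zero b p"
  by (rule poly_mapping_eqI) (simp add: lookup_spec_zero when_def)

lemma perm_mpoly_spec_zero: "perm_mpoly g (spec_zero b p) = spec_zero (Perm.apply g b) (perm_mpoly g p)"
  by (rule poly_mapping_eqI) (simp add: lookup_spec_zero lookup_perm_mpoly lookup_perm_mon)

lemma perm_mpoly_swap_fixed:
  assumes "spec_zero i p = p" "spec_zero j p = p"
  shows "perm_mpoly (Perm.swap i j) p = p"
proof (rule poly_mapping_eqI)
  fix m
  let ?m = "perm_mon (Perm.swap i j) m"
  have *: "Poly_Mapping.lookup p m = 0" if "Poly_Mapping.lookup m i \<noteq> 0 \<or> Poly_Mapping.lookup m j \<noteq> 0" for m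
    using that arg_cong[OF assms(1), of "\<lambda>q. Poly_Mapping.lookup q m"]
      arg_cong[OF assms(2), of "\<lambda>q. Poly_Mapping.lookup q m"] by (auto simp: lookup_spec_zero)
  show "Poly_Mapping.lookup (perm_mpoly (Perm.swap i j) p) m = Poly_Mapping.lookup p m"
  proof (cases "Poly_Mapping.lookup m i = 0 \<and> Poly_Mapping.lookup m j = 0")
    case True
    then have "?m = m" by (intro poly_mapping_eqI) (simp add: lookup_perm_mon apply_swap)
    then show ?thesis by (simp add: lookup_perm_mpoly)
  next
    case False
    then have "Poly_Mapping.lookup ?m i \<noteq> 0 \<or> Poly_Mapping.lookup ?m j \<noteq> 0"
      by (auto simp: lookup_perm_mon apply_swap)
    then show ?thesis using *[of m] *[of ?m] False by (simp add: lookup_perm_mpoly)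
  qed
qed

lemma eventually_spec_zero: "\<forall>\<^sub>F b in sequentially. spec_zero b p = p"
proof -
  \<comment> \<open>For constant \<open>p\<close> this \<open>Max\<close> is taken over the empty
    set and is unspecified; the bound is applied only when some variable occurs.\<close>
  define n where "n = Suc (Max (\<Union> (Poly_Mapping.keys ` Poly_Mapping.keys p)))"
  have n: "Poly_Mapping.lookup m b = 0" if "m \<in> Poly_Mapping.keys p" "n \<le> b" for m b
  proof (rule ccontr)
    assume "Poly_Mapping.lookup m b \<noteq> 0"
    then have "b \<in> \<Union> (Poly_Mapping.keys ` Poly_Mapping.keys p)" using that by (auto simp: in_keys_iff)
    then have "b \<le> Max (\<Union> (Poly_Mapping.keys ` Poly_Mapping.keys p))" by (intro Max_ge) auto
    then show False using that by (simp add: n_def)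
  qed
  show ?thesis
  proof (rule eventually_sequentiallyI[of n], rule poly_mapping_eqI)
    fix b m
    assume "n \<le> b"
    then show "Poly_Mapping.lookup (spec_zero b p) m = Poly_Mapping.lookup p m"
      using n[of m b] by (cases "Poly_Mapping.lookup p m = 0") (auto simp: lookup_spec_zero when_def in_keys_iff)
  qed
qed

text \<open>The exponent \<open>s\<close> is the least one with which \<open>b\<close> occurs. A
  monomial \<open>m0\<close> that attains it loses \<open>b\<close> altogether after division, so it
  survives the specialisation.\<close>

lemma mpoly_factor_var:
  assumes "p \<noteq> (0 :: 'k::field mpoly)"
  shows "\<exists>s q. p = Poly_Mapping.single (Poly_Mapping.single b s) 1 * q \<and> spec_zero b q \<noteq> 0"
proof -
  let ?K = "Poly_Mapping.keys p"
  have "?K \<noteq> {}" using assms by simp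
  define s where "s = Min ((\<lambda>m. Poly_Mapping.lookup m b) ` ?K)"
  have s: "s \<le> Poly_Mapping.lookup m b" if "m \<in> ?K" for m
    unfolding s_def using that by (intro Min_le) auto
  have "s \<in> (\<lambda>m. Poly_Mapping.lookup m b) ` ?K"
    unfolding s_def using \<open>?K \<noteq> {}\<close> by (intro Min_in) auto
  then obtain m0 where m0: "m0 \<in> ?K" "Poly_Mapping.lookup m0 b = s" by auto
  define d where "d m = m - Poly_Mapping.single b s" for m :: "nat \<Rightarrow>\<^sub>0 nat"
  have d: "Poly_Mapping.single b s + d m = m" if "m \<in> ?K" for m
    using s[OF that] by (intro poly_mapping_eqI) (auto simp: d_def lookup_add lookup_minus lookup_single when_def)
  define q where "q = (\<Sum>m\<in>?K. Poly_Mapping.single (d m) (Poly_Mapping.lookup p m))"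
  have "Poly_Mapping.single (Poly_Mapping.single b s) 1 * q =
      (\<Sum>m\<in>?K. Poly_Mapping.single m (Poly_Mapping.lookup p m))"
    by (simp add: q_def sum_distrib_left mult_single d)
  then have pq: "p = Poly_Mapping.single (Poly_Mapping.single b s) 1 * q"
    by (simp flip: poly_mapping_eq_sum)
  \<comment> \<open>Division by a fixed monomial is injective on the monomials of \<open>p\<close>,
    so no cancellation can occur at \<open>d m0\<close>.\<close>
  have "Poly_Mapping.lookup q (d m0) = (\<Sum>m\<in>?K. if m = m0 then Poly_Mapping.lookup p m else 0)"
    unfolding q_def lookup_sum
    by (rule sum.cong) (use d m0 in \<open>auto simp: lookup_single when_def, metis\<close>)
  also have "\<dots> = Poly_Mapping.lookup p m0" using m0 by simp
  finally have "Poly_Mapping.lookup q (d m0) \<noteq> 0" using m0 by (simp add: in_keys_iff)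
  moreover have "Poly_Mapping.lookup (d m0) b = 0" using m0 by (simp add: d_def lookup_minus)
  ultimately have "Poly_Mapping.lookup (spec_zero b q) (d m0) \<noteq> 0" by (simp add: lookup_spec_zero)
  then show ?thesis using pq by (metis lookup_zero)
qed

text \<open>The value of a rational function at 0 in the variable \<open>b\<close>. It is a
  relation, since functions with a pole there have no value; any fraction whose denominator survives
  the specialisation may serve as witness, and \<open>residue_at_unique\<close> shows that the
  choice does not matter.\<close>

definition residue_at :: "nat \<Rightarrow> 'k::field ratfun \<Rightarrow> 'k ratfun \<Rightarrow> bool" where
  "residue_at b a c \<longleftrightarrow>
    (\<exists>p q. spec_zero b q \<noteq> 0 \<and> a = Fract p q \<and> c = Fract (spec_zero b p) (spec_zero b q))"

lemma residue_at_unique: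
  assumes "residue_at b a c" "residue_at b a c'"
  shows "c = c'"
proof -
  obtain p q p' q' where *: "spec_zero b q \<noteq> 0" "a = Fract p q" "c = Fract (spec_zero b p) (spec_zero b q)"
    "spec_zero b q' \<noteq> 0" "a = Fract p' q'" "c' = Fract (spec_zero b p') (spec_zero b q')"
    using assms unfolding residue_at_def by blast
  then have "q \<noteq> 0" "q' \<noteq> 0" by auto
  then have "p * q' = p' * q" using * by (simp add: eq_fract)
  then show ?thesis using * by (simp add: eq_fract flip: spec_zero_mult)
qed

lemma residue_at_0 [simp]: "residue_at b 0 0"
  unfolding residue_at_def by (rule exI[of _ 0], rule exI[of _ 1]) (simp add: Zero_fract_def)

lemma residue_at_add:
  assumes "residue_at b a c" "residue_at b a' c'"
  shows "residue_at b (a + a') (c + c')"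
proof -
  obtain p q p' q' where *: "spec_zero b q \<noteq> 0" "a = Fract p q" "c = Fract (spec_zero b p) (spec_zero b q)"
    "spec_zero b q' \<noteq> 0" "a' = Fract p' q'" "c' = Fract (spec_zero b p') (spec_zero b q')"
    using assms unfolding residue_at_def by blast
  then have "q \<noteq> 0" "q' \<noteq> 0" by auto
  then show ?thesis unfolding residue_at_def
    using * by (intro exI[of _ "p * q' + p' * q"] exI[of _ "q * q'"]) (simp add: spec_zero_mult spec_zero_add)
qed

lemma residue_at_mult:
  assumes "residue_at b a c" "residue_at b a' c'"
  shows "residue_at b (a * a') (c * c')"
proof -
  obtain p q p' q' where *: "spec_zero b q \<noteq> 0" "a = Fract p q" "c = Fract (spec_zero b p) (spec_zero b q)"
    "spec_zero b q' \<noteq> 0" "a' = Fract p' q'" "c' = Fract (spec_zero b p') (spec_zero b q')"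
    using assms unfolding residue_at_def by blast
  then show ?thesis unfolding residue_at_def
    using * by (intro exI[of _ "p * p'"] exI[of _ "q * q'"]) (simp add: spec_zero_mult)
qed

lemma residue_at_perm:
  assumes "residue_at b a c"
  shows "residue_at (Perm.apply g b) (perm_ratfun g a) (perm_ratfun g c)"
proof -
  obtain p q where *: "spec_zero b q \<noteq> 0" "a = Fract p q" "c = Fract (spec_zero b p) (spec_zero b q)"
    using assms unfolding residue_at_def by blast
  moreover from this have "q \<noteq> 0" by auto
  ultimately show ?thesis unfolding residue_at_def
    by (intro exI[of _ "perm_mpoly g p"] exI[of _ "perm_mpoly g q"])
      (simp add: perm_ratfun_Fract perm_mpoly_spec_zero flip: perm_mpoly_spec_zero)
qed

lemma eventually_residue_at: "\<forall>\<^sub>F b in sequentially. residue_at b a a"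
proof (cases a)
  case (Fract p q)
  show ?thesis
    using eventually_spec_zero[of p] eventually_spec_zero[of q]
  proof eventually_elim
    case (elim b)
    then show ?case using Fract unfolding residue_at_def
      by (intro exI[of _ p] exI[of _ q]) simp
  qed
qed

text \<open>A value at 0 in the variable \<open>i\<close> no longer involves \<open>i\<close>, nor
  does it involve any sufficiently large \<open>b\<close>. This is why leading coefficients will not
  depend on the index with which they are computed.\<close>

lemma eventually_residue_swap:
  assumes "residue_at i a c"
  shows "\<forall>\<^sub>F b in sequentially. perm_ratfun (Perm.swap i b) c = c"
proof -
  obtain p q where *: "spec_zero i q \<noteq> 0" "c = Fract (spec_zero i p) (spec_zero i q)"
    using assms unfolding residue_at_def by blast
  show ?thesis
    using eventually_spec_zero[of "spec_zero i p"] eventually_spec_zero[of "spec_zero i q"]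
    by eventually_elim (use * in \<open>simp add: perm_ratfun_Fract perm_mpoly_swap_fixed\<close>)
qed

lemma ratvar_nonzero [simp]: "ratvar i \<noteq> 0"
  by (auto simp: ratvar_def Zero_fract_def eq_fract
      dest: arg_cong[where f = "\<lambda>p. Poly_Mapping.lookup p (Poly_Mapping.single i 1)"])

lemma ratvar_power: "ratvar b ^ s = Fract (Poly_Mapping.single (Poly_Mapping.single b s) 1) (1 :: 'k::field mpoly)"
  by (induction s) (simp_all add: ratvar_def One_fract_def mult_single single_add[symmetric] flip: single_one)

text \<open>The discrete valuation of the variable \<open>b\<close>: a power of it times a unit at
  0.\<close>

lemma ratfun_factor_var:
  fixes a :: "'k::field ratfun"
  assumes "a \<noteq> 0"
  shows "\<exists>e u c. a = ratvar b powi e * u \<and> residue_at b u c \<and> c \<noteq> 0"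
proof (cases a)
  case (Fract p q)
  then have "p \<noteq> 0" using assms by (auto simp: Zero_fract_def eq_fract)
  obtain s p' where p: "p = Poly_Mapping.single (Poly_Mapping.single b s) 1 * p'" "spec_zero b p' \<noteq> 0"
    using mpoly_factor_var[OF \<open>p \<noteq> 0\<close>] by blast
  obtain t q' where q: "q = Poly_Mapping.single (Poly_Mapping.single b t) 1 * q'" "spec_zero b q' \<noteq> 0"
    using mpoly_factor_var[OF \<open>q \<noteq> 0\<close>] by blast
  have "a = Fract (Poly_Mapping.single (Poly_Mapping.single b s) 1) 1 * Fract p' q'
      / Fract (Poly_Mapping.single (Poly_Mapping.single b t) 1) 1"
    using Fract p q by (auto simp: mult_ac)
  also have "\<dots> = ratvar b powi (int s - int t) * Fract p' q'"
    by (simp add: power_int_diff flip: ratvar_power)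
  finally have "a = ratvar b powi (int s - int t) * Fract p' q'" .
  moreover have "residue_at b (Fract p' q') (Fract (spec_zero b p') (spec_zero b q'))"
    using q by (auto simp: residue_at_def)
  moreover have "Fract (spec_zero b p') (spec_zero b q') \<noteq> 0"
    using p q by (simp add: Zero_fract_def eq_fract)
  ultimately show ?thesis by blast
qed

lemma residue_at_ratvar_power: "residue_at b (ratvar b ^ k) (if k = 0 then 1 else 0)"
  unfolding residue_at_def
  by (rule exI[of _ "Poly_Mapping.single (Poly_Mapping.single b k) 1"], rule exI[of _ 1])
    (auto simp: ratvar_power spec_zero_single One_fract_def Zero_fract_def)

text \<open>Take for \<open>e\<close> the negative of the least valuation that occurs in
  \<open>A\<close>: then every product is regular, and an element of least valuation keeps a nonzero
  value.\<close>

lemma ex_common_order: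
  fixes A :: "'k::field ratfun set"
  assumes "finite A" "\<exists>a\<in>A. a \<noteq> 0"
  shows "\<exists>e. (\<forall>a\<in>A. \<exists>c. residue_at b (ratvar b powi e * a) c) \<and>
    (\<exists>a\<in>A. \<exists>c. c \<noteq> 0 \<and> residue_at b (ratvar b powi e * a) c)"
proof -
  let ?A = "A - {0}"
  have "\<forall>a\<in>?A. \<exists>e u c. a = ratvar b powi e * u \<and> residue_at b u c \<and> c \<noteq> 0"
    using ratfun_factor_var by blast
  then obtain E U C where EUC: "\<And>a. a \<in> ?A \<Longrightarrow> a = ratvar b powi (E a) * U a \<and> residue_at b (U a) (C a) \<and> C a \<noteq> 0"
    by metis
  define m where "m = Min (E ` ?A)"
  have "m \<in> E ` ?A" unfolding m_def using assms by (intro Min_in) auto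
  then obtain a0 where a0: "a0 \<in> ?A" "E a0 = m" by auto
  have eq: "ratvar b powi (- m) * a = ratvar b ^ nat (E a - m) * U a" if "a \<in> ?A" for a
  proof -
    have "m \<le> E a" unfolding m_def using that assms by (intro Min_le) auto
    then have "ratvar b ^ nat (E a - m) = (ratvar b :: 'k ratfun) powi (- m + E a)"
      by (simp add: power_int_def)
    also have "\<dots> * U a = ratvar b powi (- m) * (ratvar b powi (E a) * U a)"
      by (subst power_int_add) simp_all
    finally show ?thesis using EUC[OF that] by metis
  qed
  have "\<exists>c. residue_at b (ratvar b powi (- m) * a) c" if "a \<in> A" for a
  proof (cases "a = 0")
    case False
    then show ?thesis using eq[of a] EUC[of a] that residue_at_mult[OF residue_at_ratvar_power] by fastforce
  qed (auto intro: exI[of _ 0])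
  moreover have "residue_at b (ratvar b powi (- m) * a0) (C a0)"
    using eq[OF a0(1)] EUC[OF a0(1)] a0 by simp
  ultimately show ?thesis using a0 EUC[OF a0(1)] by blast
qed

section \<open>Equivariant families\<close>

definition tail_sets :: "nat \<Rightarrow> nat \<Rightarrow> nat set set" where
  "tail_sets n d = {T. finite T \<and> card T = d \<and> T \<subseteq> {n..}}"

lemma tail_setsD:
  assumes "T \<in> tail_sets n d"
  shows "finite T" "card T = d" "T \<subseteq> {n..}" "i \<in> T \<Longrightarrow> n \<le> i"
  using assms by (auto simp: tail_sets_def)

lemma tail_sets_image: "g \<in> sym_fix n \<Longrightarrow> T \<in> tail_sets n d \<Longrightarrow> Perm.apply g ` T \<in> tail_sets n d"
  by (auto simp: tail_sets_def card_image inj_on_subset[OF inj_apply] intro: sym_fix_le)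

lemma tail_sets_mono: "n \<le> n' \<Longrightarrow> tail_sets n' d \<subseteq> tail_sets n d"
  by (auto simp: tail_sets_def subset_iff)

lemma tail_sets_0 [simp]: "tail_sets n 0 = {{}}"
  by (auto simp: tail_sets_def)

lemma interval_in_tail_sets [simp]: "{n..<n + d} \<in> tail_sets n d"
  by (auto simp: tail_sets_def)

text \<open>Separating the sets that contain \<open>n\<close> from those that do not is the
  splitting of the restriction of $I_n^{d+1}$ to $G_{n+1}$ into $I_{n+1}^d$ and
  $I_{n+1}^{d+1}$.\<close>

lemma tail_sets_Suc:
  "tail_sets n (Suc d) - tail_sets (Suc n) (Suc d) = insert n ` tail_sets (Suc n) d"
proof (intro equalityI subsetI)
  fix T
  assume "T \<in> tail_sets n (Suc d) - tail_sets (Suc n) (Suc d)"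
  then have T: "finite T" "card T = Suc d" "T \<subseteq> {n..}" "\<not> T \<subseteq> {Suc n..}"
    by (auto simp: tail_sets_def)
  then obtain i where "i \<in> T" "\<not> Suc n \<le> i" "n \<le> i" by auto
  then have "n \<in> T" by (simp add: not_less_eq_eq)
  have "T - {n} \<subseteq> {Suc n..}"
  proof
    fix i
    assume "i \<in> T - {n}"
    then have "n \<le> i" "i \<noteq> n" using T(3) by auto
    then show "i \<in> {Suc n..}" by simp
  qed
  then have "T - {n} \<in> tail_sets (Suc n) d"
    using T(1,2) \<open>n \<in> T\<close> by (simp add: tail_sets_def)
  moreover have "T = insert n (T - {n})" using \<open>n \<in> T\<close> by (simp add: insert_absorb)
  ultimately show "T \<in> insert n ` tail_sets (Suc n) d" by blast
next
  fix T
  assume "T \<in> insert n ` tail_sets (Suc n) d"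
  then obtain R where "T = insert n R" "finite R" "card R = d" "R \<subseteq> {Suc n..}"
    by (auto simp: tail_sets_def)
  moreover have "n \<notin> R" using \<open>R \<subseteq> {Suc n..}\<close> by auto
  ultimately show "T \<in> tail_sets n (Suc d) - tail_sets (Suc n) (Suc d)"
    using subset_trans[of R "{Suc n..}" "{n..}"] by (simp add: tail_sets_def)
qed

lemma ex_perm_image_fixing:
  assumes "finite S" "finite T" "card S = card T" "finite B" "B \<inter> S = {}" "B \<inter> T = {}"
  shows "\<exists>g. Perm.apply g ` S = T \<and> (\<forall>i\<in>B. Perm.apply g i = i)"
proof -
  obtain f where f: "bij_betw f S T"
    using assms finite_same_card_bij by blast
  define h where "h i = (if i \<in> S then f i else i)" for i
  have hS: "h ` S = T" using f by (auto simp: h_def bij_betw_def)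
  have "inj_on h (S \<union> B)"
    using f assms(5,6) by (auto simp: h_def inj_on_def bij_betw_def split: if_splits)
  then obtain g where "\<forall>i\<in>S \<union> B. Perm.apply g i = h i"
    using ex_perm_extending[of "S \<union> B" h] assms by auto
  then show ?thesis
    using hS assms(5) by (intro exI[of _ g]) (auto simp: h_def image_def)
qed

lemma ex_sym_fix_image:
  assumes "S \<in> tail_sets n d" "T \<in> tail_sets n d"
  shows "\<exists>g\<in>sym_fix n. Perm.apply g ` S = T"
  using ex_perm_image_fixing[of S T "{..<n}"] assms
  by (fastforce simp: tail_sets_def sym_fix_def)

locale semilinear = vector_space scale
  for scale :: "'k::field ratfun \<Rightarrow> 'w::ab_group_add \<Rightarrow> 'w" (infixr \<open>*s\<close> 75) +
  fixes gact :: "nat perm \<Rightarrow> 'w \<Rightarrow> 'w"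
  assumes gact_one [simp]: "gact 1 v = v"
    and gact_times: "gact (g * h) v = gact g (gact h v)"
    and gact_add: "gact g (v + w) = gact g v + gact g w"
    and gact_scale: "gact g (a *s v) = perm_ratfun g a *s gact g v"
begin

lemma gact_zero [simp]: "gact g 0 = 0"
  using gact_add[of g 0 0] by simp

lemma gact_minus: "gact g (- v) = - gact g v"
  using gact_add[of g v "- v"] by (simp add: eq_neg_iff_add_eq_0 add.commute)

lemma gact_diff: "gact g (v - w) = gact g v - gact g w"
  using gact_add[of g v "- w"] by (simp add: gact_minus)

lemma gact_sum: "gact g (\<Sum>i\<in>A. f i) = (\<Sum>i\<in>A. gact g (f i))"
  by (induction A rule: infinite_finite_induct) (simp_all add: gact_add)

definition stable :: "nat \<Rightarrow> 'w set \<Rightarrow> bool" where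
  "stable n V \<longleftrightarrow> subspace V \<and> (\<forall>g\<in>sym_fix n. \<forall>v\<in>V. gact g v \<in> V)"

lemma stable_mono: "stable n V \<Longrightarrow> n \<le> n' \<Longrightarrow> stable n' V"
  using sym_fix_mono[of n n'] by (auto simp: stable_def)

lemma stable_subspace: "stable n V \<Longrightarrow> subspace V"
  by (simp add: stable_def)

lemma stable_gact: "stable n V \<Longrightarrow> g \<in> sym_fix n \<Longrightarrow> v \<in> V \<Longrightarrow> gact g v \<in> V"
  by (simp add: stable_def)

lemma stable_Int: "stable n V \<Longrightarrow> stable n W \<Longrightarrow> stable n (V \<inter> W)"
  by (auto simp: stable_def subspace_inter)

lemma stable_span:
  assumes "\<And>g v. g \<in> sym_fix n \<Longrightarrow> v \<in> Q \<Longrightarrow> gact g v \<in> span Q"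
  shows "stable n (span Q)"
proof -
  have "gact g v \<in> span Q" if g: "g \<in> sym_fix n" and v: "v \<in> span Q" for g v
    using v
  proof (induction rule: span_induct_alt)
    case (step c x y)
    then show ?case using assms[OF g] by (simp add: gact_add gact_scale span_add span_scale)
  qed (simp add: span_zero)
  then show ?thesis by (simp add: stable_def subspace_span)
qed

lemma span_stable [simp]: "stable n V \<Longrightarrow> span V = V"
  by (simp add: stable_subspace)

lemma span_Un_span: "span (span P \<union> Q) = span (P \<union> Q)"
proof
  have "span P \<subseteq> span (P \<union> Q)" by (rule span_mono) auto
  then show "span (span P \<union> Q) \<subseteq> span (P \<union> Q)"
    by (intro span_minimal) (auto intro: span_base subspace_span)
  show "span (P \<union> Q) \<subseteq> span (span P \<union> Q)"
    by (rule span_mono) (auto intro: span_base)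
qed

lemma span_eqI': "P \<subseteq> span Q \<Longrightarrow> Q \<subseteq> span P \<Longrightarrow> span P = span Q"
  by (metis span_minimal subset_antisym subspace_span)

lemma span_Un_cong: "span Q = span R \<Longrightarrow> span (P \<union> Q) = span (P \<union> R)"
  by (metis Un_commute span_Un_span)

text \<open>Such a family is a $G_n$-equivariant map from $I_n^d$, given by its values on the basis
  vectors. The values of \<open>y\<close> at all other sets are unconstrained.\<close>

definition fam :: "nat \<Rightarrow> nat \<Rightarrow> (nat set \<Rightarrow> 'w) \<Rightarrow> bool" where
  "fam n d y \<longleftrightarrow> (\<forall>g\<in>sym_fix n. \<forall>T\<in>tail_sets n d. gact g (y T) = y (Perm.apply g ` T))"

lemma famD: "fam n d y \<Longrightarrow> g \<in> sym_fix n \<Longrightarrow> T \<in> tail_sets n d \<Longrightarrow> gact g (y T) = y (Perm.apply g ` T)"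
  by (simp add: fam_def)

lemma fam_mono: "fam n d y \<Longrightarrow> n \<le> n' \<Longrightarrow> fam n' d y"
  using sym_fix_mono[of n n'] tail_sets_mono[of n n' d] by (auto simp: fam_def)

lemma fam_insert:
  assumes "fam n (Suc d) y"
  shows "fam (Suc n) d (\<lambda>R. y (insert n R))"
  unfolding fam_def
proof (intro ballI)
  fix g T
  assume gT: "g \<in> sym_fix (Suc n)" "T \<in> tail_sets (Suc n) d"
  then have "insert n T \<in> tail_sets n (Suc d)" using tail_sets_Suc[of n d] by blast
  moreover have "Perm.apply g n = n" "g \<in> sym_fix n"
    using gT(1) sym_fix_mono[of n "Suc n"] by (auto simp: sym_fix_def)
  ultimately show "gact g (y (insert n T)) = y (insert n (Perm.apply g ` T))"
    using famD[OF assms, of g "insert n T"] by simp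
qed

text \<open>These are the spanning sets for the inductions on the degree. They are sets rather than
  spans because restriction to a smaller group only splits them into families of the smaller group,
  without changing the set.\<close>

inductive lower :: "nat \<Rightarrow> nat \<Rightarrow> 'w set \<Rightarrow> bool" for n d where
  lower_empty: "lower n d {}"
| lower_insert: "lower n d Q \<Longrightarrow> j < d \<Longrightarrow> fam n j z \<Longrightarrow> lower n d (z ` tail_sets n j \<union> Q)"

lemma lower_Un: "lower n d P \<Longrightarrow> lower n d Q \<Longrightarrow> lower n d (P \<union> Q)"
  by (induction rule: lower.induct) (auto simp: Un_assoc intro: lower_insert)

lemma lower_fam: "fam n j z \<Longrightarrow> j < d \<Longrightarrow> lower n d (z ` tail_sets n j)"
  using lower_insert[OF lower_empty] by fastforce

lemma lower_deg_mono: "lower n d Q \<Longrightarrow> d \<le> d' \<Longrightarrow> lower n d' Q"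
  by (induction rule: lower.induct) (auto intro: lower_empty lower_insert)

lemma lower_Union: "finite A \<Longrightarrow> (\<And>i. i \<in> A \<Longrightarrow> lower n d (Q i)) \<Longrightarrow> lower n d (\<Union>i\<in>A. Q i)"
  by (induction A rule: finite_induct) (auto intro: lower_empty lower_Un)

text \<open>A member whose index set contains \<open>n\<close> is determined by the remaining
  \<open>d - 1\<close> indices, and $G_{n+1}$ fixes \<open>n\<close>; so these members form a family
  of degree \<open>d - 1\<close>. In degree 0 there are none.\<close>

lemma fam_image_Suc:
  assumes "fam n d y"
  shows "lower (Suc n) d (y ` (tail_sets n d - tail_sets (Suc n) d))"
proof (cases d)
  case (Suc j)
  have "y ` (tail_sets n d - tail_sets (Suc n) d) = (\<lambda>R. y (insert n R)) ` tail_sets (Suc n) j"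
    unfolding Suc tail_sets_Suc by (simp add: image_image)
  then show ?thesis using assms fam_insert Suc by (auto intro: lower_fam)
qed (simp add: lower_empty)

lemma fam_image_split:
  assumes "n \<le> n'"
  shows "y ` tail_sets n d = y ` tail_sets n' d \<union> y ` (tail_sets n d - tail_sets n' d)"
  using tail_sets_mono[OF assms, of d] by (simp add: Un_absorb1 flip: image_Un)

lemma lower_Suc: "lower n d Q \<Longrightarrow> lower (Suc n) d Q"
proof (induction rule: lower.induct)
  case (lower_insert Q j z)
  have "z ` tail_sets n j = z ` tail_sets (Suc n) j \<union> z ` (tail_sets n j - tail_sets (Suc n) j)"
    by (rule fam_image_split) simp
  moreover have "lower (Suc n) d (z ` tail_sets (Suc n) j)"
    using lower_insert fam_mono by (intro lower_fam) auto
  moreover have "lower (Suc n) d (z ` (tail_sets n j - tail_sets (Suc n) j))"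
    using lower_insert.hyps by (intro lower_deg_mono[OF fam_image_Suc]) auto
  ultimately show ?case using lower_insert lower_Un by simp
qed (rule lower_empty)

lemma lower_mono:
  assumes "lower n d Q" "n \<le> n'"
  shows "lower n' d Q"
  using assms(2,1) by (induction n' rule: dec_induct) (auto intro: lower_Suc)

text \<open>An index set that meets \<open>{n..<n'}\<close> has fewer than \<open>d\<close> indices
  left on which the smaller group acts. The proof lets go of one index at a time.\<close>

lemma fam_image_diff:
  assumes "fam n d y" "n \<le> n'"
  shows "lower n' d (y ` (tail_sets n d - tail_sets n' d))"
  using assms(2)
proof (induction n' rule: dec_induct)
  case base
  show ?case by (simp add: lower_empty)
next
  case (step m)
  have "tail_sets n d - tail_sets (Suc m) d =
      (tail_sets n d - tail_sets m d) \<union> (tail_sets m d - tail_sets (Suc m) d)"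
    using tail_sets_mono[of n m d] tail_sets_mono[of m "Suc m" d] step by auto
  then show ?case
    using step lower_Suc[OF step.IH] fam_image_Suc[OF fam_mono[OF assms(1)]]
    by (simp add: image_Un lower_Un)
qed



lemma lower_gact: "lower n d Q \<Longrightarrow> g \<in> sym_fix n \<Longrightarrow> v \<in> Q \<Longrightarrow> gact g v \<in> Q"
  by (induction rule: lower.induct) (auto simp: famD intro!: imageI tail_sets_image)

lemma stable_span_lower: "stable n Y \<Longrightarrow> lower n d Q \<Longrightarrow> stable n (span (Y \<union> Q))"
  by (rule stable_span) (auto dest: stable_gact lower_gact intro: span_base)

lemma stable_span_Un: "stable n Y \<Longrightarrow> fam n d y \<Longrightarrow> stable n (span (Y \<union> y ` tail_sets n d))"
  by (rule stable_span_lower[where d = "Suc d"]) (auto intro: lower_fam)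

section \<open>Finitely generated subquotients are spanned by finitely many families\<close>

definition fin_gen_over :: "nat \<Rightarrow> 'w set \<Rightarrow> 'w set \<Rightarrow> bool" where
  "fin_gen_over n Y U \<longleftrightarrow>
    (\<exists>F. finite F \<and> F \<subseteq> U \<and> U = span (Y \<union> {gact g f |g f. g \<in> sym_fix n \<and> f \<in> F}))"

end

section \<open>Monomials that tell the orderings of a finite set apart\<close>

definition list_monom :: "nat list \<Rightarrow> (nat \<Rightarrow>\<^sub>0 nat)" where
  "list_monom s = (\<Sum>k<length s. Poly_Mapping.single (s ! k) (Suc k))"

text \<open>The exponents in \<open>list_monom\<close> encode the positions in the list; they start
  at 1, so that the first entry is visible too. Permutations carry the element of \<open>s\<close>
  to that of the renamed list.\<close>

definition list_theta :: "nat list \<Rightarrow> 'k::field ratfun" where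
  "list_theta s = Fract (Poly_Mapping.single (list_monom s) 1) 1"

lemma lookup_list_monom_nth:
  "distinct s \<Longrightarrow> k < length s \<Longrightarrow> Poly_Mapping.lookup (list_monom s) (s ! k) = Suc k"
  by (simp add: list_monom_def lookup_sum lookup_single when_def nth_eq_iff_index_eq)

lemma lookup_list_monom_0_iff: "distinct s \<Longrightarrow> Poly_Mapping.lookup (list_monom s) i = 0 \<longleftrightarrow> i \<notin> set s"
  by (auto simp: list_monom_def lookup_sum lookup_single when_def in_set_conv_nth)

lemma list_monom_inj:
  assumes "distinct s" "distinct t" "list_monom s = list_monom t"
  shows "s = t"
proof -
  have "set s = set t"
    using assms lookup_list_monom_0_iff by (metis subsetI subset_antisym)
  then have len: "length s = length t" using assms by (metis distinct_card)
  show ?thesis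
  proof (rule nth_equalityI[OF len])
    fix k
    assume k: "k < length s"
    then have "s ! k \<in> set t" unfolding \<open>set s = set t\<close>[symmetric] by (rule nth_mem)
    then obtain l where l: "l < length t" "s ! k = t ! l" by (auto simp: in_set_conv_nth)
    then have "Suc k = Suc l" using lookup_list_monom_nth assms k by metis
    then show "s ! k = t ! k" using l by simp
  qed
qed

lemma list_theta_inj:
  "distinct s \<Longrightarrow> distinct t \<Longrightarrow> list_theta s = (list_theta t :: 'k::field ratfun) \<Longrightarrow> s = t"
  unfolding list_theta_def
  by (rule list_monom_inj) (auto dest!: arg_cong[where f = Poly_Mapping.keys])

lemma perm_list_theta: "perm_ratfun g (list_theta s) = list_theta (map (Perm.apply g) s)"
proof -
  have "perm_mon g (\<Sum>k\<in>A. m k) = (\<Sum>k\<in>A. perm_mon g (m k))" for A and m :: "nat \<Rightarrow> nat \<Rightarrow>\<^sub>0 nat"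
    by (induction A rule: infinite_finite_induct) (simp_all add: perm_mon_add)
  then have "perm_mon g (list_monom s) = list_monom (map (Perm.apply g) s)"
    by (simp add: list_monom_def)
  then show ?thesis by (simp add: list_theta_def perm_ratfun_Fract perm_mpoly_single)
qed

lemma permutations_of_set_apply:
  "permutations_of_set (Perm.apply g ` T) = map (Perm.apply g) ` permutations_of_set T"
  by (rule permutations_of_set_image_inj) (rule inj_on_subset[OF inj_apply subset_UNIV])

context semilinear
begin

text \<open>Vandermonde: the elements \<open>list_theta s\<close>, for the orderings \<open>s\<close> of \<open>T\<close>, are distinct, so the sums
  weighted by their powers recover every single translate of \<open>f\<close>.\<close>

lemma lower_orbit:
  assumes f: "\<And>g. g \<in> sym_fix (n + d) \<Longrightarrow> gact g f = f"
  shows "\<exists>Q. lower n (Suc d) Q \<and> span Q = span {gact g f |g. g \<in> sym_fix n}"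
proof -
  \<comment> \<open>A translate of \<open>f\<close> depends only on the images of \<open>n\<close>,
    ..., \<open>n + d - 1\<close>, since two permutations that agree there differ by one that fixes
    \<open>f\<close>. Hence the translates are indexed by lists of distinct entries, and
    \<open>z\<close> is this indexing.\<close>
  define ok where "ok s g \<longleftrightarrow> g \<in> sym_fix n \<and> (\<forall>k<d. Perm.apply g (n + k) = s ! k)" for s and g :: "nat perm"
  define z where "z s = gact (SOME g. ok s g) f" for s
  have z: "z s = gact g f" if "ok s g" for s g
  proof -
    let ?h = "SOME g. ok s g"
    have h: "ok s ?h" using that by (rule someI)
    have "inverse ?h * g \<in> sym_fix (n + d)"
      unfolding sym_fix_def
    proof (clarsimp simp: apply_times)
      fix i
      assume "i < n + d"
      moreover have "Perm.apply (inverse ?h) (Perm.apply g i) = i" if "Perm.apply g i = Perm.apply ?h i"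
        using that by simp
      moreover have "Perm.apply g i = Perm.apply ?h i" if "i < n + d"
      proof (cases "i < n")
        case True
        then show ?thesis using that h \<open>ok s g\<close> by (auto simp: ok_def sym_fix_def)
      next
        case False
        then have i: "n + (i - n) = i" "i - n < d" using that by auto
        have "Perm.apply g (n + (i - n)) = Perm.apply ?h (n + (i - n))"
          using h \<open>ok s g\<close> i(2) by (simp add: ok_def)
        then show ?thesis by (simp only: i(1))
      qed
      ultimately show "Perm.apply (inverse ?h) (Perm.apply g i) = i" by blast
    qed
    then have "gact ?h (gact (inverse ?h * g) f) = gact ?h f" using f by simp
    then show ?thesis by (simp add: z_def flip: gact_times mult.assoc)
  qed
  have ok_ex: "\<exists>g. ok s g" if "distinct s" "set s \<in> tail_sets n d" for s
  proof -
    have len: "length s = d" using that by (auto simp: tail_sets_def distinct_card)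
    define h where "h i = (if i < n then i else s ! (i - n))" for i
    have ge: "n \<le> s ! k" if "k < d" for k
      using that \<open>set s \<in> _\<close> len nth_mem[of k s] by (auto simp: tail_sets_def simp del: nth_mem)
    have "inj_on h {..<n + d}"
    proof (rule inj_onI)
      fix i j
      assume ij: "i \<in> {..<n + d}" "j \<in> {..<n + d}" "h i = h j"
      have "h l < n \<longleftrightarrow> l < n" if "l < n + d" for l
      proof (cases "l < n")
        case False
        then have "l - n < d" using that by linarith
        then show ?thesis using ge[of "l - n"] False by (simp add: h_def)
      qed (simp add: h_def)
      then have "i < n \<longleftrightarrow> j < n" using ij by (metis lessThan_iff)
      moreover have "s ! (i - n) = s ! (j - n) \<longleftrightarrow> i - n = j - n" if "n \<le> i" "n \<le> j"
        using that ij \<open>distinct s\<close> len by (intro nth_eq_iff_index_eq) auto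
      ultimately show "i = j" using ij by (cases "i < n") (auto simp: h_def)
    qed
    then obtain g where "\<forall>i\<in>{..<n + d}. Perm.apply g i = h i"
      using ex_perm_extending[of "{..<n + d}" h] by auto
    then have "ok s g" by (auto simp: ok_def sym_fix_def h_def)
    then show ?thesis ..
  qed
  have zmap: "gact g (z s) = z (map (Perm.apply g) s)"
    if "g \<in> sym_fix n" "distinct s" "set s \<in> tail_sets n d" for g s
  proof -
    have len: "length s = d" using that by (auto simp: tail_sets_def distinct_card)
    have "\<exists>h. ok s h" using that(2,3) by (rule ok_ex)
    then obtain h where h: "ok s h" ..
    then have "ok (map (Perm.apply g) s) (g * h)"
      using that(1) len by (auto simp: ok_def apply_times intro: sym_fix_times)
    then show ?thesis using z[OF h] z by (simp add: gact_times)
  qed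
  \<comment> \<open>Summing over all orderings makes the result depend on the set \<open>T\<close>
    only; the exponent \<open>j\<close> provides enough such sums to separate the orderings
    again.\<close>
  define y where "y j T = (\<Sum>s\<in>permutations_of_set T. list_theta s ^ j *s z s)" for j T
  have "fam n d (y j)" for j
    unfolding fam_def
  proof (intro ballI)
    fix g T
    assume g: "g \<in> sym_fix n" and T: "T \<in> tail_sets n d"
    have pw: "perm_ratfun g (a ^ j) = perm_ratfun g a ^ j" for a
      by (induction j) (simp_all add: perm_ratfun_mult)
    have "gact g (y j T) = (\<Sum>s\<in>permutations_of_set T.
        list_theta (map (Perm.apply g) s) ^ j *s z (map (Perm.apply g) s))"
      unfolding y_def gact_sum
      by (rule sum.cong)
        (use g T zmap in \<open>auto simp: gact_scale pw perm_list_theta dest: permutations_of_setD\<close>)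
    also have "\<dots> = y j (Perm.apply g ` T)"
      unfolding y_def permutations_of_set_apply
      by (subst sum.reindex) (auto simp: inj_on_def inj_map_eq_map[OF inj_apply])
    finally show "gact g (y j T) = y j (Perm.apply g ` T)" .
  qed
  note fam_y = this
  \<comment> \<open>There are \<open>fact d\<close> orderings of a \<open>d\<close>-set, so as many
    powers, starting from 0, give an invertible Vandermonde matrix.\<close>
  define Q where "Q = (\<Union>j<fact d. y j ` tail_sets n d)"
  have "lower n (Suc d) Q"
    unfolding Q_def by (rule lower_Union) (auto intro: lower_fam fam_y)
  moreover have "span Q = span {gact g f |g. g \<in> sym_fix n}" (is "_ = span ?R")
  proof (rule span_eqI')
    show "Q \<subseteq> span ?R"
    proof (clarsimp simp: Q_def y_def)
      fix j T
      assume T: "T \<in> tail_sets n d"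
      show "(\<Sum>s\<in>permutations_of_set T. list_theta s ^ j *s z s) \<in> span ?R"
      proof (intro span_sum span_scale span_base)
        fix s
        assume "s \<in> permutations_of_set T"
        then have "distinct s" "set s \<in> tail_sets n d" using T by (auto dest: permutations_of_setD)
        then obtain g where "ok s g" using ok_ex by blast
        then show "z s \<in> ?R" using z by (auto simp: ok_def)
      qed
    qed
    show "?R \<subseteq> span Q"
    proof clarify
      fix g
      assume g: "g \<in> sym_fix n"
      define s where "s = map (\<lambda>k. Perm.apply g (n + k)) [0..<d]"
      define T where "T = set s"
      have "distinct s" by (simp add: s_def distinct_map inj_on_def)
      have "T \<in> tail_sets n d"
        using sym_fix_le[OF g] distinct_card[OF \<open>distinct s\<close>] by (auto simp: T_def s_def tail_sets_def)
      have "ok s g" using g by (simp add: ok_def s_def)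
      let ?P = "permutations_of_set T"
      have "s \<in> ?P" using \<open>distinct s\<close> by (simp add: T_def permutations_of_set_def)
      \<comment> \<open>The Lagrange polynomial: it vanishes at the elements of all orderings except
        \<open>s\<close>, so its coefficients combine the \<open>y j T\<close> into a nonzero
        multiple of the translate that belongs to \<open>s\<close>.\<close>
      define p :: "'k ratfun poly" where "p = (\<Prod>t\<in>?P - {s}. [:- list_theta t, 1:])"
      have "degree p \<le> (\<Sum>t\<in>?P - {s}. 1)"
        unfolding p_def by (rule order_trans[OF degree_prod_sum_le]) auto
      also have "\<dots> < card ?P"
        using \<open>s \<in> ?P\<close> by (simp add: T_def card_gt_0_iff)
      also have "card ?P = fact d" using \<open>T \<in> _\<close> by (simp add: tail_sets_def)
      finally have deg: "degree p < fact d" .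
      have 0: "poly p (list_theta t) = 0" if "t \<in> ?P - {s}" for t
        unfolding p_def poly_prod using that by (intro prod_zero) (auto simp: T_def)
      have "poly p (list_theta s) \<noteq> 0"
        using \<open>s \<in> ?P\<close> list_theta_inj[where 'k = 'k]
        by (auto simp: p_def poly_prod T_def prod_zero_iff dest!: permutations_of_setD)
      moreover have "(\<Sum>j\<le>degree p. coeff p j *s y j T) = poly p (list_theta s) *s gact g f"
      proof -
        have "(\<Sum>j\<le>degree p. coeff p j *s y j T) = (\<Sum>t\<in>?P. \<Sum>j\<le>degree p. (coeff p j * list_theta t ^ j) *s z t)"
          unfolding y_def scale_sum_right by (subst sum.swap) simp
        also have "\<dots> = (\<Sum>t\<in>?P. poly p (list_theta t) *s z t)"
          by (simp add: poly_altdef scale_sum_left)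
        also have "\<dots> = (\<Sum>t\<in>?P. if t = s then poly p (list_theta s) *s z s else 0)"
          by (rule sum.cong) (use 0 in auto)
        also have "\<dots> = poly p (list_theta s) *s gact g f"
          using \<open>s \<in> ?P\<close> z[OF \<open>ok s g\<close>] by (simp add: T_def)
        finally show ?thesis .
      qed
      moreover have "(\<Sum>j\<le>degree p. coeff p j *s y j T) \<in> span Q"
        using deg \<open>T \<in> _\<close> by (intro span_sum span_scale span_base) (auto simp: Q_def)
      ultimately have "inverse (poly p (list_theta s)) *s (poly p (list_theta s) *s gact g f) \<in> span Q"
        by (metis span_scale)
      then show "gact g f \<in> span Q" using \<open>poly p (list_theta s) \<noteq> 0\<close> by simp
    qed
  qed
  ultimately show ?thesis by blast
qed

definition smooth_vector :: "'w \<Rightarrow> bool" where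
  "smooth_vector v \<longleftrightarrow> (\<exists>n. \<forall>g\<in>sym_fix n. gact g v = v)"

lemma smooth_vector_ge:
  assumes "smooth_vector v"
  shows "\<exists>d. \<forall>g\<in>sym_fix (n + d). gact g v = v"
proof -
  obtain m where "\<forall>g\<in>sym_fix m. gact g v = v" using assms by (auto simp: smooth_vector_def)
  then show ?thesis using sym_fix_mono[of m "n + m"] by auto
qed

lemma fin_gen_over_lower:
  assumes "fin_gen_over n Y U" "\<And>v. v \<in> U \<Longrightarrow> smooth_vector v"
  shows "\<exists>d Q. lower n d Q \<and> U = span (Y \<union> Q)"
proof -
  obtain F where F: "finite F" "F \<subseteq> U" "U = span (Y \<union> {gact g f |g f. g \<in> sym_fix n \<and> f \<in> F})"
    using assms(1) by (auto simp: fin_gen_over_def)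
  have "\<exists>d Q. lower n d Q \<and> span Q = span {gact g f |g f. g \<in> sym_fix n \<and> f \<in> F}"
    using F(1,2)
  proof (induction F rule: finite_induct)
    case empty
    show ?case by (rule exI[of _ 0], rule exI[of _ "{}"]) (simp add: lower_empty)
  next
    case (insert f F)
    obtain d Q where Q: "lower n d Q" "span Q = span {gact g f |g f. g \<in> sym_fix n \<and> f \<in> F}"
      using insert by auto
    obtain e where "\<forall>g\<in>sym_fix (n + e). gact g f = f"
      using insert assms(2) smooth_vector_ge by blast
    then obtain R where R: "lower n (Suc e) R" "span R = span {gact g f |g. g \<in> sym_fix n}"
      using lower_orbit by blast
    have "{gact g f' |g f'. g \<in> sym_fix n \<and> f' \<in> insert f F} =
        {gact g f |g. g \<in> sym_fix n} \<union> {gact g f |g f. g \<in> sym_fix n \<and> f \<in> F}"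
      by auto
    moreover have "span (R \<union> Q) = span ({gact g f |g. g \<in> sym_fix n} \<union> {gact g f |g f. g \<in> sym_fix n \<and> f \<in> F})"
      using span_Un_cong[OF Q(2), of R] span_Un_cong[OF R(2), of "{gact g f |g f. g \<in> sym_fix n \<and> f \<in> F}"]
      by (metis (no_types, lifting) Un_commute)
    ultimately have "span (R \<union> Q) = span {gact g f' |g f'. g \<in> sym_fix n \<and> f' \<in> insert f F}"
      by simp
    moreover have "lower n (max d (Suc e)) (R \<union> Q)"
      using Q(1) R(1) by (intro lower_Un) (auto intro: lower_deg_mono)
    ultimately show ?case by blast
  qed
  then obtain d Q where "lower n d Q" "span Q = span {gact g f |g f. g \<in> sym_fix n \<and> f \<in> F}"
    by blast
  then show ?thesis using F(3) span_Un_cong[of Q _ Y] by (intro exI[of _ d] exI[of _ Q]) simp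
qed

end

section \<open>Linear combinations of a family\<close>

text \<open>The formula for the action on \<open>I_rep r\<close> is the same for every
  \<open>r\<close>; the index 0 is an arbitrary representative.\<close>

abbreviation subset_act :: "nat perm \<Rightarrow> (nat set \<Rightarrow>\<^sub>0 'k::field ratfun) \<Rightarrow> (nat set \<Rightarrow>\<^sub>0 'k ratfun)" where
  "subset_act \<equiv> act (I_rep 0)"

lemma act_I_rep_eq: "act (I_rep r) = subset_act"
  by (simp add: I_rep_def)

lemma keys_subset_act:
  fixes f :: "nat set \<Rightarrow>\<^sub>0 'a::field ratfun"
  shows "Poly_Mapping.keys (subset_act g f) = (`) (Perm.apply g) ` Poly_Mapping.keys f"
proof -
  have [simp]: "perm_ratfun g a = 0 \<longleftrightarrow> a = 0" for a :: "'a ratfun"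
    by (metis perm.left_inverse perm_ratfun_0 perm_ratfun_one perm_ratfun_times)
  show ?thesis
  proof (intro equalityI subsetI)
    fix S
    assume "S \<in> Poly_Mapping.keys (subset_act g f)"
    then have "Perm.apply (inverse g) ` S \<in> Poly_Mapping.keys f"
      by (simp add: in_keys_iff lookup_act_I_rep)
    then show "S \<in> (`) (Perm.apply g) ` Poly_Mapping.keys f"
      by (metis image_eqI image_inverse_image(2))
  qed (auto simp: in_keys_iff lookup_act_I_rep)
qed

lemma lookup_subset_act_image:
  "Poly_Mapping.lookup (subset_act g f) (Perm.apply g ` S) = perm_ratfun g (Poly_Mapping.lookup f S)"
  by (simp add: lookup_act_I_rep)

text \<open>If a set of the support contained some \<open>t\<close> outside \<open>B\<close>, the
  exchange of \<open>t\<close> with an index that occurs nowhere would fix \<open>f\<close> and yet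
  produce a set of the support that contains the new index.\<close>

lemma keys_fixed_subset:
  assumes fixed: "\<And>g. \<forall>i\<in>B. Perm.apply g i = i \<Longrightarrow> subset_act g f = f"
    and "finite B" "\<And>T. T \<in> Poly_Mapping.keys f \<Longrightarrow> finite T" "T \<in> Poly_Mapping.keys f"
  shows "T \<subseteq> B"
proof
  fix t
  assume "t \<in> T"
  show "t \<in> B"
  proof (rule ccontr)
    assume "t \<notin> B"
    have "finite (B \<union> \<Union> (Poly_Mapping.keys f))" using assms by auto
    then obtain t' where t': "t' \<notin> B \<union> \<Union> (Poly_Mapping.keys f)"
      using ex_new_if_finite infinite_UNIV_nat by blast
    let ?g = "Perm.swap t t'"
    have "subset_act ?g f = f"
      using t' \<open>t \<notin> B\<close> by (intro fixed) (auto simp: apply_swap)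
    then have "Perm.apply ?g ` T \<in> Poly_Mapping.keys f"
      using keys_subset_act[of ?g f] assms(4) by auto
    moreover have "t' \<in> Perm.apply ?g ` T"
      using \<open>t \<in> T\<close> by (rule rev_image_eqI) (simp add: apply_swap)
    ultimately show False using t' by blast
  qed
qed

context semilinear
begin

definition comb :: "('i \<Rightarrow> 'w) \<Rightarrow> ('i \<Rightarrow>\<^sub>0 'k ratfun) \<Rightarrow> 'w" where
  "comb y f = (\<Sum>i\<in>Poly_Mapping.keys f. Poly_Mapping.lookup f i *s y i)"

lemma comb_superset:
  "finite A \<Longrightarrow> Poly_Mapping.keys f \<subseteq> A \<Longrightarrow> comb y f = (\<Sum>i\<in>A. Poly_Mapping.lookup f i *s y i)"
  unfolding comb_def by (rule sum.mono_neutral_left) (auto simp: in_keys_iff)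

lemma comb_zero [simp]: "comb y 0 = 0"
  by (simp add: comb_def)

lemma comb_single [simp]: "comb y (Poly_Mapping.single i a) = a *s y i"
  by (cases "a = 0") (simp_all add: comb_def)

lemma comb_add: "comb y (f + h) = comb y f + comb y h"
proof -
  let ?A = "Poly_Mapping.keys f \<union> Poly_Mapping.keys h"
  have "comb y (f + h) = (\<Sum>i\<in>?A. Poly_Mapping.lookup (f + h) i *s y i)"
    by (rule comb_superset) (use keys_add[of f h] in auto)
  also have "\<dots> = comb y f + comb y h"
    by (simp add: comb_superset[of ?A f] comb_superset[of ?A h] lookup_add scale_left_distrib sum.distrib)
  finally show ?thesis .
qed

lemma comb_smult: "comb y (Poly_Mapping.map ((*) a) f) = a *s comb y f"
proof -
  have "comb y (Poly_Mapping.map ((*) a) f) = (\<Sum>i\<in>Poly_Mapping.keys f. (a * Poly_Mapping.lookup f i) *s y i)"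
    by (subst comb_superset[of "Poly_Mapping.keys f"]) (auto simp: map.rep_eq when_def in_keys_iff lookup_smult)
  then show ?thesis by (simp add: comb_def scale_sum_right)
qed

lemma comb_minus: "comb y (- f) = - comb y f"
  using comb_add[of y f "- f"] by (simp add: eq_neg_iff_add_eq_0 add.commute)

lemma comb_diff: "comb y (f - h) = comb y f - comb y h"
  using comb_add[of y f "- h"] by (simp add: comb_minus)

lemma comb_sum: "comb y (\<Sum>i\<in>A. h i) = (\<Sum>i\<in>A. comb y (h i))"
  by (induction A rule: infinite_finite_induct) (simp_all add: comb_add)

lemma comb_in_span: "Poly_Mapping.keys f \<subseteq> B \<Longrightarrow> comb y f \<in> span (y ` B)"
  unfolding comb_def by (intro span_sum span_scale span_base) auto

lemma span_image_comb:
  assumes "v \<in> span (y ` B)"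
  shows "\<exists>f. Poly_Mapping.keys f \<subseteq> B \<and> v = comb y f"
  using assms
proof (induction rule: span_induct_alt)
  case base
  show ?case by (rule exI[of _ 0]) simp
next
  case (step c x v)
  then obtain f i where "Poly_Mapping.keys f \<subseteq> B" "v = comb y f" "i \<in> B" "x = y i" by blast
  then show ?case
    using keys_add[of "Poly_Mapping.single i c" f]
    by (intro exI[of _ "Poly_Mapping.single i c + f"]) (auto simp: comb_add split: if_splits)
qed

lemma span_Un_image_comb:
  assumes "subspace Z" "v \<in> span (Z \<union> y ` B)"
  shows "\<exists>z f. z \<in> Z \<and> Poly_Mapping.keys f \<subseteq> B \<and> v = z + comb y f"
proof -
  obtain z w where "z \<in> span Z" "w \<in> span (y ` B)" "v = z + w"
    using assms(2) unfolding span_Un by blast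
  moreover have "span Z = Z" using assms(1) by simp
  ultimately show ?thesis using span_image_comb[of w y B] by metis
qed

lemma gact_comb:
  assumes "fam n d y" "g \<in> sym_fix n" "Poly_Mapping.keys f \<subseteq> tail_sets n d"
  shows "gact g (comb y f) = comb y (subset_act g f)"
proof -
  have "comb y (subset_act g f) =
      (\<Sum>T\<in>(`) (Perm.apply g) ` Poly_Mapping.keys f. Poly_Mapping.lookup (subset_act g f) T *s y T)"
    by (simp add: comb_def keys_subset_act)
  also have "\<dots> = (\<Sum>T\<in>Poly_Mapping.keys f. perm_ratfun g (Poly_Mapping.lookup f T) *s y (Perm.apply g ` T))"
    by (subst sum.reindex) (auto simp: inj_on_subset[OF inj_image_perm] lookup_subset_act_image)
  also have "\<dots> = gact g (comb y f)"
    unfolding comb_def gact_sum using assms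
    by (intro sum.cong refl) (auto simp: gact_scale famD)
  finally show ?thesis ..
qed

text \<open>For a family this says that the induced map from $I_n^d$ to the quotient by
  \<open>Z\<close> is injective, so that it makes a free piece of a filtration.\<close>

definition indep_over :: "'w set \<Rightarrow> 'i set \<Rightarrow> ('i \<Rightarrow> 'w) \<Rightarrow> bool" where
  "indep_over Z B y \<longleftrightarrow> (\<forall>f. Poly_Mapping.keys f \<subseteq> B \<longrightarrow> comb y f \<in> Z \<longrightarrow> f = 0)"

text \<open>Translating a nontrivial relation so that only one of its index sets leaves \<open>{..<n'}\<close>
  expresses every \<open>y T\<close> with \<open>T\<close> beyond \<open>n'\<close> by families of smaller degree.\<close>

lemma dependent_fam:
  assumes y: "fam n d y" and Z: "stable n Z"
    and f: "Poly_Mapping.keys f \<subseteq> tail_sets n d" "comb y f \<in> Z" "f \<noteq> 0"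
  shows "\<exists>n'\<ge>n. y ` tail_sets n' d \<subseteq> span (Z \<union> y ` (tail_sets n d - tail_sets n' d))"
proof -
  obtain S where S: "S \<in> Poly_Mapping.keys f" using f(3) by fastforce
  have fin: "finite (\<Union> (Poly_Mapping.keys f))" using f(1) by (auto simp: tail_sets_def)
  then obtain m where m: "\<Union> (Poly_Mapping.keys f) \<subseteq> {..<m}"
    using finite_nat_iff_bounded by blast
  define n' where "n' = max n m"
  have n': "T \<subseteq> {..<n'}" if "T \<in> Poly_Mapping.keys f" for T
    using m that by (auto simp: n'_def)
  have "y T \<in> span (Z \<union> y ` (tail_sets n d - tail_sets n' d))" if T: "T \<in> tail_sets n' d" for T
  proof -
    have Sn: "S \<in> tail_sets n d" using S f(1) by auto
    \<comment> \<open>The translation moves the chosen set \<open>S\<close> onto the given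
      \<open>T\<close> beyond \<open>n'\<close> and fixes every other index below
      \<open>n'\<close>.\<close>
    obtain g where g: "Perm.apply g ` S = T" "\<forall>i\<in>{..<n'} - S. Perm.apply g i = i"
    proof -
      have "({..<n'} - S) \<inter> T = {}" using tail_setsD(4)[OF T] by fastforce
      then show thesis
        using ex_perm_image_fixing[of S T "{..<n'} - S"] tail_setsD[OF Sn] tail_setsD[OF T] that
        by (metis Diff_disjoint Int_commute finite_Diff finite_lessThan)
    qed
    have "i \<in> {..<n'} - S" if "i < n" for i
      using that tail_setsD(4)[OF Sn, of i] by (auto simp: n'_def)
    then have gn: "g \<in> sym_fix n" using g(2) by (simp add: sym_fix_def)
    define h where "h = subset_act g f"
    have hT: "Poly_Mapping.lookup h T = perm_ratfun g (Poly_Mapping.lookup f S)"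
      unfolding h_def g(1)[symmetric] by (rule lookup_subset_act_image)
    have TK: "T \<in> Poly_Mapping.keys h" unfolding h_def keys_subset_act using S g(1) by blast
    have "comb y h \<in> Z"
      using gact_comb[OF y gn f(1)] stable_gact[OF Z gn f(2)] by (simp add: h_def)
    have "y R \<in> span (Z \<union> y ` (tail_sets n d - tail_sets n' d))" if R: "R \<in> Poly_Mapping.keys h" "R \<noteq> T" for R
    proof -
      obtain R' where R': "R' \<in> Poly_Mapping.keys f" "R = Perm.apply g ` R'"
        using R(1) by (auto simp: h_def keys_subset_act)
      have R'n: "R' \<in> tail_sets n d" using R' f(1) by auto
      \<comment> \<open>All sets of the relation have \<open>d\<close> elements, so each one other
        than \<open>S\<close> has an element outside \<open>S\<close>. This element lies below
        \<open>n'\<close> and is not moved, so only the translate of \<open>S\<close> can lie beyond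
        \<open>n'\<close>.\<close>
      have "R' \<noteq> S" using R' R(2) g(1) by auto
      then have "\<not> R' \<subseteq> S"
        using R'n Sn card_subset_eq[of S R'] by (auto simp: tail_sets_def)
      then obtain i where i: "i \<in> R'" "i \<notin> S" by blast
      then have "i < n'" using n'[OF R'(1)] by auto
      then have "Perm.apply g i = i" using g(2) i by auto
      then have "i \<in> R" using R' i by (metis imageI)
      then have "R \<notin> tail_sets n' d" using \<open>i < n'\<close> by (auto simp: tail_sets_def)
      moreover have "R \<in> tail_sets n d" using R' R'n tail_sets_image[OF gn] by simp
      ultimately show ?thesis by (intro span_base) blast
    qed
    then have "(\<Sum>R\<in>Poly_Mapping.keys h - {T}. Poly_Mapping.lookup h R *s y R)
        \<in> span (Z \<union> y ` (tail_sets n d - tail_sets n' d))"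
      by (intro span_sum span_scale) auto
    moreover have "comb y h = Poly_Mapping.lookup h T *s y T +
        (\<Sum>R\<in>Poly_Mapping.keys h - {T}. Poly_Mapping.lookup h R *s y R)"
      unfolding comb_def by (rule sum.remove) (use TK in auto)
    moreover have "comb y h \<in> span (Z \<union> y ` (tail_sets n d - tail_sets n' d))"
      using \<open>comb y h \<in> Z\<close> by (intro span_base) blast
    ultimately have "Poly_Mapping.lookup h T *s y T \<in> span (Z \<union> y ` (tail_sets n d - tail_sets n' d))"
      using span_diff[of "comb y h" _ "\<Sum>R\<in>Poly_Mapping.keys h - {T}. Poly_Mapping.lookup h R *s y R"]
      by simp
    then have "inverse (Poly_Mapping.lookup h T) *s (Poly_Mapping.lookup h T *s y T)
        \<in> span (Z \<union> y ` (tail_sets n d - tail_sets n' d))"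
      by (rule span_scale)
    then show ?thesis using TK by (simp add: in_keys_iff)
  qed
  then show ?thesis by (intro exI[of _ n']) (auto simp: n'_def)
qed

lemma dependent_fam_lower:
  assumes y: "fam n d y" and Z: "stable n Z" and dep: "\<not> indep_over Z (tail_sets n d) y"
  shows "\<exists>n'\<ge>n. \<exists>Q. lower n' d Q \<and> span (Z \<union> y ` tail_sets n d) = span (Z \<union> Q)"
proof -
  obtain n' where n': "n' \<ge> n" "y ` tail_sets n' d \<subseteq> span (Z \<union> y ` (tail_sets n d - tail_sets n' d))"
    using dependent_fam[OF y Z] dep unfolding indep_over_def by blast
  let ?Q = "y ` (tail_sets n d - tail_sets n' d)"
  have "span (Z \<union> y ` tail_sets n d) = span (Z \<union> ?Q)"
  proof (rule span_eqI')
    show "Z \<union> y ` tail_sets n d \<subseteq> span (Z \<union> ?Q)"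
      unfolding fam_image_split[OF n'(1)] using n'(2) span_superset[of "Z \<union> ?Q"] by blast
    show "Z \<union> ?Q \<subseteq> span (Z \<union> y ` tail_sets n d)"
      by (rule subset_trans[OF _ span_superset]) blast
  qed
  then show ?thesis using fam_image_diff[OF y n'(1)] n'(1) by blast
qed

section \<open>Finitely generated objects are noetherian\<close>

abbreviation orbits :: "nat \<Rightarrow> 'w set \<Rightarrow> 'w set" where
  "orbits n F \<equiv> {gact g f |g f. g \<in> sym_fix n \<and> f \<in> F}"

lemma gact_orbits: "g \<in> sym_fix n \<Longrightarrow> v \<in> orbits n F \<Longrightarrow> gact g v \<in> orbits n F"
proof clarify
  fix h f
  assume "g \<in> sym_fix n" "h \<in> sym_fix n" "f \<in> F"
  then show "\<exists>h' f'. gact g (gact h f) = gact h' f' \<and> h' \<in> sym_fix n \<and> f' \<in> F"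
    by (intro exI[of _ "g * h"] exI[of _ f]) (simp add: gact_times sym_fix_times)
qed

lemma stable_span_orbits: "stable n Y \<Longrightarrow> stable n (span (Y \<union> orbits n F))"
proof (rule stable_span)
  fix g v
  assume "stable n Y" "g \<in> sym_fix n" "v \<in> Y \<union> orbits n F"
  then have "gact g v \<in> Y \<union> orbits n F"
    using gact_orbits[of g n v F] stable_gact[of n Y g v] by blast
  then show "gact g v \<in> span (Y \<union> orbits n F)" by (rule span_base)
qed

lemma orbits_subset: "stable n U \<Longrightarrow> F \<subseteq> U \<Longrightarrow> orbits n F \<subseteq> U"
  by (auto simp: stable_gact subset_iff)

lemma subset_orbits: "F \<subseteq> orbits n F"
  by (clarify, rule exI[of _ 1]) auto

lemma orbits_mono_n: "n \<le> n' \<Longrightarrow> orbits n' F \<subseteq> orbits n F"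
  using sym_fix_mono[of n n'] by blast

lemma fin_gen_overI:
  assumes "stable n U" "Y \<subseteq> U" "finite F" "F \<subseteq> U" "U \<subseteq> span (Y \<union> orbits n F)"
  shows "fin_gen_over n Y U"
proof -
  have "span (Y \<union> orbits n F) \<subseteq> U"
    using assms orbits_subset by (intro span_minimal stable_subspace[OF assms(1)]) auto
  then show ?thesis using assms unfolding fin_gen_over_def by blast
qed

lemma fin_gen_over_obtain:
  assumes "fin_gen_over n Y U"
  obtains F where "finite F" "F \<subseteq> U" "U = span (Y \<union> orbits n F)"
  using assms unfolding fin_gen_over_def by blast

lemma fin_gen_over_trans:
  assumes "fin_gen_over n Y V" "fin_gen_over n V U"
  shows "fin_gen_over n Y U"
proof -
  obtain F where F: "finite F" "F \<subseteq> V" "V = span (Y \<union> orbits n F)"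
    using assms(1) by (rule fin_gen_over_obtain)
  obtain G where G: "finite G" "G \<subseteq> U" "U = span (V \<union> orbits n G)"
    using assms(2) by (rule fin_gen_over_obtain)
  have "V \<subseteq> U" unfolding G(3) by (auto intro: span_base)
  have "U = span (Y \<union> (orbits n F \<union> orbits n G))"
    unfolding Un_assoc[symmetric]
    by (subst G(3), subst F(3), rule span_Un_span)
  also have "orbits n F \<union> orbits n G = orbits n (F \<union> G)" by blast
  finally show ?thesis
    unfolding fin_gen_over_def using F G \<open>V \<subseteq> U\<close> by (intro exI[of _ "F \<union> G"]) auto
qed

text \<open>The same generators serve, since the larger group has larger orbits. It brings a
  conclusion that was reached after restriction back to the original group.\<close>

lemma fin_gen_over_weaken:
  assumes "fin_gen_over n' Y U" "stable n U" "Y \<subseteq> U" "n \<le> n'"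
  shows "fin_gen_over n Y U"
proof -
  obtain F where F: "finite F" "F \<subseteq> U" "U = span (Y \<union> orbits n' F)"
    using assms(1) by (rule fin_gen_over_obtain)
  moreover have "span (Y \<union> orbits n' F) \<subseteq> span (Y \<union> orbits n F)"
    by (rule span_mono) (use orbits_mono_n[OF assms(4), of F] in blast)
  ultimately show ?thesis using assms by (intro fin_gen_overI[of _ _ _ F]) auto
qed

definition noeth_over :: "nat \<Rightarrow> 'w set \<Rightarrow> 'w set \<Rightarrow> bool" where
  "noeth_over n Y U \<longleftrightarrow> (\<forall>V. stable n V \<and> Y \<subseteq> V \<and> V \<subseteq> U \<longrightarrow> fin_gen_over n Y V)"

lemma noeth_over_trans:
  assumes "noeth_over n Y Z" "noeth_over n Z U" "stable n Z" "Y \<subseteq> Z" "Z \<subseteq> U" "stable n U"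
  shows "noeth_over n Y U"
  unfolding noeth_over_def
proof (intro allI impI, elim conjE)
  fix V
  assume V: "stable n V" "Y \<subseteq> V" "V \<subseteq> U"
  have "fin_gen_over n Y (V \<inter> Z)"
    using assms(1) V assms(3,4) stable_Int unfolding noeth_over_def by blast
  then obtain F where F: "finite F" "F \<subseteq> V \<inter> Z" "V \<inter> Z = span (Y \<union> orbits n F)"
    by (rule fin_gen_over_obtain)
  have "stable n (span (V \<union> Z))"
    by (rule stable_span) (use V assms(3) in \<open>auto dest: stable_gact intro: span_base\<close>)
  moreover have "span (V \<union> Z) \<subseteq> U"
    using V assms by (intro span_minimal stable_subspace) auto
  moreover have "Z \<subseteq> span (V \<union> Z)" by (auto intro: span_base)
  ultimately have "fin_gen_over n Z (span (V \<union> Z))"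
    using assms(2) unfolding noeth_over_def by blast
  then obtain G where G: "finite G" "G \<subseteq> span (V \<union> Z)" "span (V \<union> Z) = span (Z \<union> orbits n G)"
    by (rule fin_gen_over_obtain)
  have "\<exists>v\<in>V. f - v \<in> Z" if "f \<in> G" for f
  proof -
    have "f \<in> span (V \<union> Z)" using G(2) that by blast
    then obtain v z where "v \<in> V" "z \<in> Z" "f = v + z"
      using V(1) assms(3) by (auto simp: span_Un)
    then show ?thesis by (intro bexI[of _ v]) auto
  qed
  \<comment> \<open>The generators of \<open>V + Z\<close> modulo \<open>Z\<close> are corrected by
    elements of \<open>Z\<close> so that they lie in \<open>V\<close>; together with generators of
    the intersection they generate \<open>V\<close>.\<close>
  then obtain p where p: "\<And>f. f \<in> G \<Longrightarrow> p f \<in> V" "\<And>f. f \<in> G \<Longrightarrow> f - p f \<in> Z" by metis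
  have "V \<subseteq> span (Y \<union> orbits n (F \<union> p ` G))"
  proof
    fix v
    assume "v \<in> V"
    then have "v \<in> span (Z \<union> orbits n G)" unfolding G(3)[symmetric] by (auto intro: span_base)
    moreover have "orbits n G \<subseteq> span (Z \<union> orbits n (p ` G))"
    proof clarify
      fix g f
      assume gf: "g \<in> sym_fix n" "f \<in> G"
      have "gact g f = gact g (p f) + gact g (f - p f)" by (simp add: gact_diff)
      moreover have "gact g (f - p f) \<in> Z" using stable_gact[OF assms(3)] gf p(2) by blast
      moreover have "gact g (p f) \<in> orbits n (p ` G)" using gf by blast
      ultimately show "gact g f \<in> span (Z \<union> orbits n (p ` G))"
        by (simp only:) (intro span_add span_base UnI1 UnI2)
    qed
    then have "span (Z \<union> orbits n G) \<subseteq> span (Z \<union> orbits n (p ` G))"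
      by (intro span_minimal) (auto intro: span_base)
    ultimately have "v \<in> span (Z \<union> orbits n (p ` G))" by blast
    then obtain z w where zw: "z \<in> Z" "w \<in> span (orbits n (p ` G))" "v = z + w"
      using assms(3) by (auto simp: span_Un)
    have "orbits n (p ` G) \<subseteq> V" using p(1) by (intro orbits_subset[OF V(1)]) auto
    then have "w \<in> V" using zw(2) span_minimal[OF _ stable_subspace[OF V(1)]] by blast
    then have "z \<in> V \<inter> Z"
      using zw \<open>v \<in> V\<close> subspace_diff[OF stable_subspace[OF V(1)], of v w] by auto
    then have "z \<in> span (Y \<union> orbits n (F \<union> p ` G))"
      unfolding F(3) by (rule subsetD[OF span_mono, rotated]) blast
    moreover have "w \<in> span (Y \<union> orbits n (F \<union> p ` G))"
      using zw(2) by (rule subsetD[OF span_mono, rotated]) blast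
    ultimately show "v \<in> span (Y \<union> orbits n (F \<union> p ` G))"
      unfolding zw(3) by (rule span_add)
  qed
  then show "fin_gen_over n Y V"
    using V F p(1) G(1) by (intro fin_gen_overI[of _ _ _ "F \<union> p ` G"]) auto
qed

text \<open>A stable \<open>V\<close> larger than \<open>Z\<close> contains some \<open>u\<close>
  that is a nonzero combination of the family modulo \<open>Z\<close>. Once the orbit of
  \<open>u\<close> is added to \<open>Z\<close> the family becomes dependent, so after restriction
  the rest of \<open>V\<close> lies in a quotient of smaller degree, to which the induction
  hypothesis applies.\<close>

lemma noeth_over_fam:
  assumes IH: "\<And>n Y Q. stable n Y \<Longrightarrow> lower n d Q \<Longrightarrow> noeth_over n Y (span (Y \<union> Q))"
    and Z: "stable n Z" and y: "fam n d y"
  shows "noeth_over n Z (span (Z \<union> y ` tail_sets n d))"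
  unfolding noeth_over_def
proof (intro allI impI, elim conjE)
  fix V
  assume V: "stable n V" "Z \<subseteq> V" "V \<subseteq> span (Z \<union> y ` tail_sets n d)"
  show "fin_gen_over n Z V"
  proof (cases "V = Z")
    case True
    then show ?thesis using Z by (intro fin_gen_overI[of _ _ _ "{}"]) (auto intro: span_base)
  next
    case False
    then obtain u where u: "u \<in> V" "u \<notin> Z" using V by blast
    then obtain z f where zf: "z \<in> Z" "Poly_Mapping.keys f \<subseteq> tail_sets n d" "u = z + comb y f"
      using V span_Un_image_comb[OF stable_subspace[OF Z]] by blast
    define W where "W = span (Z \<union> orbits n {u})"
    have W: "stable n W" unfolding W_def by (rule stable_span_orbits[OF Z])
    have ZW: "Z \<subseteq> W" unfolding W_def by (auto intro: span_base)
    have uW: "u \<in> W" unfolding W_def using subset_orbits[of "{u}" n] by (intro span_base) auto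
    have WV: "W \<subseteq> V"
      unfolding W_def using V u orbits_subset[OF V(1), of "{u}"]
      by (intro span_minimal stable_subspace[OF V(1)]) auto
    have "comb y f \<in> W"
      using uW ZW zf subspace_diff[OF stable_subspace[OF W], of u z] by auto
    moreover have "f \<noteq> 0" using zf u by auto
    ultimately have "\<not> indep_over W (tail_sets n d) y" using zf(2) by (auto simp: indep_over_def)
    then obtain n' Q where n': "n' \<ge> n" "lower n' d Q" "span (W \<union> y ` tail_sets n d) = span (W \<union> Q)"
      using dependent_fam_lower[OF y W] by blast
    have "noeth_over n' W (span (W \<union> Q))"
      by (rule IH[OF stable_mono[OF W n'(1)] n'(2)])
    moreover have "V \<subseteq> span (W \<union> Q)"
      unfolding n'(3)[symmetric]
      by (rule subset_trans[OF V(3) span_mono]) (rule Un_mono[OF ZW order_refl])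
    ultimately have "fin_gen_over n' W V"
      using stable_mono[OF V(1) n'(1)] WV unfolding noeth_over_def by blast
    then have "fin_gen_over n W V"
      by (rule fin_gen_over_weaken[OF _ V(1) WV n'(1)])
    moreover have "fin_gen_over n Z W"
      using W ZW uW by (intro fin_gen_overI[of _ _ _ "{u}"]) (auto simp: W_def)
    ultimately show ?thesis using fin_gen_over_trans by blast
  qed
qed

lemma noeth_over_lower: "stable n Y \<Longrightarrow> lower n d Q \<Longrightarrow> noeth_over n Y (span (Y \<union> Q))"
proof (induction d arbitrary: n Y Q rule: less_induct)
  case (less d)
  note IH = less.IH and Y = less.prems(1)
  show ?case
    using less.prems(2)
  proof (induction rule: lower.induct)
    case lower_empty
    show ?case unfolding noeth_over_def
      using Y by (auto intro!: fin_gen_overI[of _ _ _ "{}"] span_base dest: subsetD)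
  next
    case (lower_insert Q j z)
    let ?Z = "span (Y \<union> Q)"
    have Z: "stable n ?Z" using stable_span_lower[OF Y lower_insert.hyps(1)] .
    have eq: "span (Y \<union> (z ` tail_sets n j \<union> Q)) = span (?Z \<union> z ` tail_sets n j)"
      unfolding span_Un_span by (simp add: Un_ac)
    show ?case unfolding eq
    proof (rule noeth_over_trans[OF lower_insert.IH])
      show "noeth_over n ?Z (span (?Z \<union> z ` tail_sets n j))"
        by (rule noeth_over_fam[OF IH[OF lower_insert.hyps(2)] Z lower_insert.hyps(3)])
      show "stable n (span (?Z \<union> z ` tail_sets n j))"
        by (rule stable_span_Un[OF Z lower_insert.hyps(3)])
    qed (use Z in \<open>auto intro: span_base\<close>)
  qed
qed

lemma fin_gen_over_subspace:
  assumes "fin_gen_over n Y U" "\<And>v. v \<in> U \<Longrightarrow> smooth_vector v"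
    and "stable n Y" "stable n V" "Y \<subseteq> V" "V \<subseteq> U"
  shows "fin_gen_over n Y V"
proof -
  obtain d Q where "lower n d Q" "U = span (Y \<union> Q)"
    using fin_gen_over_lower[OF assms(1,2)] by blast
  then show ?thesis using noeth_over_lower[OF assms(3)] assms(4-6) unfolding noeth_over_def by blast
qed

end

section \<open>Chains of free families\<close>

text \<open>Lists of degrees describe filtrations from the top downwards. A map onto the topmost
  piece is available directly, so a piece of largest degree should come first.\<close>

definition head_max :: "nat list \<Rightarrow> bool" where
  "head_max l \<longleftrightarrow> (\<forall>j\<in>set l. j \<le> hd l)"

text \<open>What restriction to a smaller group preserves: the list grows by entries of smaller
  degree, but its head and all its upper bounds stay. Quantifying over bounds \<open>b\<close>
  avoids the maximum of an empty list.\<close>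

definition same_head :: "nat list \<Rightarrow> nat list \<Rightarrow> bool" where
  "same_head l l' \<longleftrightarrow> (l = [] \<longleftrightarrow> l' = []) \<and> hd l' = hd l \<and> (\<forall>b. (\<forall>j\<in>set l. j \<le> b) \<longrightarrow> (\<forall>j\<in>set l'. j \<le> b))"

lemma same_head_refl [simp]: "same_head l l"
  by (simp add: same_head_def)

lemma same_head_trans: "same_head l l' \<Longrightarrow> same_head l' l'' \<Longrightarrow> same_head l l''"
  unfolding same_head_def by metis

context semilinear
begin

lemma indep_over_image:
  assumes "inj_on h B" "indep_over Z (h ` B) y"
  shows "indep_over Z B (\<lambda>i. y (h i))"
  unfolding indep_over_def
proof (intro allI impI)
  fix f
  assume f: "Poly_Mapping.keys f \<subseteq> B" "comb (\<lambda>i. y (h i)) f \<in> Z"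
  define f' where "f' = (\<Sum>i\<in>Poly_Mapping.keys f. Poly_Mapping.single (h i) (Poly_Mapping.lookup f i))"
  have "comb y f' = comb (\<lambda>i. y (h i)) f"
    by (simp add: f'_def comb_sum) (simp add: comb_def)
  moreover have "Poly_Mapping.keys f' \<subseteq> h ` B"
  proof
    fix S
    assume "S \<in> Poly_Mapping.keys f'"
    then obtain i where "i \<in> Poly_Mapping.keys f" "S \<in> Poly_Mapping.keys (Poly_Mapping.single (h i) (Poly_Mapping.lookup f i))"
      unfolding f'_def using keys_sum[of "\<lambda>i. Poly_Mapping.single (h i) (Poly_Mapping.lookup f i)" "Poly_Mapping.keys f"]
      by blast
    then show "S \<in> h ` B" using f(1) by (auto split: if_splits)
  qed
  ultimately have "f' = 0" using assms(2) f(2) by (simp add: indep_over_def)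
  show "f = 0"
  proof (rule poly_mapping_eqI)
    fix i
    show "Poly_Mapping.lookup f i = Poly_Mapping.lookup 0 i"
    proof (cases "i \<in> Poly_Mapping.keys f")
      case True
      have "Poly_Mapping.lookup f' (h i) = (\<Sum>j\<in>Poly_Mapping.keys f. if j = i then Poly_Mapping.lookup f j else 0)"
        unfolding f'_def lookup_sum
      proof (rule sum.cong[OF refl])
        fix j
        assume "j \<in> Poly_Mapping.keys f"
        then have "h j = h i \<longleftrightarrow> j = i"
          using True f(1) assms(1) by (meson inj_on_eq_iff subsetD)
        then show "Poly_Mapping.lookup (Poly_Mapping.single (h j) (Poly_Mapping.lookup f j)) (h i) =
            (if j = i then Poly_Mapping.lookup f j else 0)"
          by (simp add: lookup_single when_def)
      qed
      then show ?thesis using True \<open>f' = 0\<close> by simp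
    qed (simp add: in_keys_iff)
  qed
qed

lemma indep_over_subset: "indep_over Z B y \<Longrightarrow> A \<subseteq> B \<Longrightarrow> indep_over Z A y"
  unfolding indep_over_def by blast

lemma indep_over_Un:
  assumes "subspace Z" "indep_over Z (A \<union> B) y" "A \<inter> B = {}"
  shows "indep_over (span (Z \<union> y ` A)) B y"
  unfolding indep_over_def
proof (intro allI impI)
  fix f
  assume f: "Poly_Mapping.keys f \<subseteq> B" "comb y f \<in> span (Z \<union> y ` A)"
  obtain z h where zh: "z \<in> Z" "Poly_Mapping.keys h \<subseteq> A" "comb y f = z + comb y h"
    using span_Un_image_comb[OF assms(1) f(2)] by blast
  then have "comb y (f - h) \<in> Z" by (simp add: comb_diff)
  moreover have "Poly_Mapping.keys (f - h) \<subseteq> A \<union> B"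
    using keys_diff[of f h] f zh by blast
  ultimately have "f = h" using assms(2) by (auto simp: indep_over_def)
  then have "Poly_Mapping.keys f = {}" using f(1) zh(2) assms(3) by blast
  then show "f = 0" by simp
qed

text \<open>By \<open>indep_over\<close> each step adds a copy of $I_n^d$ to the quotient. The
  degree that is added last, at the top, is the head of the list.\<close>

inductive chain :: "nat \<Rightarrow> 'w set \<Rightarrow> 'w set \<Rightarrow> nat list \<Rightarrow> bool" for n Y where
  chain_Nil: "stable n Y \<Longrightarrow> chain n Y Y []"
| chain_Cons: "chain n Y Z l \<Longrightarrow> fam n d y \<Longrightarrow> indep_over Z (tail_sets n d) y \<Longrightarrow>
    chain n Y (span (Z \<union> y ` tail_sets n d)) (d # l)"

lemma chain_stable: "chain n Y U l \<Longrightarrow> stable n Y \<and> stable n U \<and> Y \<subseteq> U"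
proof (induction rule: chain.induct)
  case (chain_Cons Z l d y)
  then show ?case using stable_span_Un[of n Z d y] span_superset[of "Z \<union> y ` tail_sets n d"] by blast
qed simp

lemma chain_append: "chain n Z U l \<Longrightarrow> chain n Y Z l' \<Longrightarrow> chain n Y U (l @ l')"
  by (induction rule: chain.induct) (auto intro: chain.intros)

lemma chain_singleton:
  "stable n Z \<Longrightarrow> fam n d y \<Longrightarrow> indep_over Z (tail_sets n d) y \<Longrightarrow> chain n Z (span (Z \<union> y ` tail_sets n d)) [d]"
  using chain_Cons[OF chain_Nil] by blast

text \<open>The splitting of \<open>tail_sets_Suc\<close> as a filtration: the sets that contain
  \<open>n\<close> form the lower piece, of degree \<open>d - 1\<close>, and the others the upper
  one, so that \<open>d\<close> remains the head. In degree 0 there is nothing to split.\<close>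

lemma chain_Suc_singleton:
  assumes "stable n Z" "fam n d y" "indep_over Z (tail_sets n d) y"
  shows "\<exists>l. chain (Suc n) Z (span (Z \<union> y ` tail_sets n d)) (d # l) \<and> (\<forall>j\<in>set l. j \<le> d)"
proof (cases d)
  case 0
  then have "chain (Suc n) Z (span (Z \<union> y ` tail_sets (Suc n) d)) [d]"
    using assms by (intro chain_singleton) (auto intro: stable_mono fam_mono)
  then show ?thesis using 0 by (intro exI[of _ "[]"]) simp
next
  case (Suc e)
  let ?D = "tail_sets n d - tail_sets (Suc n) d"
  have D: "?D = insert n ` tail_sets (Suc n) e" unfolding Suc by (rule tail_sets_Suc)
  have DU: "?D \<union> tail_sets (Suc n) d = tail_sets n d"
    using tail_sets_mono[of n "Suc n" d] by (simp add: Un_absorb2)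
  have "inj_on (insert n) (tail_sets (Suc n) e)"
  proof (rule inj_onI)
    fix S T
    assume "S \<in> tail_sets (Suc n) e" "T \<in> tail_sets (Suc n) e" "insert n S = insert n T"
    moreover from this have "n \<notin> S" "n \<notin> T" by (auto dest: tail_setsD(4))
    ultimately show "S = T" by (simp add: insert_ident)
  qed
  moreover have "indep_over Z (insert n ` tail_sets (Suc n) e) y"
    unfolding D[symmetric] using assms(3) by (rule indep_over_subset) blast
  ultimately have "indep_over Z (tail_sets (Suc n) e) (\<lambda>R. y (insert n R))"
    by (rule indep_over_image)
  moreover have "fam (Suc n) e (\<lambda>R. y (insert n R))"
    using assms(2) Suc by (intro fam_insert) simp
  ultimately have "chain (Suc n) Z (span (Z \<union> (\<lambda>R. y (insert n R)) ` tail_sets (Suc n) e)) [e]"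
    using assms(1) by (intro chain_singleton) (auto intro: stable_mono)
  then have *: "chain (Suc n) Z (span (Z \<union> y ` ?D)) [e]" unfolding D by (simp add: image_image)
  have "indep_over (span (Z \<union> y ` ?D)) (tail_sets (Suc n) d) y"
    by (rule indep_over_Un[OF stable_subspace[OF assms(1)]]) (use assms(3) DU in auto)
  then have "chain (Suc n) Z (span (span (Z \<union> y ` ?D) \<union> y ` tail_sets (Suc n) d)) [d, e]"
    using assms(2) by (intro chain_Cons[OF *]) (auto intro: fam_mono)
  moreover have "span (span (Z \<union> y ` ?D) \<union> y ` tail_sets (Suc n) d) = span (Z \<union> y ` tail_sets n d)"
    unfolding span_Un_span Un_assoc image_Un[symmetric] DU ..
  ultimately show ?thesis using Suc by (intro exI[of _ "[e]"]) simp
qed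

lemma chain_Suc:
  "chain n Y U l \<Longrightarrow> \<exists>l'. chain (Suc n) Y U l' \<and> same_head l l'"
proof (induction rule: chain.induct)
  case chain_Nil
  then show ?case by (intro exI[of _ "[]"]) (auto simp: chain.chain_Nil stable_mono)
next
  case (chain_Cons Z l d y)
  then obtain l' where l': "chain (Suc n) Y Z l'" "same_head l l'" by blast
  have "stable n Z" using chain_stable[OF chain_Cons.hyps(1)] by simp
  then obtain l'' where l'': "chain (Suc n) Z (span (Z \<union> y ` tail_sets n d)) (d # l'')" "\<forall>j\<in>set l''. j \<le> d"
    using chain_Suc_singleton[of n Z d y] chain_Cons.hyps by blast
  have "chain (Suc n) Y (span (Z \<union> y ` tail_sets n d)) ((d # l'') @ l')"
    by (rule chain_append[OF l''(1) l'(1)])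
  moreover have "same_head (d # l) ((d # l'') @ l')"
    unfolding same_head_def
  proof (intro conjI allI impI ballI)
    fix b j
    assume b: "\<forall>j\<in>set (d # l). j \<le> b" and "j \<in> set ((d # l'') @ l')"
    then have "j \<le> d \<or> j \<in> set l'" using l''(2) by auto
    moreover have "d \<le> b" "\<forall>j\<in>set l'. j \<le> b" using b l'(2) by (simp_all add: same_head_def)
    ultimately show "j \<le> b" by auto
  qed auto
  ultimately show ?case by blast
qed

lemma chain_mono:
  assumes "chain n Y U l" "n \<le> n'"
  shows "\<exists>l'. chain n' Y U l' \<and> same_head l l'"
  using assms(2)
proof (induction n' rule: dec_induct)
  case base
  then show ?case using assms(1) same_head_refl by blast
next
  case (step m)
  then obtain l1 where l1: "chain m Y U l1" "same_head l l1"
    by blast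
  then show ?case using chain_Suc[OF l1(1)] same_head_trans by blast
qed

lemma chain_lower:
  "chain n Y U l \<Longrightarrow> (\<And>j. j \<in> set l \<Longrightarrow> j < d) \<Longrightarrow> \<exists>Q. lower n d Q \<and> U = span (Y \<union> Q)"
proof (induction rule: chain.induct)
  case chain_Nil
  then show ?case by (intro exI[of _ "{}"]) (simp add: lower_empty)
next
  case (chain_Cons Z l j y)
  then obtain Q where Q: "lower n d Q" "Z = span (Y \<union> Q)" by auto
  then show ?case
    using lower_insert[OF Q(1) _ chain_Cons.hyps(2)] chain_Cons.prems[of j]
    by (intro exI[of _ "y ` tail_sets n j \<union> Q"]) (simp add: span_Un_span Un_ac)
qed

lemma lower_Suc_split:
  "lower n (Suc d) Q \<Longrightarrow> \<exists>P ys. lower n d P \<and> (\<forall>y\<in>set ys. fam n d y) \<and> Q = P \<union> (\<Union>y\<in>set ys. y ` tail_sets n d)"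
proof (induction rule: lower.induct)
  case lower_empty
  show ?case by (intro exI[of _ "{}"] exI[of _ "[]"]) (simp add: lower.lower_empty)
next
  case (lower_insert Q j z)
  then obtain P ys where P: "lower n d P" "\<forall>y\<in>set ys. fam n d y" "Q = P \<union> (\<Union>y\<in>set ys. y ` tail_sets n d)"
    by blast
  show ?case
  proof (cases "j = d")
    case True
    then show ?thesis using P lower_insert.hyps by (intro exI[of _ P] exI[of _ "z # ys"]) auto
  next
    case False
    then have "j < d" using lower_insert.hyps by simp
    then have "lower n d (z ` tail_sets n j \<union> P)" using P lower_insert.hyps by (intro lower.lower_insert)
    then show ?thesis using P by (intro exI[of _ "z ` tail_sets n j \<union> P"] exI[of _ ys]) auto
  qed
qed

text \<open>The families of top degree are treated one by one. One that is independent over the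
  others is put on top of their filtration; one that is dependent is rewritten in smaller degree, at
  the price of a smaller group. Putting the top degree last makes the head maximal.\<close>

lemma ex_chain:
  "stable n Y \<Longrightarrow> lower n d Q \<Longrightarrow>
    \<exists>n'\<ge>n. \<exists>l. chain n' Y (span (Y \<union> Q)) l \<and> head_max l \<and> (\<forall>j\<in>set l. j < d)"
proof (induction d arbitrary: n Y Q)
  case 0
  then have "Q = {}" by (auto elim: lower.cases)
  then show ?case using 0
    by (intro exI[of _ n] conjI exI[of _ "[]"]) (auto simp: head_max_def chain_Nil)
next
  case (Suc d)
  \<comment> \<open>The claim ranges over all \<open>n\<close> and \<open>P\<close>: in the
    dependent case both change, while the list of top-degree families gets shorter.\<close>
  have *: "\<exists>n'\<ge>n. \<exists>l. chain n' Y (span (Y \<union> (P \<union> (\<Union>y\<in>set ys. y ` tail_sets n d)))) l \<and>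
      head_max l \<and> (\<forall>j\<in>set l. j < Suc d)"
    if "stable n Y" "lower n d P" "\<forall>y\<in>set ys. fam n d y" for n P ys
    using that
  proof (induction ys arbitrary: n P)
    case Nil
    then show ?case using Suc.IH[of n Y P] by (fastforce simp: less_Suc_eq)
  next
    case (Cons y ys)
    let ?R = "P \<union> (\<Union>y\<in>set ys. y ` tail_sets n d)"
    let ?Z = "span (Y \<union> ?R)"
    have y: "fam n d y" using Cons.prems by simp
    have eq: "span (Y \<union> (P \<union> (\<Union>y\<in>set (y # ys). y ` tail_sets n d))) = span (?Z \<union> y ` tail_sets n d)"
      unfolding span_Un_span by (simp add: Un_ac)
    have "lower n (Suc d) ?R"
      using Cons.prems by (intro lower_Un lower_Union) (auto intro: lower_deg_mono lower_fam)
    then have Z: "stable n ?Z" by (rule stable_span_lower[OF Cons.prems(1)])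
    show ?case
    proof (cases "indep_over ?Z (tail_sets n d) y")
      case True
      obtain n' l where l: "n' \<ge> n" "chain n' Y ?Z l" "\<forall>j\<in>set l. j < Suc d"
        using Cons.IH[OF Cons.prems(1,2)] Cons.prems(3) by auto
      have "chain n ?Z (span (?Z \<union> y ` tail_sets n d)) [d]"
        using Z y True by (rule chain_singleton)
      then obtain l' where l': "chain n' ?Z (span (?Z \<union> y ` tail_sets n d)) l'" "same_head [d] l'"
        using chain_mono[OF _ l(1)] by blast
      have "head_max (l' @ l) \<and> (\<forall>j\<in>set (l' @ l). j < Suc d)"
        using l'(2) l(3) by (auto simp: same_head_def head_max_def less_Suc_eq_le)
      then show ?thesis unfolding eq using l(1) chain_append[OF l'(1) l(2)] by blast
    next
      case False
      then obtain n' Q where n': "n' \<ge> n" "lower n' d Q" "span (?Z \<union> y ` tail_sets n d) = span (?Z \<union> Q)"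
        using dependent_fam_lower[OF y Z] by blast
      \<comment> \<open>Besides the rewritten family, the new lower part takes in the members of the
        remaining families whose index sets meet \<open>{n..<n'}\<close>; they would otherwise be
        lost on restriction.\<close>
      define P' where "P' = P \<union> Q \<union> (\<Union>y\<in>set ys. y ` (tail_sets n d - tail_sets n' d))"
      have "lower n' d P'"
        unfolding P'_def using Cons.prems n'
        by (intro lower_Un lower_Union) (auto intro: lower_mono fam_image_diff)
      moreover have "\<forall>y\<in>set ys. fam n' d y" using Cons.prems n'(1) by (auto intro: fam_mono)
      ultimately obtain m l where l: "m \<ge> n'" "chain m Y (span (Y \<union> (P' \<union> (\<Union>y\<in>set ys. y ` tail_sets n' d)))) l"
        "head_max l" "\<forall>j\<in>set l. j < Suc d"
        using Cons.IH[OF stable_mono[OF Cons.prems(1) n'(1)]] by blast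
      have "(\<Union>y\<in>set ys. y ` tail_sets n d) =
          (\<Union>y\<in>set ys. y ` tail_sets n' d) \<union> (\<Union>y\<in>set ys. y ` (tail_sets n d - tail_sets n' d))"
        unfolding UN_Un_distrib[symmetric] fam_image_split[OF n'(1), symmetric] ..
      then have "Y \<union> (P' \<union> (\<Union>y\<in>set ys. y ` tail_sets n' d)) = (Y \<union> ?R) \<union> Q"
        unfolding P'_def by (simp only: Un_ac)
      then have "span (Y \<union> (P' \<union> (\<Union>y\<in>set ys. y ` tail_sets n' d))) = span (?Z \<union> Q)"
        by (simp only: span_Un_span)
      also have "\<dots> = span (?Z \<union> y ` tail_sets n d)" by (rule n'(3)[symmetric])
      finally have "span (Y \<union> (P' \<union> (\<Union>y\<in>set ys. y ` tail_sets n' d))) = span (?Z \<union> y ` tail_sets n d)" .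
      then show ?thesis unfolding eq using l n'(1) by (intro exI[of _ m] exI[of _ l]) auto
    qed
  qed
  obtain P ys where "lower n d P" "\<forall>y\<in>set ys. fam n d y" "Q = P \<union> (\<Union>y\<in>set ys. y ` tail_sets n d)"
    using lower_Suc_split[OF Suc.prems(2)] by blast
  then show ?case using *[OF Suc.prems(1)] by blast
qed


section \<open>Counting invariants\<close>

text \<open>Projection along \<open>Y\<close> to a complement. Its range serves as a model of the
  quotient by \<open>Y\<close> within the same type; it need not commute with the group.\<close>

lemma ex_projection:
  assumes "subspace Y"
  shows "\<exists>p. Vector_Spaces.linear scale scale p \<and> (\<forall>v. p v = 0 \<longleftrightarrow> v \<in> Y) \<and> (\<forall>v. v - p v \<in> Y)"
proof -
  interpret vector_space_pair scale scale ..
  obtain C where C: "C \<subseteq> Y" "independent C" "Y \<subseteq> span C" by (rule maximal_independent_subset)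
  let ?B = "extend_basis C"
  obtain p where p: "Vector_Spaces.linear scale scale p" "\<forall>x\<in>?B. p x = (if x \<in> C then 0 else x)"
    using linear_independent_extend[OF independent_extend_basis[OF C(2)], of "\<lambda>x. if x \<in> C then 0 else x"] by blast
  interpret p: Vector_Spaces.linear scale scale p by (rule p(1))
  have diff: "v - p v \<in> Y" for v
  proof -
    have "v \<in> span ?B" using span_extend_basis[OF C(2)] by simp
    then show ?thesis
    proof (induction rule: span_induct_alt)
      case (step c x w)
      have "x - p x \<in> Y" using step(1) p(2) C(1) subspace_0[OF assms] by auto
      then have "c *s (x - p x) + (w - p w) \<in> Y"
        using step assms by (intro subspace_add subspace_scale)
      then show ?case by (simp add: p.add p.scale scale_right_diff_distrib algebra_simps)
    qed (simp add: p.zero subspace_0[OF assms])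
  qed
  have zero: "p v = 0" if "v \<in> Y" for v
  proof -
    have "v \<in> span C" using C(3) that by blast
    then show ?thesis
    proof (induction rule: span_induct_alt)
      case (step c x w)
      then have "p x = 0" using p(2) extend_basis_superset[OF C(2)] by auto
      then show ?case using step by (simp add: p.add p.scale)
    qed (simp add: p.zero)
  qed
  have "v \<in> Y" if "p v = 0" for v using diff[of v] that by simp
  then show ?thesis using p(1) diff zero by blast
qed

definition lin_indep_mod :: "'w set \<Rightarrow> 'w set \<Rightarrow> bool" where
  "lin_indep_mod Y B \<longleftrightarrow> (\<forall>c. (\<Sum>b\<in>B. c b *s b) \<in> Y \<longrightarrow> (\<forall>b\<in>B. c b = 0))"

text \<open>The exchange theorem in the quotient by \<open>Y\<close>, carried out on images under a
  projection with kernel \<open>Y\<close>.\<close>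

lemma lin_indep_mod_card_le:
  assumes "subspace Y" "finite B" "lin_indep_mod Y B" "finite C" "B \<subseteq> span (Y \<union> C)"
  shows "card B \<le> card C"
proof -
  obtain p where p: "Vector_Spaces.linear scale scale p" "\<And>v. p v = 0 \<longleftrightarrow> v \<in> Y"
    using ex_projection[OF assms(1)] by blast
  interpret vector_space_pair scale scale ..
  interpret p: Vector_Spaces.linear scale scale p by (rule p(1))
  have sum: "(\<Sum>b\<in>B. c b *s p b) = p (\<Sum>b\<in>B. c b *s b)" for c
    by (simp add: p.sum p.scale)
  have 0: "\<forall>b\<in>B. c b = 0" if "(\<Sum>b\<in>B. c b *s p b) = 0" for c
    using assms(3) that p(2) unfolding sum lin_indep_mod_def by blast
  have inj: "inj_on p B"
  proof (rule inj_onI)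
    fix a b
    assume ab: "a \<in> B" "b \<in> B" "p a = p b"
    show "a = b"
    proof (rule ccontr)
      assume "a \<noteq> b"
      define c :: "'w \<Rightarrow> 'k ratfun" where "c x = (if x = a then 1 else if x = b then - 1 else 0)" for x
      have "(\<Sum>x\<in>B. c x *s p x) = (\<Sum>x\<in>B. (if x = a then p a else 0) - (if x = b then p b else 0))"
        by (rule sum.cong) (use \<open>a \<noteq> b\<close> in \<open>auto simp: c_def\<close>)
      also have "\<dots> = 0" using ab assms(2) by (simp add: sum_subtractf)
      finally have "c a = 0" using 0[of c] ab(1) by blast
      then show False by (simp add: c_def)
    qed
  qed
  have "independent (p ` B)"
  proof
    assume "dependent (p ` B)"
    then obtain u where u: "\<exists>v\<in>p ` B. u v \<noteq> 0" "(\<Sum>v\<in>p ` B. u v *s v) = 0"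
      using dependent_finite[of "p ` B"] assms(2) by auto
    then have "(\<Sum>b\<in>B. u (p b) *s p b) = 0" using inj by (simp add: sum.reindex)
    then show False using u(1) 0[of "\<lambda>b. u (p b)"] by auto
  qed
  moreover have "p ` B \<subseteq> span (p ` C)"
  proof clarify
    fix b
    assume "b \<in> B"
    then obtain y w where "y \<in> span Y" "w \<in> span C" "b = y + w"
      using assms(5) unfolding span_Un by blast
    moreover have "span Y = Y" using assms(1) by simp
    ultimately have "p b = p w" using p(2) by (simp add: p.add)
    then show "p b \<in> span (p ` C)"
      using \<open>w \<in> span C\<close> linear_span_image[OF p(1), of C] by auto
  qed
  ultimately have "card (p ` B) \<le> card (p ` C)"
    using independent_span_bound[of "p ` C" "p ` B"] assms(4) by auto
  then show ?thesis using card_image[OF inj] card_image_le[OF assms(4), of p] by simp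
qed

lemma card_tail_sets_below: "card {T \<in> tail_sets n d. T \<subseteq> {..<N}} = (N - n) choose d"
proof -
  have "{T \<in> tail_sets n d. T \<subseteq> {..<N}} = {T. T \<subseteq> {n..<N} \<and> card T = d}"
  proof (intro equalityI subsetI)
    fix T
    assume "T \<in> {T. T \<subseteq> {n..<N} \<and> card T = d}"
    then show "T \<in> {T \<in> tail_sets n d. T \<subseteq> {..<N}}"
      using finite_subset[of T "{n..<N}"] by (auto simp: tail_sets_def)
  qed (auto simp: tail_sets_def)
  then show ?thesis by (simp add: n_subsets)
qed

text \<open>Representatives of the invariants of the quotient \<open>U / Y\<close>, which is weaker
  than being fixed in \<open>U\<close>.\<close>

definition invariants_mod :: "nat \<Rightarrow> 'w set \<Rightarrow> 'w set \<Rightarrow> 'w set" where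
  "invariants_mod N Y U = {v \<in> U. \<forall>g\<in>sym_fix N. gact g v - v \<in> Y}"

text \<open>A piece of degree \<open>d\<close> contributes the vectors \<open>y T\<close> with
  \<open>T\<close> between \<open>n\<close> and \<open>N\<close>, of which there are
  \<open>(N - n) choose d\<close>. The coefficients of an invariant vector with respect to the piece
  are themselves fixed, so by \<open>keys_fixed_subset\<close> they are supported on such
  \<open>T\<close>. As these \<open>y T\<close> are fixed in \<open>U\<close> and not only modulo a
  subspace, no invariant is lost from one piece to the next.\<close>

lemma chain_basis:
  assumes "chain n Y U l" "n \<le> N"
  shows "\<exists>B. finite B \<and> card B = (\<Sum>d\<leftarrow>l. (N - n) choose d) \<and> B \<subseteq> U \<and>
    (\<forall>b\<in>B. \<forall>g\<in>sym_fix N. gact g b = b) \<and> lin_indep_mod Y B \<and> invariants_mod N Y U \<subseteq> span (Y \<union> B)"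
  using assms(1)
proof (induction rule: chain.induct)
  case chain_Nil
  then show ?case
    by (intro exI[of _ "{}"]) (auto simp: lin_indep_mod_def invariants_mod_def)
next
  case (chain_Cons Z l d y)
  obtain B where B: "finite B" "card B = (\<Sum>d\<leftarrow>l. (N - n) choose d)" "B \<subseteq> Z"
    "\<And>b g. b \<in> B \<Longrightarrow> g \<in> sym_fix N \<Longrightarrow> gact g b = b" "lin_indep_mod Y B" "invariants_mod N Y Z \<subseteq> span (Y \<union> B)"
    using chain_Cons.IH by blast
  note y = chain_Cons.hyps(2) and ind = chain_Cons.hyps(3)
  have st: "stable n Y" "stable n Z" "Y \<subseteq> Z" using chain_stable[OF chain_Cons.hyps(1)] by auto
  note Z = stable_subspace[OF st(2)]
  define C where "C = {T \<in> tail_sets n d. T \<subseteq> {..<N}}"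
  have C: "C \<subseteq> tail_sets n d" "finite C"
    using finite_subset[of C "Pow {..<N}"] by (auto simp: C_def)
  have fixC: "gact g (y T) = y T" if "T \<in> C" "g \<in> sym_fix N" for g T
    using famD[OF y, of g T] that sym_fix_mono[OF assms(2)] sym_fix_image[of g N T]
    by (auto simp: C_def)
  have ind0: "\<forall>T\<in>C. c T = 0" if "(\<Sum>T\<in>C. c T *s y T) \<in> Z" for c
  proof -
    define f where "f = (\<Sum>T\<in>C. Poly_Mapping.single T (c T))"
    have lf: "Poly_Mapping.lookup f T = (c T when T \<in> C)" for T
      using C(2) by (simp add: f_def lookup_sum lookup_single when_def)
    have "Poly_Mapping.keys f \<subseteq> tail_sets n d"
      using C(1) by (auto simp: in_keys_iff lf)
    moreover have "comb y f \<in> Z" using that by (simp add: f_def comb_sum)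
    ultimately have "f = 0" using ind by (simp add: indep_over_def)
    then show ?thesis using lf by (metis lookup_zero when_simps(1))
  qed
  have injC: "inj_on y C"
  proof (rule inj_onI)
    fix S T
    assume ST: "S \<in> C" "T \<in> C" "y S = y T"
    have "comb y (Poly_Mapping.single S 1 - Poly_Mapping.single T 1) \<in> Z"
      using ST subspace_0[OF Z] by (simp add: comb_diff)
    moreover have "Poly_Mapping.keys (Poly_Mapping.single S 1 - Poly_Mapping.single T (1 :: 'k ratfun)) \<subseteq> tail_sets n d"
      using keys_diff[of "Poly_Mapping.single S (1 :: 'k ratfun)" "Poly_Mapping.single T 1"] ST C(1) by auto
    ultimately have "Poly_Mapping.single S (1 :: 'k ratfun) = Poly_Mapping.single T 1"
      using ind by (auto simp: indep_over_def)
    then show "S = T" by (metis keys_single singleton_inject zero_neq_one)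
  qed
  have disj: "B \<inter> y ` C = {}"
  proof (rule equals0I)
    fix b
    assume "b \<in> B \<inter> y ` C"
    then obtain T where T: "T \<in> C" "y T \<in> Z" using B(3) by auto
    have "(\<Sum>S\<in>C. (if S = T then 1 else 0) *s y S) = y T"
      using T C(2) by (simp add: if_distrib[of "\<lambda>a. a *s _"] cong: if_cong)
    then show False using ind0[of "\<lambda>S. if S = T then 1 else 0"] T by auto
  qed
  have card: "card (B \<union> y ` C) = (\<Sum>d\<leftarrow>(d # l). (N - n) choose d)"
    using B(1,2) C(2) disj card_image[OF injC]
    by (simp add: card_Un_disjoint C_def card_tail_sets_below)
  have "lin_indep_mod Y (B \<union> y ` C)"
    unfolding lin_indep_mod_def
  proof (intro allI impI)
    fix c
    assume c: "(\<Sum>b\<in>B \<union> y ` C. c b *s b) \<in> Y"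
    have split: "(\<Sum>b\<in>B \<union> y ` C. c b *s b) = (\<Sum>b\<in>B. c b *s b) + (\<Sum>T\<in>C. c (y T) *s y T)"
      using B(1) C(2) disj injC by (simp add: sum.union_disjoint sum.reindex)
    moreover have "(\<Sum>b\<in>B. c b *s b) \<in> Z"
      using B(3) by (intro subspace_sum[OF Z] subspace_scale[OF Z]) auto
    ultimately have "(\<Sum>T\<in>C. c (y T) *s y T) \<in> Z"
      using c st(3) subspace_diff[OF Z, of "\<Sum>b\<in>B \<union> y ` C. c b *s b" "\<Sum>b\<in>B. c b *s b"] by auto
    then have *: "\<forall>T\<in>C. c (y T) = 0" by (rule ind0)
    then have "(\<Sum>b\<in>B. c b *s b) \<in> Y" using c split by simp
    then show "\<forall>b\<in>B \<union> y ` C. c b = 0" using * B(5) by (auto simp: lin_indep_mod_def)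
  qed
  moreover have "invariants_mod N Y (span (Z \<union> y ` tail_sets n d)) \<subseteq> span (Y \<union> (B \<union> y ` C))"
  proof
    fix v
    assume "v \<in> invariants_mod N Y (span (Z \<union> y ` tail_sets n d))"
    then have v: "v \<in> span (Z \<union> y ` tail_sets n d)" "\<And>g. g \<in> sym_fix N \<Longrightarrow> gact g v - v \<in> Y"
      by (auto simp: invariants_mod_def)
    obtain z f where zf: "z \<in> Z" "Poly_Mapping.keys f \<subseteq> tail_sets n d" "v = z + comb y f"
      using span_Un_image_comb[OF Z v(1)] by blast
    \<comment> \<open>Invariance of \<open>v\<close> modulo \<open>Y\<close> becomes invariance
      modulo the larger \<open>Z\<close>, where the part \<open>z\<close> disappears and
      independence determines the coefficients.\<close>
    have fixf: "subset_act g f = f" if g: "g \<in> sym_fix N" for g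
    proof -
      have gn: "g \<in> sym_fix n" using g sym_fix_mono[OF assms(2)] by blast
      have "comb y (subset_act g f - f) = (gact g v - v) - (gact g z - z)"
        using zf(3) gact_comb[OF y gn zf(2)] by (simp add: comb_diff gact_add)
      moreover have "gact g z - z \<in> Z" using stable_gact[OF st(2) gn zf(1)] zf(1) subspace_diff[OF Z] by blast
      ultimately have "comb y (subset_act g f - f) \<in> Z"
        using v(2)[OF g] st(3) subspace_diff[OF Z] by auto
      moreover have "Poly_Mapping.keys (subset_act g f - f) \<subseteq> tail_sets n d"
        using keys_diff[of "subset_act g f" f] zf(2) tail_sets_image[OF gn] by (auto simp: keys_subset_act subset_iff)
      ultimately have "subset_act g f - f = 0" using ind unfolding indep_over_def by blast
      then show ?thesis by simp
    qed
    have "T \<subseteq> {..<N}" if "T \<in> Poly_Mapping.keys f" for T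
      by (rule keys_fixed_subset[of _ f])
        (use fixf that zf(2) in \<open>auto simp: sym_fix_def dest: tail_setsD(1)\<close>)
    then have fC: "Poly_Mapping.keys f \<subseteq> C" using zf(2) by (auto simp: C_def)
    \<comment> \<open>Since the combination of the family is fixed outright, \<open>z\<close>
      inherits the invariance modulo \<open>Y\<close>, and the induction hypothesis covers
      it.\<close>
    have "gact g z - z \<in> Y" if g: "g \<in> sym_fix N" for g
    proof -
      have gn: "g \<in> sym_fix n" using g sym_fix_mono[OF assms(2)] by blast
      have "gact g (comb y f) = comb y f" using gact_comb[OF y gn zf(2)] fixf[OF g] by simp
      then show ?thesis using v(2)[OF g] zf(3) by (simp add: gact_add)
    qed
    then have "z \<in> span (Y \<union> B)" using B(6) zf(1) by (auto simp: invariants_mod_def)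
    then have "z \<in> span (Y \<union> (B \<union> y ` C))" by (rule subsetD[OF span_mono, rotated]) auto
    moreover have "comb y f \<in> span (Y \<union> (B \<union> y ` C))"
      using comb_in_span[OF fC, of y] by (rule subsetD[OF span_mono, rotated]) auto
    ultimately show "v \<in> span (Y \<union> (B \<union> y ` C))" unfolding zf(3) by (rule span_add)
  qed
  moreover have "B \<union> y ` C \<subseteq> span (Z \<union> y ` tail_sets n d)"
    using B(3) C(1) by (intro subset_trans[OF _ span_superset]) auto
  moreover have "\<forall>b\<in>B \<union> y ` C. \<forall>g\<in>sym_fix N. gact g b = b" using B(4) fixC by auto
  ultimately show ?case using card B(1) C(2) by (intro exI[of _ "B \<union> y ` C"]) auto
qed

end

section \<open>Extending the symmetry of a map to the induced modules\<close>

text \<open>One ambient representation, with basis all sets of indices; every \<open>I_rep r\<close>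
  is a stable subspace of it.\<close>

interpretation subs: semilinear "\<lambda>a. Poly_Mapping.map ((*) a) :: (nat set \<Rightarrow>\<^sub>0 'k::field ratfun) \<Rightarrow> _" subset_act
proof unfold_locales
  fix a b :: "'k ratfun" and f h :: "nat set \<Rightarrow>\<^sub>0 'k ratfun" and g g' :: "nat perm"
  show "Poly_Mapping.map ((*) a) (f + h) = Poly_Mapping.map ((*) a) f + Poly_Mapping.map ((*) a) h"
    by (rule poly_mapping_eqI) (simp add: lookup_smult lookup_add algebra_simps)
  show "Poly_Mapping.map ((*) (a + b)) f = Poly_Mapping.map ((*) a) f + Poly_Mapping.map ((*) b) f"
    by (rule poly_mapping_eqI) (simp add: lookup_smult lookup_add algebra_simps)
  show "Poly_Mapping.map ((*) a) (Poly_Mapping.map ((*) b) f) = Poly_Mapping.map ((*) (a * b)) f"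
    by (rule poly_mapping_eqI) (simp add: lookup_smult)
  show "Poly_Mapping.map ((*) 1) f = f"
    by (rule poly_mapping_eqI) (simp add: lookup_smult)
  show "subset_act 1 f = f"
    by (rule poly_mapping_eqI) (simp add: lookup_act_I_rep)
  show "subset_act (g * g') f = subset_act g (subset_act g' f)"
    by (rule poly_mapping_eqI) (simp add: lookup_act_I_rep perm_ratfun_times image_image apply_times)
  show "subset_act g (f + h) = subset_act g f + subset_act g h"
    by (rule poly_mapping_eqI) (simp add: lookup_act_I_rep lookup_add perm_ratfun_add)
  show "subset_act g (Poly_Mapping.map ((*) a) f) = Poly_Mapping.map ((*) (perm_ratfun g a)) (subset_act g f)"
    by (rule poly_mapping_eqI) (simp add: lookup_act_I_rep lookup_smult perm_ratfun_mult)
qed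

lemma perm_ratfun_power: "perm_ratfun g (a ^ k) = perm_ratfun g a ^ k"
  by (induction k) (simp_all add: perm_ratfun_mult)

lemma perm_ratfun_inverse: "perm_ratfun g (inverse a) = inverse (perm_ratfun g a)"
proof (cases "a = 0")
  case False
  then have "perm_ratfun g (inverse a) * perm_ratfun g a = 1"
    by (simp flip: perm_ratfun_mult)
  then show ?thesis by (metis inverse_unique mult.commute)
qed simp

lemma perm_ratfun_powi: "perm_ratfun g (a powi k) = perm_ratfun g a powi k"
  by (simp add: power_int_def perm_ratfun_power perm_ratfun_inverse)

lemma eventually_apply_fixed: "\<forall>\<^sub>F b in sequentially. Perm.apply g b = b"
proof -
  obtain m where "affected g \<subseteq> {..<m}" using finite_nat_iff_bounded finite_affected by blast
  then show ?thesis
    by (intro eventually_sequentiallyI[of m]) (metis in_affected lessThan_iff not_le subsetD)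
qed

context semilinear
begin

text \<open>A $G_n$-equivariant map from the quotient \<open>U / L\<close> to $I_n^d$, written as a
  map on \<open>U\<close> that vanishes on \<open>L\<close>.\<close>

definition equivariant :: "nat \<Rightarrow> nat \<Rightarrow> 'w set \<Rightarrow> 'w set \<Rightarrow> ('w \<Rightarrow> (nat set \<Rightarrow>\<^sub>0 'k ratfun)) \<Rightarrow> bool" where
  "equivariant n d L U f \<longleftrightarrow> (\<forall>v\<in>U. \<forall>w\<in>U. f (v + w) = f v + f w) \<and>
    (\<forall>a. \<forall>v\<in>U. f (a *s v) = Poly_Mapping.map ((*) a) (f v)) \<and> (\<forall>v\<in>L. f v = 0) \<and>
    (\<forall>v\<in>U. Poly_Mapping.keys (f v) \<subseteq> tail_sets n d) \<and>
    (\<forall>g\<in>sym_fix n. \<forall>v\<in>U. f (gact g v) = subset_act g (f v))"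

lemma lower_families:
  "lower n d Q \<Longrightarrow> \<exists>F. finite F \<and> (\<forall>(j, z)\<in>F. j < d \<and> fam n j z) \<and> Q = (\<Union>(j, z)\<in>F. z ` tail_sets n j)"
proof (induction rule: lower.induct)
  case lower_empty
  show ?case by (intro exI[of _ "{}"]) simp
next
  case (lower_insert Q j z)
  then obtain F where "finite F" "\<forall>(j, z)\<in>F. j < d \<and> fam n j z" "Q = (\<Union>(j, z)\<in>F. z ` tail_sets n j)"
    by blast
  then show ?case using lower_insert.hyps by (intro exI[of _ "insert (j, z) F"]) auto
qed

end

text \<open>The map \<open>f\<close> is equivariant only for the stabiliser of the index \<open>p\<close>.  Its conjugates \<open>f\<^sub>b\<close> play the
  same role for the other indices \<open>b \<ge> p\<close>.  For a given \<open>v\<close> and all large \<open>b\<close> the coefficients of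
  \<open>f\<^sub>b v\<close> are one and the same rational function in the variable \<open>b\<close>, and its leading Laurent coefficient
  at 0 no longer depends on \<open>b\<close>.\<close>

locale descent = semilinear scale gact
  for scale :: "'k::field ratfun \<Rightarrow> 'w::ab_group_add \<Rightarrow> 'w" (infixr \<open>*s\<close> 75) and gact +
  fixes p d m :: nat and L U :: "'w set" and F :: "(nat \<times> (nat set \<Rightarrow> 'w)) set"
    and f :: "'w \<Rightarrow> (nat set \<Rightarrow>\<^sub>0 'k ratfun)"
  assumes U: "stable p U" and L: "stable p L" and pm: "p < m" and finF: "finite F"
    and F: "\<And>j z. (j, z) \<in> F \<Longrightarrow> j \<le> d \<and> fam m j z"
    and U_eq: "U = span (L \<union> (\<Union>(j, z)\<in>F. z ` tail_sets m j))"
    and f: "equivariant (Suc p) d L U f" and f_nz: "\<exists>v\<in>U. f v \<noteq> 0"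
begin

definition fconj :: "nat \<Rightarrow> 'w \<Rightarrow> (nat set \<Rightarrow>\<^sub>0 'k ratfun)" where
  "fconj b v = subset_act (Perm.swap p b) (f (gact (Perm.swap p b) v))"

lemma gens_subset: "L \<union> (\<Union>(j, z)\<in>F. z ` tail_sets m j) \<subseteq> U"
  unfolding U_eq by (rule span_superset)

lemma LU: "L \<subseteq> U"
  using gens_subset by blast

lemma swap_stable: "p \<le> b \<Longrightarrow> v \<in> U \<Longrightarrow> gact (Perm.swap p b) v \<in> U"
  by (rule stable_gact[OF U]) (auto intro: swap_in_sym_fix)

lemma f_gact: "g \<in> sym_fix (Suc p) \<Longrightarrow> v \<in> U \<Longrightarrow> f (gact g v) = subset_act g (f v)"
  using f by (simp add: equivariant_def)

text \<open>The group permutes the conjugates as it permutes their indices: composing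
  \<open>g\<close> with the exchanges of \<open>p\<close> with \<open>b\<close> and with its image
  under \<open>g\<close> gives a permutation \<open>t\<close> that fixes \<open>p\<close>, and
  \<open>f\<close> commutes with \<open>t\<close>.\<close>

lemma fconj_gact:
  assumes g: "g \<in> sym_fix p" and b: "p \<le> b" and v: "v \<in> U"
  shows "subset_act g (fconj b v) = fconj (Perm.apply g b) (gact g v)"
proof -
  let ?s = "Perm.swap p b" and ?s' = "Perm.swap p (Perm.apply g b)"
  define t where "t = ?s' * g * ?s"
  have "p \<le> Perm.apply g b" using sym_fix_le[OF g b] .
  then have "t \<in> sym_fix (Suc p)"
    using g b by (auto simp: t_def sym_fix_def apply_times apply_swap less_Suc_eq)
  then have "f (gact t (gact ?s v)) = subset_act t (f (gact ?s v))"
    using swap_stable[OF b v] by (rule f_gact)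
  moreover have "gact t (gact ?s v) = gact ?s' (gact g v)"
    by (simp add: t_def mult.assoc flip: gact_times)
  moreover have "?s' * t = g * ?s"
    by (simp add: t_def mult.assoc[symmetric])
  ultimately show ?thesis
    by (simp add: fconj_def flip: subs.gact_times)
qed

lemma fconj_add: "p \<le> b \<Longrightarrow> v \<in> U \<Longrightarrow> w \<in> U \<Longrightarrow> fconj b (v + w) = fconj b v + fconj b w"
  using f swap_stable[of b] by (simp add: fconj_def gact_add equivariant_def subs.gact_add)

lemma fconj_scale: "p \<le> b \<Longrightarrow> v \<in> U \<Longrightarrow> fconj b (a *s v) = Poly_Mapping.map ((*) a) (fconj b v)"
  using f swap_stable[of b v]
  by (simp add: fconj_def gact_scale equivariant_def subs.gact_scale flip: perm_ratfun_times)

lemma fconj_L: "p \<le> b \<Longrightarrow> v \<in> L \<Longrightarrow> fconj b v = 0"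
  using f stable_gact[OF L, of "Perm.swap p b" v] swap_in_sym_fix[of p p b]
  by (simp add: fconj_def equivariant_def)

lemma keys_fconj:
  assumes "p \<le> b" "v \<in> U" "T \<in> Poly_Mapping.keys (fconj b v)"
  shows "T \<in> tail_sets p d" "b \<notin> T"
proof -
  obtain S where S: "S \<in> Poly_Mapping.keys (f (gact (Perm.swap p b) v))" "T = Perm.apply (Perm.swap p b) ` S"
    using assms(3) by (auto simp: fconj_def keys_subset_act)
  have S': "S \<in> tail_sets (Suc p) d"
    using f swap_stable[OF assms(1,2)] S(1) by (auto simp: equivariant_def)
  then have "S \<in> tail_sets p d" using tail_sets_mono[of p "Suc p" d] by auto
  then show "T \<in> tail_sets p d"
    unfolding S(2) using assms(1) by (intro tail_sets_image swap_in_sym_fix) auto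
  have "p \<notin> S" using tail_setsD(4)[OF S', of p] by auto
  then show "b \<notin> T" unfolding S(2) by (auto simp: apply_swap split: if_splits)
qed

text \<open>The value is fixed by every permutation that fixes \<open>B\<close> and \<open>b\<close>
  pointwise, so its support lies in \<open>insert b B\<close>; and \<open>b\<close> itself never
  occurs in the support of a value of the conjugate at \<open>b\<close>.\<close>

lemma keys_fconj_subset:
  assumes "finite B" "{..<p} \<subseteq> B" "\<And>g. \<forall>i\<in>B. Perm.apply g i = i \<Longrightarrow> gact g v = v"
    and "p \<le> b" "v \<in> U" "T \<in> Poly_Mapping.keys (fconj b v)"
  shows "T \<subseteq> B"
proof -
  have "T \<subseteq> insert b B"
  proof (rule keys_fixed_subset[of _ "fconj b v"])
    fix g
    assume g: "\<forall>i\<in>insert b B. Perm.apply g i = i"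
    then have "g \<in> sym_fix p" using assms(2) by (auto simp: sym_fix_def)
    then show "subset_act g (fconj b v) = fconj b v"
      using fconj_gact[of g b v] assms(3)[of g] assms(4,5) g by simp
  qed (use assms(1,6) keys_fconj(1)[OF assms(4,5)] in \<open>auto dest: tail_setsD(1)\<close>)
  then show ?thesis using keys_fconj(2)[OF assms(4-6)] by blast
qed

text \<open>An index beyond all the sets \<open>{m..<m + j}\<close> with \<open>j\<close> at most
  \<open>d\<close> that index the chosen generators. Exchanging it with a larger index therefore
  fixes every generator.\<close>

definition top_ix :: nat where
  "top_ix = m + d"

definition gen :: "nat \<times> (nat set \<Rightarrow> 'w) \<Rightarrow> 'w" where
  "gen = (\<lambda>(j, z). z {m..<m + j})"

lemma gen_in_U: "x \<in> F \<Longrightarrow> gen x \<in> U"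
  using gens_subset by (force simp: gen_def split: prod.splits)

lemma p_le_top [simp]: "p \<le> top_ix"
  using pm by (simp add: top_ix_def)

lemma gen_fixed:
  assumes "x \<in> F" "g \<in> sym_fix top_ix"
  shows "gact g (gen x) = gen x"
proof -
  obtain j z where x: "x = (j, z)" by (cases x)
  then have j: "j \<le> d" "fam m j z" using F assms(1) by auto
  have "Perm.apply g ` {m..<m + j} = {m..<m + j}"
    by (rule sym_fix_image[OF assms(2)]) (use j in \<open>auto simp: top_ix_def\<close>)
  moreover have "g \<in> sym_fix m" using assms(2) sym_fix_mono[of m top_ix] by (auto simp: top_ix_def)
  ultimately show ?thesis using famD[OF j(2), of g "{m..<m + j}"] by (simp add: x gen_def)
qed

lemma keys_gen: "x \<in> F \<Longrightarrow> T \<in> Poly_Mapping.keys (fconj top_ix (gen x)) \<Longrightarrow> T \<subseteq> {..<top_ix}"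
  by (rule keys_fconj_subset[of _ "gen x" top_ix])
    (use pm in \<open>auto simp: top_ix_def sym_fix_def gen_in_U intro!: gen_fixed\<close>)

text \<open>After a translation some value has \<open>{m..<m + d}\<close> in its support, hence so
  does the value of a spanning vector \<open>z R\<close>. By \<open>keys_fconj_subset\<close> that
  support consists of subsets of \<open>{..<m}\<close> and \<open>R\<close> together, so
  \<open>R\<close> contains \<open>{m..<m + d}\<close>. As \<open>R\<close> has at most
  \<open>d\<close> elements the two are equal, and \<open>z R\<close> is the chosen generator of a
  family of degree exactly \<open>d\<close>. This is where the bound on the degrees of the
  generators is needed.\<close>

lemma ex_gen_nonzero: "\<exists>x\<in>F. fconj top_ix (gen x) \<noteq> 0"
proof -
  let ?T = "{m..<m + d}"
  obtain v where v: "v \<in> U" "f v \<noteq> 0" using f_nz by blast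
  define u where "u = gact (Perm.swap p top_ix) v"
  have u: "u \<in> U" unfolding u_def by (rule swap_stable[OF p_le_top v(1)])
  have "fconj top_ix u = subset_act (Perm.swap p top_ix) (f v)"
    by (simp add: fconj_def u_def flip: gact_times)
  then have "Poly_Mapping.keys (fconj top_ix u) \<noteq> {}" using v(2) by (simp add: keys_subset_act)
  then obtain S where S: "S \<in> Poly_Mapping.keys (fconj top_ix u)" by blast
  have S': "S \<in> tail_sets p d" "top_ix \<notin> S" using keys_fconj[OF p_le_top u S] by auto
  have "insert top_ix {..<p} \<inter> S = {}" using S' tail_setsD(4)[OF S'(1)] by fastforce
  moreover have "insert top_ix {..<p} \<inter> ?T = {}" using pm by (auto simp: top_ix_def)
  ultimately obtain g where g: "Perm.apply g ` S = ?T" "\<forall>i\<in>insert top_ix {..<p}. Perm.apply g i = i"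
    using ex_perm_image_fixing[of S ?T "insert top_ix {..<p}"] tail_setsD[OF S'(1)] by auto
  then have gp: "g \<in> sym_fix p" by (auto simp: sym_fix_def)
  define w where "w = gact g u"
  have w: "w \<in> U" unfolding w_def by (rule stable_gact[OF U gp u])
  have "fconj top_ix w = subset_act g (fconj top_ix u)"
    using fconj_gact[OF gp p_le_top u] g(2) by (simp add: w_def)
  then have "?T \<in> Poly_Mapping.keys (fconj top_ix w)"
    using S g(1) by (auto simp: keys_subset_act)
  then have nz: "Poly_Mapping.lookup (fconj top_ix w) ?T \<noteq> 0" by (simp add: in_keys_iff)
  have "\<exists>q\<in>L \<union> (\<Union>(j, z)\<in>F. z ` tail_sets m j). Poly_Mapping.lookup (fconj top_ix q) ?T \<noteq> 0"
  proof (rule ccontr)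
    assume *: "\<not> ?thesis"
    have "Poly_Mapping.lookup (fconj top_ix w) ?T = 0 \<and> w \<in> U"
      using w[unfolded U_eq]
    proof (induction rule: span_induct_alt)
      case base
      show ?case using fconj_L[OF p_le_top, of 0] subspace_0[OF stable_subspace[OF L]] LU by auto
    next
      case (step c x y)
      have "x \<in> U" by (rule subsetD[OF gens_subset step(1)])
      moreover have "Poly_Mapping.lookup (fconj top_ix x) ?T = 0" using step(1) * by blast
      ultimately have x: "x \<in> U" "Poly_Mapping.lookup (fconj top_ix x) ?T = 0" by auto
      then have "c *s x \<in> U" using subspace_scale[OF stable_subspace[OF U]] by blast
      then show ?case using x step subspace_add[OF stable_subspace[OF U]]
        by (simp add: fconj_add fconj_scale lookup_add lookup_smult)
    qed
    then show False using nz by simp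
  qed
  then obtain q where q: "q \<in> L \<union> (\<Union>(j, z)\<in>F. z ` tail_sets m j)" "Poly_Mapping.lookup (fconj top_ix q) ?T \<noteq> 0"
    by blast
  have "q \<notin> L" using q(2) fconj_L[OF p_le_top] by auto
  then obtain j z R where jzR: "(j, z) \<in> F" "R \<in> tail_sets m j" "q = z R" using q(1) by auto
  have j: "j \<le> d" "fam m j z" using F[OF jzR(1)] by auto
  have "?T \<subseteq> {..<m} \<union> R"
  proof (rule keys_fconj_subset[of _ q top_ix])
    fix g
    assume g: "\<forall>i\<in>{..<m} \<union> R. Perm.apply g i = i"
    then have "g \<in> sym_fix m" by (simp add: sym_fix_def)
    moreover have "Perm.apply g ` R = R" using g by (subst image_cong[OF refl, where g = id]) auto
    ultimately show "gact g q = q" using famD[OF j(2) _ jzR(2)] jzR(3) by simp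
  next
    show "q \<in> U" using q(1) gens_subset by blast
  qed (use q(2) pm tail_setsD(1)[OF jzR(2)] in \<open>auto simp: in_keys_iff\<close>)
  then have "?T \<subseteq> R" by auto
  then have "?T = R"
    using tail_setsD(1,2)[OF jzR(2)] j(1) by (intro card_seteq) auto
  then have "card ?T = j" using tail_setsD(2)[OF jzR(2)] by simp
  then have "d = j" by simp
  then have "q = gen (j, z)" using \<open>?T = R\<close> jzR(3) by (simp add: gen_def)
  then show ?thesis using q(2) jzR(1) by (intro bexI[of _ "(j, z)"]) auto
qed

definition gen_values :: "'k ratfun set" where
  "gen_values = (\<Union>x\<in>F. Poly_Mapping.lookup (fconj top_ix (gen x)) ` Poly_Mapping.keys (fconj top_ix (gen x)))"

lemma ex_order:
  "\<exists>e. (\<forall>a\<in>gen_values. \<exists>c. residue_at top_ix (ratvar top_ix powi e * a) c) \<and>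
    (\<exists>a\<in>gen_values. \<exists>c. c \<noteq> 0 \<and> residue_at top_ix (ratvar top_ix powi e * a) c)"
proof (rule ex_common_order)
  show "finite gen_values" using finF by (simp add: gen_values_def)
  obtain x where "x \<in> F" "fconj top_ix (gen x) \<noteq> 0" using ex_gen_nonzero by blast
  moreover from this obtain T where T: "T \<in> Poly_Mapping.keys (fconj top_ix (gen x))" by fastforce
  ultimately have "Poly_Mapping.lookup (fconj top_ix (gen x)) T \<in> gen_values"
    unfolding gen_values_def by blast
  then show "\<exists>a\<in>gen_values. a \<noteq> 0" using T by (auto simp: in_keys_iff)
qed

text \<open>The exponent of the multiplier: positive if some coefficient has a pole at 0, negative
  if all of them vanish there. It is fixed once and for all by the generators; an exponent chosen
  for each vector separately would destroy additivity.\<close>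

definition pole_ord :: int where
  "pole_ord = (SOME e. (\<forall>a\<in>gen_values. \<exists>c. residue_at top_ix (ratvar top_ix powi e * a) c) \<and>
    (\<exists>a\<in>gen_values. \<exists>c. c \<noteq> 0 \<and> residue_at top_ix (ratvar top_ix powi e * a) c))"

lemma pole_ord:
  "a \<in> gen_values \<Longrightarrow> \<exists>c. residue_at top_ix (ratvar top_ix powi pole_ord * a) c"
  "\<exists>a\<in>gen_values. \<exists>c. c \<noteq> 0 \<and> residue_at top_ix (ratvar top_ix powi pole_ord * a) c"
  using someI_ex[OF ex_order] by (simp_all add: pole_ord_def)

text \<open>Requiring the equation for all large \<open>b\<close> makes every finite set of
  variables and every finitary permutation irrelevant in the limit, which yields linearity and full
  equivariance.\<close>

definition leading :: "'w \<Rightarrow> (nat set \<Rightarrow>\<^sub>0 'k ratfun) \<Rightarrow> bool" where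
  "leading v h \<longleftrightarrow> (\<forall>\<^sub>F b in sequentially. \<forall>T.
    residue_at b (ratvar b powi pole_ord * Poly_Mapping.lookup (fconj b v) T) (Poly_Mapping.lookup h T))"

text \<open>The values are computed at \<open>top_ix\<close> and carried to a larger
  \<open>b\<close> by exchanging the two. The exchange fixes the generator and its supporting sets,
  and for large \<open>b\<close> also the values, which do not involve
  \<open>top_ix\<close>.\<close>

lemma leading_gen:
  assumes x: "x \<in> F"
  shows "\<exists>h. leading (gen x) h \<and> (\<forall>T\<in>Poly_Mapping.keys (fconj top_ix (gen x)).
    residue_at top_ix (ratvar top_ix powi pole_ord * Poly_Mapping.lookup (fconj top_ix (gen x)) T) (Poly_Mapping.lookup h T))"
proof -
  let ?k = "fconj top_ix (gen x)"
  have "\<exists>c. residue_at top_ix (ratvar top_ix powi pole_ord * Poly_Mapping.lookup ?k T) c" if "T \<in> Poly_Mapping.keys ?k" for T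
    using that x by (intro pole_ord(1)) (auto simp: gen_values_def)
  then obtain c where c: "\<And>T. T \<in> Poly_Mapping.keys ?k \<Longrightarrow> residue_at top_ix (ratvar top_ix powi pole_ord * Poly_Mapping.lookup ?k T) (c T)"
    by metis
  define h where "h = (\<Sum>T\<in>Poly_Mapping.keys ?k. Poly_Mapping.single T (c T))"
  have h: "Poly_Mapping.lookup h T = (if T \<in> Poly_Mapping.keys ?k then c T else 0)" for T
    by (simp add: h_def lookup_sum lookup_single when_def)
  have "\<forall>\<^sub>F b in sequentially. \<forall>T\<in>Poly_Mapping.keys ?k. perm_ratfun (Perm.swap top_ix b) (c T) = c T"
    using eventually_residue_swap[OF c] by (intro eventually_ball_finite) auto
  then have "leading (gen x) h"
    unfolding leading_def using eventually_ge_at_top[of top_ix]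
  proof eventually_elim
    case (elim b)
    let ?g = "Perm.swap top_ix b"
    have "?g \<in> sym_fix top_ix" using elim(2) by (intro swap_in_sym_fix) auto
    moreover have "?g \<in> sym_fix p" using elim(2) order_trans[OF p_le_top] by (intro swap_in_sym_fix) auto
    ultimately have eq: "fconj b (gen x) = subset_act ?g ?k"
      using fconj_gact[of ?g top_ix "gen x"] gen_in_U[OF x] gen_fixed[OF x] by (simp add: apply_swap)
    have fixT: "Perm.apply ?g ` T = T" if "T \<in> Poly_Mapping.keys ?k" for T
      using keys_gen[OF x that] elim(2) by (intro image_swap_fixed) auto
    have in_iff: "Perm.apply ?g ` T \<in> Poly_Mapping.keys ?k \<longleftrightarrow> T \<in> Poly_Mapping.keys ?k" for T
    proof
      assume *: "Perm.apply ?g ` T \<in> Poly_Mapping.keys ?k"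
      have "T = Perm.apply ?g ` Perm.apply ?g ` T" by (simp add: image_image apply_sequence)
      then show "T \<in> Poly_Mapping.keys ?k" using fixT[OF *] * by simp
    qed (use fixT in simp)
    show ?case
    proof
      fix T
      show "residue_at b (ratvar b powi pole_ord * Poly_Mapping.lookup (fconj b (gen x)) T) (Poly_Mapping.lookup h T)"
      proof (cases "T \<in> Poly_Mapping.keys ?k")
        case True
        have "residue_at (Perm.apply ?g top_ix) (perm_ratfun ?g (ratvar top_ix powi pole_ord * Poly_Mapping.lookup ?k T))
            (perm_ratfun ?g (c T))"
          by (rule residue_at_perm[OF c[OF True]])
        then show ?thesis
          using elim(1) True fixT[OF True]
          by (simp add: eq h lookup_act_I_rep perm_ratfun_mult perm_ratfun_powi perm_ratfun_ratvar apply_swap)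
      next
        case False
        then have "Poly_Mapping.lookup (fconj b (gen x)) T = 0"
          using in_iff[of T] by (simp add: eq lookup_act_I_rep in_keys_iff)
        then show ?thesis using False by (simp add: h)
      qed
    qed
  qed
  then show ?thesis using h c by (intro exI[of _ h]) auto
qed

lemma eventually_ge_p: "\<forall>\<^sub>F b in sequentially. p \<le> b"
  by (rule eventually_ge_at_top)

lemma leading_add:
  assumes "leading v h" "leading w k" "v \<in> U" "w \<in> U"
  shows "leading (v + w) (h + k)"
  using assms(1,2) eventually_ge_p unfolding leading_def
  by eventually_elim
    (use assms(3,4) in \<open>simp add: fconj_add lookup_add distrib_left residue_at_add\<close>)

text \<open>A scalar involves finitely many variables, so for large \<open>b\<close> its value at 0
  in the variable \<open>b\<close> is the scalar itself.\<close>

lemma leading_scale: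
  assumes "leading v h" "v \<in> U"
  shows "leading (a *s v) (Poly_Mapping.map ((*) a) h)"
  using assms(1) eventually_ge_p eventually_residue_at[of a] unfolding leading_def
proof eventually_elim
  case (elim b)
  then show ?case
    using assms(2) residue_at_mult[of b a a] by (simp add: fconj_scale lookup_smult mult.left_commute)
qed

text \<open>For large \<open>b\<close> the permutation \<open>g\<close> fixes \<open>b\<close>, so
  it commutes with the conjugate at \<open>b\<close>. This holds also for \<open>g\<close> that move
  \<open>p\<close>, which is the gain over \<open>f\<close>.\<close>

lemma leading_gact:
  assumes "leading v h" "v \<in> U" "g \<in> sym_fix p"
  shows "leading (gact g v) (subset_act g h)"
  using assms(1) eventually_ge_p eventually_apply_fixed[of g] unfolding leading_def
proof eventually_elim
  case (elim b)
  then have eq: "fconj b (gact g v) = subset_act g (fconj b v)"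
    using fconj_gact[OF assms(3) _ assms(2), of b] by simp
  show ?case
  proof
    fix T
    let ?T = "Perm.apply (inverse g) ` T"
    have "residue_at (Perm.apply g b) (perm_ratfun g (ratvar b powi pole_ord * Poly_Mapping.lookup (fconj b v) ?T))
        (perm_ratfun g (Poly_Mapping.lookup h ?T))"
      using elim(1) by (intro residue_at_perm) auto
    then show "residue_at b (ratvar b powi pole_ord * Poly_Mapping.lookup (fconj b (gact g v)) T)
        (Poly_Mapping.lookup (subset_act g h) T)"
      using elim(3) by (simp add: eq lookup_act_I_rep perm_ratfun_mult perm_ratfun_powi perm_ratfun_ratvar)
  qed
qed

lemma leading_L: "v \<in> L \<Longrightarrow> leading v 0"
  unfolding leading_def using eventually_ge_p by eventually_elim (simp add: fconj_L)

lemma leading_unique: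
  assumes "leading v h" "leading v k"
  shows "h = k"
proof -
  have "\<forall>\<^sub>F b :: nat in sequentially. h = k"
    using assms unfolding leading_def
    by eventually_elim (auto intro!: poly_mapping_eqI dest: residue_at_unique)
  then show ?thesis by simp
qed

lemma ex_leading: "v \<in> U \<Longrightarrow> \<exists>h. leading v h"
proof -
  assume v: "v \<in> U"
  have "(\<exists>h. leading v h) \<and> v \<in> U"
    using v[unfolded U_eq]
  proof (induction rule: span_induct_alt)
    case base
    show ?case using leading_L[of 0] subspace_0[OF stable_subspace[OF L]] LU by auto
  next
    case (step c x y)
    have x: "x \<in> U" using step gens_subset by blast
    have "\<exists>h. leading x h"
    proof (cases "x \<in> L")
      case False
      then obtain j z R where jzR: "(j, z) \<in> F" "R \<in> tail_sets m j" "x = z R" using step(1) by auto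
      obtain g where g: "g \<in> sym_fix m" "Perm.apply g ` {m..<m + j} = R"
        using ex_sym_fix_image[OF interval_in_tail_sets jzR(2)] by blast
      have "x = gact g (gen (j, z))"
        using famD[OF _ g(1) interval_in_tail_sets, of j z] F[OF jzR(1)] jzR(3) g(2) by (simp add: gen_def)
      moreover have "g \<in> sym_fix p" using g(1) sym_fix_mono[of p m] pm by auto
      ultimately show ?thesis
        using leading_gen[OF jzR(1)] leading_gact gen_in_U[OF jzR(1)] by blast
    qed (use leading_L in blast)
    then obtain h k where "leading x h" "leading y k" using step by blast
    moreover have "c *s x \<in> U" using subspace_scale[OF stable_subspace[OF U] x] .
    ultimately show ?case
      using leading_add[OF leading_scale, of x h y k c] x step subspace_add[OF stable_subspace[OF U]] by blast
  qed
  then show ?thesis by simp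
qed

definition descended :: "'w \<Rightarrow> (nat set \<Rightarrow>\<^sub>0 'k ratfun)" where
  "descended v = (THE h. leading v h)"

lemma descended_eq: "leading v h \<Longrightarrow> descended v = h"
  unfolding descended_def using leading_unique by blast

lemma leading_descended: "v \<in> U \<Longrightarrow> leading v (descended v)"
  using ex_leading descended_eq by blast

lemma keys_leading:
  assumes "leading v h" "v \<in> U"
  shows "Poly_Mapping.keys h \<subseteq> tail_sets p d"
proof -
  have "\<forall>\<^sub>F b in sequentially. Poly_Mapping.keys h \<subseteq> tail_sets p d"
    using assms(1) eventually_ge_p unfolding leading_def
  proof eventually_elim
    case (elim b)
    show ?case
    proof
      fix T
      assume T: "T \<in> Poly_Mapping.keys h"
      have "T \<in> Poly_Mapping.keys (fconj b v)"
      proof (rule ccontr)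
        assume "T \<notin> Poly_Mapping.keys (fconj b v)"
        then have "residue_at b 0 (Poly_Mapping.lookup h T)"
          using elim(1)[rule_format, of T] by (simp add: in_keys_iff)
        then show False using residue_at_unique[OF residue_at_0] T by (auto simp: in_keys_iff)
      qed
      then show "T \<in> tail_sets p d" using keys_fconj(1)[OF elim(2) assms(2)] by blast
    qed
  qed
  then show ?thesis by simp
qed

lemma descended: "equivariant p d L U descended"
  unfolding equivariant_def
proof (intro conjI ballI allI)
  fix v
  assume "v \<in> U"
  then show "Poly_Mapping.keys (descended v) \<subseteq> tail_sets p d"
    using keys_leading leading_descended by blast
qed (simp_all add: descended_eq leading_descended leading_add leading_scale leading_L leading_gact)

lemma descended_nonzero: "\<exists>v\<in>U. descended v \<noteq> 0"
proof -
  obtain a c where a: "a \<in> gen_values" "c \<noteq> 0" "residue_at top_ix (ratvar top_ix powi pole_ord * a) c"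
    using pole_ord(2) by blast
  then obtain x T where x: "x \<in> F" "T \<in> Poly_Mapping.keys (fconj top_ix (gen x))"
    "a = Poly_Mapping.lookup (fconj top_ix (gen x)) T"
    by (auto simp: gen_values_def)
  obtain h where h: "leading (gen x) h" "residue_at top_ix (ratvar top_ix powi pole_ord * a) (Poly_Mapping.lookup h T)"
    using leading_gen[OF x(1)] x(2,3) by blast
  then have "Poly_Mapping.lookup h T = c" using a(3) residue_at_unique by blast
  then have "descended (gen x) \<noteq> 0" using descended_eq[OF h(1)] a(2) by auto
  then show ?thesis using gen_in_U[OF x(1)] by blast
qed

end

section \<open>Maps that are equivariant under the whole group\<close>

context semilinear
begin

text \<open>Each use of \<open>descent\<close> gives back one fixed index. The generating families
  stay those of the group for \<open>m\<close>, which is why \<open>m\<close> has to be at least the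
  starting \<open>n\<close>.\<close>

lemma equivariant_descend:
  assumes "stable 0 U" "stable 0 L" "lower m (Suc d) Q" "U = span (L \<union> Q)"
    and "equivariant n d L U f" "n \<le> m" "\<exists>v\<in>U. f v \<noteq> 0"
  shows "\<exists>h. equivariant 0 d L U h \<and> (\<exists>v\<in>U. h v \<noteq> 0)"
  using assms(5-7)
proof (induction n arbitrary: f)
  case (Suc p)
  obtain F where F: "finite F" "\<forall>(j, z)\<in>F. j < Suc d \<and> fam m j z" "Q = (\<Union>(j, z)\<in>F. z ` tail_sets m j)"
    using lower_families[OF assms(3)] by blast
  interpret descent scale gact p d m L U F f
    by unfold_locales
      (use Suc.prems F assms(4) stable_mono[OF assms(1)] stable_mono[OF assms(2)] in auto)
  show ?case using Suc.IH[OF descended _ descended_nonzero] Suc.prems by simp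
qed auto

text \<open>The starting map takes the coordinates with respect to the topmost family modulo the
  rest \<open>Z\<close> of the filtration. That the head is maximal ensures that all generators have
  degree at most \<open>d\<close>, as the descent requires.\<close>

lemma chain_ex_equivariant:
  assumes st: "stable 0 U" "stable 0 L" and l: "chain n L U (d # l)" "head_max (d # l)"
  shows "\<exists>h. equivariant 0 d L U h \<and> (\<exists>v\<in>U. h v \<noteq> 0)"
proof -
  from l(1) obtain Z y where Zy: "chain n L Z l" "fam n d y" "indep_over Z (tail_sets n d) y"
    "U = span (Z \<union> y ` tail_sets n d)"
    by cases auto
  have Z: "stable n Z" "L \<subseteq> Z" using chain_stable[OF Zy(1)] by auto
  note Zs = stable_subspace[OF Z(1)]
  define coord where "coord v h \<longleftrightarrow> Poly_Mapping.keys h \<subseteq> tail_sets n d \<and> v - comb y h \<in> Z" for v h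
  have unique: "h = k" if "coord v h" "coord v k" for v h k
  proof -
    have "comb y (h - k) = (v - comb y k) - (v - comb y h)" by (simp add: comb_diff)
    then have "comb y (h - k) \<in> Z"
      using that subspace_diff[OF Zs, of "v - comb y k" "v - comb y h"] unfolding coord_def by simp
    moreover have "Poly_Mapping.keys (h - k) \<subseteq> tail_sets n d"
      using that keys_diff[of h k] by (auto simp: coord_def)
    ultimately have "h - k = 0" using Zy(3) unfolding indep_over_def by blast
    then show ?thesis by simp
  qed
  define f where "f v = (THE h. coord v h)" for v
  have f_eq: "f v = h" if "coord v h" for v h
    unfolding f_def using that unique by blast
  have coord: "coord v (f v)" if "v \<in> U" for v
  proof -
    obtain z h where "z \<in> Z" "Poly_Mapping.keys h \<subseteq> tail_sets n d" "v = z + comb y h"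
      using span_Un_image_comb[OF Zs] \<open>v \<in> U\<close> Zy(4) by blast
    then have "coord v h" by (simp add: coord_def)
    then show ?thesis using f_eq by simp
  qed
  have "equivariant n d L U f"
    unfolding equivariant_def
  proof (intro conjI ballI allI)
    fix v w
    assume "v \<in> U" "w \<in> U"
    then have "coord v (f v)" "coord w (f w)" using coord by auto
    then have "coord (v + w) (f v + f w)"
      using keys_add[of "f v" "f w"] subspace_add[OF Zs, of "v - comb y (f v)" "w - comb y (f w)"]
      by (auto simp: coord_def comb_add algebra_simps)
    then show "f (v + w) = f v + f w" by (rule f_eq)
  next
    fix a v
    assume "v \<in> U"
    then have "coord v (f v)" using coord by auto
    then have "coord (a *s v) (Poly_Mapping.map ((*) a) (f v))"
      using subspace_scale[OF Zs, of "v - comb y (f v)" a]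
      by (auto simp: coord_def comb_smult scale_right_diff_distrib in_keys_iff lookup_smult subset_iff)
    then show "f (a *s v) = Poly_Mapping.map ((*) a) (f v)" by (rule f_eq)
  next
    fix v
    assume "v \<in> L"
    then show "f v = 0" using Z(2) by (intro f_eq) (auto simp: coord_def)
  next
    fix v
    assume "v \<in> U"
    then show "Poly_Mapping.keys (f v) \<subseteq> tail_sets n d" using coord by (auto simp: coord_def)
  next
    fix g v
    assume g: "g \<in> sym_fix n" and "v \<in> U"
    then have *: "Poly_Mapping.keys (f v) \<subseteq> tail_sets n d" "v - comb y (f v) \<in> Z"
      using coord by (auto simp: coord_def)
    have "gact g (v - comb y (f v)) \<in> Z" by (rule stable_gact[OF Z(1) g *(2)])
    then have "coord (gact g v) (subset_act g (f v))"
      using * tail_sets_image[OF g] by (auto simp: coord_def gact_diff gact_comb[OF Zy(2) g] keys_subset_act)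
    then show "f (gact g v) = subset_act g (f v)" by (rule f_eq)
  qed
  moreover have "\<exists>v\<in>U. f v \<noteq> 0"
  proof -
    let ?T = "{n..<n + d}"
    have "y ?T \<in> U" unfolding Zy(4) by (intro span_base) auto
    moreover have "f (y ?T) = Poly_Mapping.single ?T 1"
      using subspace_0[OF Zs] by (intro f_eq) (auto simp: coord_def)
    moreover have "Poly_Mapping.single ?T (1 :: 'k ratfun) \<noteq> 0"
      by (metis keys_single keys_zero insert_not_empty zero_neq_one)
    ultimately show ?thesis by metis
  qed
  moreover have "\<And>j. j \<in> set (d # l) \<Longrightarrow> j < Suc d" using l(2) by (auto simp: head_max_def)
  then obtain Q where "lower n (Suc d) Q" "U = span (L \<union> Q)"
    using chain_lower[OF l(1)] by blast
  ultimately show ?thesis using equivariant_descend[OF st] by blast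
qed

end

section \<open>Presentations\<close>

lemma sym_fix_0 [simp]: "sym_fix 0 = UNIV"
  by (simp add: sym_fix_def)

context smooth_rep
begin

lemma scalar_closed [simp]: "v \<in> carrier M \<Longrightarrow> a \<odot> v \<in> carrier M"
  using smult_closed[of a v] by (simp add: ring_of_type_algebra_def)

lemma scalar_0 [simp]: "v \<in> carrier M \<Longrightarrow> 0 \<odot> v = \<zero>"
  using smult_l_null[of v] by (simp add: ring_of_type_algebra_def)

lemma scalar_zero [simp]: "a \<odot> \<zero> = \<zero>"
  using smult_r_null[of a] by (simp add: ring_of_type_algebra_def)

lemma scalar_1 [simp]: "v \<in> carrier M \<Longrightarrow> 1 \<odot> v = v"
  using smult_one[of v] by (simp add: ring_of_type_algebra_def)

lemma scalar_add: "v \<in> carrier M \<Longrightarrow> (a + b) \<odot> v = a \<odot> v \<oplus> b \<odot> v"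
  using smult_l_distr[of a b v] by (simp add: ring_of_type_algebra_def)

lemma scalar_mult: "v \<in> carrier M \<Longrightarrow> (a * b) \<odot> v = a \<odot> (b \<odot> v)"
  using smult_assoc1[of a b v] by (simp add: ring_of_type_algebra_def)

lemma act_zero [simp]: "act M g \<zero> = \<zero>"
  using act_smult[of \<zero> g 0] act_closed[of \<zero> g] by simp

end

section \<open>Dimension of the invariants, and objects presented as quotients\<close>

abbreviation gen_submodule :: "('k::field ratfun, 'v) sym_module \<Rightarrow> 'v set \<Rightarrow> 'v set" where
  "gen_submodule M B \<equiv> (\<lambda>H. submodule H ring_of_type_algebra M) hull B"

definition inv_space :: "nat \<Rightarrow> ('k::field ratfun, 'v) sym_module \<Rightarrow> 'v set" where
  "inv_space N M = {v \<in> carrier M. \<forall>g\<in>sym_fix N. act M g v = v}"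

text \<open>The dimension of the span of the invariants of \<open>sym_fix N\<close>.\<close>

definition inv_dim :: "nat \<Rightarrow> ('k::field ratfun, 'v) sym_module \<Rightarrow> nat" where
  "inv_dim N M = (LEAST k. \<exists>B. finite B \<and> card B \<le> k \<and> B \<subseteq> carrier M \<and> inv_space N M \<subseteq> gen_submodule M B)"

context semilinear
begin

definition rep_map :: "'w set \<Rightarrow> ('k ratfun, 'v) sym_module \<Rightarrow> ('w \<Rightarrow> 'v) \<Rightarrow> bool" where
  "rep_map U M f \<longleftrightarrow> f ` U \<subseteq> carrier M \<and>
    (\<forall>u\<in>U. \<forall>w\<in>U. f (u + w) = f u \<oplus>\<^bsub>M\<^esub> f w) \<and>
    (\<forall>a. \<forall>u\<in>U. f (a *s u) = a \<odot>\<^bsub>M\<^esub> f u) \<and>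
    (\<forall>g. \<forall>u\<in>U. f (gact g u) = act M g (f u))"

text \<open>An identification of \<open>M\<close> with \<open>U / L\<close>. The carrier of
  \<open>M\<close> may lie in another type, so several objects can be compared inside one ambient
  space.\<close>

definition presents :: "'w set \<Rightarrow> 'w set \<Rightarrow> ('k ratfun, 'v) sym_module \<Rightarrow> ('w \<Rightarrow> 'v) \<Rightarrow> bool" where
  "presents L U M f \<longleftrightarrow> stable 0 L \<and> stable 0 U \<and> L \<subseteq> U \<and> rep_map U M f \<and> f ` U = carrier M \<and>
    (\<forall>u\<in>U. f u = \<zero>\<^bsub>M\<^esub> \<longleftrightarrow> u \<in> L)"

end

locale presentation = semilinear scale gact + M: smooth_rep M
  for scale :: "'k::field ratfun \<Rightarrow> 'w::ab_group_add \<Rightarrow> 'w" (infixr \<open>*s\<close> 75) and gact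
    and M :: "('k ratfun, 'v) sym_module" +
  fixes L U :: "'w set" and f :: "'w \<Rightarrow> 'v"
  assumes presents: "presents L U M f"
begin

lemma stL: "stable 0 L" and stU: "stable 0 U" and LU: "L \<subseteq> U" and f_onto: "f ` U = carrier M"
  using presents by (auto simp: presents_def)

lemma subU: "subspace U" and subL: "subspace L"
  using stL stU by (auto simp: stable_subspace)

lemma f_closed [simp]: "u \<in> U \<Longrightarrow> f u \<in> carrier M"
  using f_onto by blast

lemma f_add: "u \<in> U \<Longrightarrow> w \<in> U \<Longrightarrow> f (u + w) = f u \<oplus>\<^bsub>M\<^esub> f w"
  and f_scale: "u \<in> U \<Longrightarrow> f (a *s u) = a \<odot>\<^bsub>M\<^esub> f u"
  and f_gact: "u \<in> U \<Longrightarrow> f (gact g u) = act M g (f u)"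
  and f_zero_iff: "u \<in> U \<Longrightarrow> f u = \<zero>\<^bsub>M\<^esub> \<longleftrightarrow> u \<in> L"
  using presents by (auto simp: presents_def rep_map_def)

lemma f_uminus: "u \<in> U \<Longrightarrow> f (- u) = \<ominus>\<^bsub>M\<^esub> f u"
  using f_add[of "- u" u] f_zero_iff[of 0] subspace_0[OF subL] subspace_0[OF subU] subspace_neg[OF subU, of u]
  by (intro M.minus_equality[symmetric]) auto

lemma f_eq_iff:
  assumes "u \<in> U" "w \<in> U"
  shows "f u = f w \<longleftrightarrow> u - w \<in> L"
proof -
  have "f (u - w) = f u \<oplus>\<^bsub>M\<^esub> \<ominus>\<^bsub>M\<^esub> f w"
    using f_add[of u "- w"] assms subspace_neg[OF subU, of w] by (simp add: f_uminus)
  then have "f (u - w) = \<zero>\<^bsub>M\<^esub> \<longleftrightarrow> f u = f w"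
    using assms by (metis M.minus_equality M.minus_minus M.r_neg f_closed M.a_inv_closed)
  then show ?thesis using f_zero_iff[of "u - w"] assms subspace_diff[OF subU] by simp
qed

lemma submodule_image:
  assumes "subspace V" "V \<subseteq> U"
  shows "submodule (f ` V) ring_of_type_algebra M"
proof (rule M.submoduleI)
  show "f ` V \<subseteq> carrier M" using assms f_onto by blast
  have "f 0 = \<zero>\<^bsub>M\<^esub>" using f_zero_iff[of 0] subspace_0[OF subL] subspace_0[OF subU] by simp
  then show "\<zero>\<^bsub>M\<^esub> \<in> f ` V" using subspace_0[OF assms(1)] by (metis imageI)
  show "\<ominus>\<^bsub>M\<^esub> a \<in> f ` V" if "a \<in> f ` V" for a
    using that assms subspace_neg[OF assms(1)] by (auto simp flip: f_uminus)
  show "a \<oplus>\<^bsub>M\<^esub> b \<in> f ` V" if "a \<in> f ` V" "b \<in> f ` V" for a b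
    using that assms(2) subspace_add[OF assms(1)] by (auto simp: subset_iff simp flip: f_add)
  show "a \<odot>\<^bsub>M\<^esub> x \<in> f ` V" if "x \<in> f ` V" for a x
    using that assms(2) subspace_scale[OF assms(1)] by (auto simp: subset_iff simp flip: f_scale)
qed

lemma gen_submodule_image:
  assumes "B \<subseteq> U"
  shows "gen_submodule M (f ` B) = f ` span B"
proof (rule hull_unique)
  have "span B \<subseteq> U" using assms subU by (rule span_minimal)
  then show "submodule (f ` span B) ring_of_type_algebra M"
    by (intro submodule_image subspace_span)
  show "f ` B \<subseteq> f ` span B" by (intro image_mono span_superset)
  fix H
  assume H: "f ` B \<subseteq> H" "submodule H ring_of_type_algebra M"
  have "subspace {u \<in> U. f u \<in> H}"
  proof (rule subspaceI)
    show "0 \<in> {u \<in> U. f u \<in> H}"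
      using f_zero_iff[of 0] subspace_0[OF subL] subspace_0[OF subU]
        subgroup.one_closed[OF submodule.axioms(1)[OF H(2)]] by simp
    show "u + w \<in> {u \<in> U. f u \<in> H}" if "u \<in> {u \<in> U. f u \<in> H}" "w \<in> {u \<in> U. f u \<in> H}" for u w
      using that M.submoduleE(5)[OF H(2)] subspace_add[OF subU] by (simp add: f_add)
    show "a *s u \<in> {u \<in> U. f u \<in> H}" if "u \<in> {u \<in> U. f u \<in> H}" for a u
      using that submodule.smult_closed[OF H(2), of a "f u"] subspace_scale[OF subU]
      by (simp add: f_scale ring_of_type_algebra_def)
  qed
  then have "span B \<subseteq> {u \<in> U. f u \<in> H}" using H(1) assms by (intro span_minimal) auto
  then show "f ` span B \<subseteq> H" by blast
qed

lemma fin_gen_over: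
  assumes "fin_gen M"
  shows "fin_gen_over 0 L U"
proof -
  obtain F where F: "finite F" "F \<subseteq> carrier M" "gen_submodule M {act M g v |g v. v \<in> F} = carrier M"
    using assms by (auto simp: fin_gen_def)
  obtain G where G: "G \<subseteq> U" "finite G" "F = f ` G"
    using finite_subset_image[OF F(1), of f U] F(2) f_onto by blast
  have orb: "{act M g v |g v. v \<in> F} = f ` orbits 0 G"
  proof (intro equalityI subsetI)
    fix x
    assume "x \<in> {act M g v |g v. v \<in> F}"
    then obtain g u where gu: "x = act M g (f u)" "u \<in> G" using G(3) by blast
    then have "x = f (gact g u)" using G(1) by (simp add: f_gact subset_iff)
    then show "x \<in> f ` orbits 0 G" using gu(2) by auto
  next
    fix x
    assume "x \<in> f ` orbits 0 G"
    then obtain g u where gu: "x = f (gact g u)" "u \<in> G" by blast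
    then have "x = act M g (f u)" using G(1) by (simp add: f_gact subset_iff)
    then show "x \<in> {act M g v |g v. v \<in> F}" using gu(2) G(3) by auto
  qed
  have "orbits 0 G \<subseteq> U" by (rule orbits_subset[OF stU G(1)])
  then have onto: "carrier M = f ` span (orbits 0 G)"
    unfolding F(3)[symmetric] orb by (rule gen_submodule_image)
  have "U \<subseteq> span (L \<union> orbits 0 G)"
  proof
    fix u
    assume u: "u \<in> U"
    then obtain w where w: "w \<in> span (orbits 0 G)" "f u = f w" using onto f_closed by blast
    then have "w \<in> U" using span_minimal[OF \<open>orbits 0 G \<subseteq> U\<close> subU] by blast
    then have "u - w \<in> L" using f_eq_iff[OF u \<open>w \<in> U\<close>] w(2) by blast
    then have "(u - w) + w \<in> span (L \<union> orbits 0 G)"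
      using w(1) span_mono[of "orbits 0 G" "L \<union> orbits 0 G"] by (intro span_add) (auto intro: span_base)
    then show "u \<in> span (L \<union> orbits 0 G)" by simp
  qed
  then show ?thesis using G by (intro fin_gen_overI[OF stU LU, of G]) auto
qed

text \<open>The images of the vectors from \<open>chain_basis\<close> generate a submodule that
  contains all invariants and are themselves invariant. Conversely, lifts of any other such set
  \<open>C\<close> span these vectors modulo \<open>L\<close>, so there are at least as many of
  them.\<close>

lemma inv_dim_eq:
  assumes "chain n L U l" "n \<le> N"
  shows "inv_dim N M = (\<Sum>d\<leftarrow>l. (N - n) choose d)"
proof -
  obtain B where B: "finite B" "card B = (\<Sum>d\<leftarrow>l. (N - n) choose d)" "B \<subseteq> U"
    "\<forall>b\<in>B. \<forall>g\<in>sym_fix N. gact g b = b" "lin_indep_mod L B" "invariants_mod N L U \<subseteq> span (L \<union> B)"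
    using chain_basis[OF assms] by blast
  show ?thesis unfolding inv_dim_def
  proof (rule Least_equality)
    have "inv_space N M \<subseteq> f ` span B"
    proof
      fix v
      assume "v \<in> inv_space N M"
      then have v: "v \<in> carrier M" "\<And>g. g \<in> sym_fix N \<Longrightarrow> act M g v = v"
        by (auto simp: inv_space_def)
      then obtain u where u: "u \<in> U" "v = f u" using f_onto by blast
      have "gact g u - u \<in> L" if "g \<in> sym_fix N" for g
        using f_eq_iff[of "gact g u" u] u v(2)[OF that] stable_gact[OF stU, of g u] by (simp add: f_gact)
      then have "u \<in> span (L \<union> B)" using B(6) u(1) by (auto simp: invariants_mod_def)
      then obtain z w where zw: "z \<in> span L" "w \<in> span B" "u = z + w" unfolding span_Un by blast
      moreover have "span L = L" using subL by simp
      moreover have "w \<in> U" using zw(2) span_minimal[OF B(3) subU] by blast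
      ultimately have "f u = f w" using u(1) by (subst f_eq_iff) auto
      then show "v \<in> f ` span B" using u(2) zw(2) by blast
    qed
    then show "\<exists>C. finite C \<and> card C \<le> (\<Sum>d\<leftarrow>l. (N - n) choose d) \<and> C \<subseteq> carrier M \<and> inv_space N M \<subseteq> gen_submodule M C"
      using B(1-3) f_onto card_image_le[OF B(1), of f]
      by (intro exI[of _ "f ` B"]) (auto simp: gen_submodule_image)
  next
    fix k
    assume "\<exists>C. finite C \<and> card C \<le> k \<and> C \<subseteq> carrier M \<and> inv_space N M \<subseteq> gen_submodule M C"
    then obtain C where C: "finite C" "card C \<le> k" "C \<subseteq> carrier M" "inv_space N M \<subseteq> gen_submodule M C"
      by blast
    obtain s where s: "\<And>v. v \<in> C \<Longrightarrow> s v \<in> U \<and> f (s v) = v"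
      using C(3) f_onto by (metis image_iff subsetD)
    then have sC: "s ` C \<subseteq> U" "f ` s ` C = C" by (auto simp: image_image)
    have "B \<subseteq> span (L \<union> s ` C)"
    proof
      fix b
      assume b: "b \<in> B"
      then have bU: "b \<in> U" using B(3) by blast
      have "f b \<in> inv_space N M"
        using b bU B(4) by (auto simp: inv_space_def simp flip: f_gact)
      then have "f b \<in> f ` span (s ` C)" using C(4) gen_submodule_image[OF sC(1)] sC(2) by auto
      then obtain w where w: "w \<in> span (s ` C)" "f b = f w" by blast
      then have "w \<in> U" using span_minimal[OF sC(1) subU] by blast
      then have "b - w \<in> L" using f_eq_iff[OF bU \<open>w \<in> U\<close>] w(2) by blast
      then have "(b - w) + w \<in> span (L \<union> s ` C)"
        using w(1) span_mono[of "s ` C" "L \<union> s ` C"] by (intro span_add) (auto intro: span_base)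
      then show "b \<in> span (L \<union> s ` C)" by simp
    qed
    then have "card B \<le> card (s ` C)"
      using lin_indep_mod_card_le[OF subL B(1) B(5)] C(1) by blast
    also have "\<dots> \<le> card C" by (rule card_image_le[OF C(1)])
    finally show "(\<Sum>d\<leftarrow>l. (N - n) choose d) \<le> k" using B(2) C(2) by simp
  qed
qed

lemma induced_hom:
  assumes h: "rep_map U N h" "\<And>u w. u \<in> U \<Longrightarrow> w \<in> U \<Longrightarrow> u - w \<in> L \<Longrightarrow> h u = h w"
  shows "\<exists>k\<in>rep_hom M N. \<forall>u\<in>U. k (f u) = h u"
proof -
  define k where "k v = h (SOME u. u \<in> U \<and> f u = v)" for v
  have k: "k (f u) = h u" if "u \<in> U" for u
  proof -
    let ?w = "SOME w. w \<in> U \<and> f w = f u"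
    have "?w \<in> U \<and> f ?w = f u" by (rule someI[of _ u]) (use that in simp)
    then show ?thesis unfolding k_def using that f_eq_iff[of ?w u] by (intro h(2)) auto
  qed
  have lift: "\<exists>u\<in>U. v = f u" if "v \<in> carrier M" for v using that f_onto by blast
  have "k \<in> rep_hom M N"
    unfolding rep_hom_def
  proof (intro CollectI conjI homI allI ballI)
    fix v
    assume "v \<in> carrier (add_monoid M)"
    then show "k v \<in> carrier (add_monoid N)"
      using lift[of v] k h(1) by (auto simp: rep_map_def)
  next
    fix v w
    assume "v \<in> carrier (add_monoid M)" "w \<in> carrier (add_monoid M)"
    then have "v \<in> carrier M" "w \<in> carrier M" by simp_all
    then obtain u u' where u: "u \<in> U" "v = f u" "u' \<in> U" "w = f u'" using lift by metis
    then have "f u \<oplus>\<^bsub>M\<^esub> f u' = f (u + u')" by (simp add: f_add)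
    then show "k (v \<otimes>\<^bsub>add_monoid M\<^esub> w) = k v \<otimes>\<^bsub>add_monoid N\<^esub> k w"
      using u h(1) k subspace_add[OF subU] by (simp add: rep_map_def)
  next
    fix a v
    assume "v \<in> carrier M"
    then obtain u where u: "u \<in> U" "v = f u" using lift by auto
    then have "a \<odot>\<^bsub>M\<^esub> v = f (a *s u)" by (simp add: f_scale)
    then show "k (a \<odot>\<^bsub>M\<^esub> v) = a \<odot>\<^bsub>N\<^esub> k v"
      using u h(1) k subspace_scale[OF subU] by (simp add: rep_map_def)
  next
    fix g v
    assume "v \<in> carrier M"
    then obtain u where u: "u \<in> U" "v = f u" using lift by auto
    then have "act M g v = f (gact g u)" by (simp add: f_gact)
    then show "k (act M g v) = act N g (k v)"
      using u h(1) k stable_gact[OF stU] by (simp add: rep_map_def)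
  qed
  then show ?thesis using k by blast
qed

end

context semilinear
begin

lemma presentationI: "smooth_rep M \<Longrightarrow> presents L U M f \<Longrightarrow> presentation scale gact M L U f"
  by (intro presentation.intro semilinear_axioms presentation_axioms.intro)

text \<open>The three objects are the quotients \<open>V / L\<close>, \<open>U / L\<close> and
  \<open>U / V\<close>; both maps are induced by the identity of \<open>U\<close>.\<close>

lemma presents_short_exact:
  assumes "smooth_rep M1" "smooth_rep M2" "smooth_rep M3"
    and "presents L V M1 f1" "presents L U M2 f2" "presents V U M3 f3"
  shows "short_exact M1 M2 M3"
proof -
  interpret A: presentation scale gact M1 L V f1 by (rule presentationI[OF assms(1,4)])
  interpret B: presentation scale gact M2 L U f2 by (rule presentationI[OF assms(2,5)])
  interpret C: presentation scale gact M3 V U f3 by (rule presentationI[OF assms(3,6)])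
  note VU = C.LU
  have "rep_map V M2 f2"
    using assms(5) VU by (auto simp: presents_def rep_map_def subset_iff image_subset_iff)
  moreover have "f2 u = f2 w" if "u \<in> V" "w \<in> V" "u - w \<in> L" for u w
    using B.f_eq_iff[of u w] that VU by auto
  ultimately obtain i where i: "i \<in> rep_hom M1 M2" "\<And>u. u \<in> V \<Longrightarrow> i (f1 u) = f2 u"
    using A.induced_hom[of M2 f2] by blast
  have "rep_map U M3 f3" using assms(6) by (auto simp: presents_def)
  moreover have "f3 u = f3 w" if "u \<in> U" "w \<in> U" "u - w \<in> L" for u w
    using C.f_eq_iff[of u w] that A.LU by auto
  ultimately obtain q where q: "q \<in> rep_hom M2 M3" "\<And>u. u \<in> U \<Longrightarrow> q (f2 u) = f3 u"
    using B.induced_hom[of M3 f3] by blast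
  have "inj_on i (carrier M1)"
  proof (rule inj_onI)
    fix v w
    assume "v \<in> carrier M1" "w \<in> carrier M1" "i v = i w"
    then obtain u u' where "u \<in> V" "v = f1 u" "u' \<in> V" "w = f1 u'" "i v = i w"
      using A.f_onto by blast
    then show "v = w" using i(2) B.f_eq_iff[of u u'] A.f_eq_iff[of u u'] VU by auto
  qed
  moreover have "i ` carrier M1 = f2 ` V"
    using i(2) by (auto simp: A.f_onto[symmetric] image_image)
  moreover have "a_kernel M2 M3 q = f2 ` V"
    using q(2) C.f_zero_iff VU by (auto simp: a_kernel_def' B.f_onto[symmetric])
  moreover have "q ` carrier M2 = carrier M3"
    using q(2) by (auto simp: B.f_onto[symmetric] C.f_onto[symmetric] image_image)
  ultimately show ?thesis unfolding short_exact_def using i(1) q(1)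
    by (intro bexI[of _ i] bexI[of _ q]) auto
qed

lemma presents_iso:
  assumes "smooth_rep M" "smooth_rep N" "presents L U M f" "k \<in> rep_hom M N" "bij_betw k (carrier M) (carrier N)"
  shows "presents L U N (\<lambda>u. k (f u))"
proof -
  interpret presentation scale gact M L U f by (rule presentationI[OF assms(1,3)])
  interpret N: smooth_rep N by fact
  have k0: "k \<zero>\<^bsub>M\<^esub> = \<zero>\<^bsub>N\<^esub>"
  proof -
    have "k (0 \<odot>\<^bsub>M\<^esub> \<zero>\<^bsub>M\<^esub>) = 0 \<odot>\<^bsub>N\<^esub> k \<zero>\<^bsub>M\<^esub>"
      using assms(4) unfolding rep_hom_def by blast
    moreover have "k \<zero>\<^bsub>M\<^esub> \<in> carrier N" using assms(5) by (simp add: bij_betwE)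
    ultimately show ?thesis by simp
  qed
  have "k v = \<zero>\<^bsub>N\<^esub> \<longleftrightarrow> v = \<zero>\<^bsub>M\<^esub>" if "v \<in> carrier M" for v
    using that k0 assms(5) M.zero_closed by (metis bij_betw_imp_inj_on inj_on_eq_iff)
  moreover have "(\<lambda>u. k (f u)) ` U = carrier N"
    using assms(5) f_onto by (simp add: image_image[symmetric] bij_betw_def)
  moreover have "rep_map U N (\<lambda>u. k (f u))"
    using assms(4,5) by (auto simp: rep_map_def rep_hom_def hom_def f_add f_scale f_gact bij_betwE)
  ultimately show ?thesis
    using stL stU LU by (simp add: presents_def f_zero_iff)
qed

text \<open>The quotient is realised on the range of a projection along \<open>L\<close>, with the
  projected action. The result lives in the ambient type and is then moved to the fixed type of the
  objects by \<open>fg_rep_iso_in_universe\<close>.\<close>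

lemma ex_presents:
  assumes st: "stable 0 L" "stable 0 U" "L \<subseteq> U" and fg: "fin_gen_over 0 L U"
    and smooth: "\<And>v. v \<in> U \<Longrightarrow> smooth_vector v"
  shows "\<exists>(M :: ('k ratfun, nat set \<Rightarrow>\<^sub>0 'k ratfun) sym_module)\<in>fg_reps. \<exists>f. presents L U M f"
proof -
  note subU = stable_subspace[OF st(2)] and subL = stable_subspace[OF st(1)]
  obtain p where p: "Vector_Spaces.linear scale scale p" "\<And>v. p v = 0 \<longleftrightarrow> v \<in> L" "\<And>v. v - p v \<in> L"
    using ex_projection[OF subL] by blast
  interpret p: Vector_Spaces.linear scale scale p by (rule p(1))
  have p_eq: "p v = p w \<longleftrightarrow> v - w \<in> L" for v w
    using p(2)[of "v - w"] by (simp add: p.diff)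
  have pp [simp]: "p (p v) = p v" for v
    using p(3)[of v] p_eq[of v "p v"] by simp
  have pU: "p v \<in> U" if "v \<in> U" for v
    using that p(3)[of v] st(3) subspace_diff[OF subU, of v "v - p v"] by auto
  define N :: "('k ratfun, 'w) sym_module" where
    "N = \<lparr>carrier = p ` U, monoid.mult = (\<lambda>_ _. 0), one = 0, zero = 0, add = (+),
      module.smult = scale, act = (\<lambda>g v. p (gact g v))\<rparr>"
  have N [simp]: "carrier N = p ` U" "\<zero>\<^bsub>N\<^esub> = 0" "v \<oplus>\<^bsub>N\<^esub> w = v + w" "a \<odot>\<^bsub>N\<^esub> v = a *s v"
    "act N g v = p (gact g v)" for v w a g
    by (simp_all add: N_def)
  \<comment> \<open>The projection need not be equivariant, but it changes a vector only by an
    element of the stable \<open>L\<close>. This identity makes the projected action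
    multiplicative.\<close>
  have pgact: "p (gact g (p v)) = p (gact g v)" for g v
    using stable_gact[OF st(1), of g "v - p v"] p(3)[of v] by (simp add: p_eq gact_diff[symmetric])
      (metis gact_diff minus_diff_eq subL subspace_neg)
  have "module ring_of_type_algebra N"
  proof (rule moduleI)
    show "cring (ring_of_type_algebra :: 'k ratfun ring)" by (rule cring_from_type_algebra)
    show "abelian_group N"
    proof (rule abelian_groupI)
      fix v
      assume "v \<in> carrier N"
      then obtain u where u: "u \<in> U" "v = p u" by auto
      then have "p (- u) \<in> carrier N" "p (- u) \<oplus>\<^bsub>N\<^esub> v = \<zero>\<^bsub>N\<^esub>"
        using imageI[OF subspace_neg[OF subU u(1)], of p] u(2) by (simp_all add: p.neg)
      then show "\<exists>w\<in>carrier N. w \<oplus>\<^bsub>N\<^esub> v = \<zero>\<^bsub>N\<^esub>" by blast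
    next
      show "\<zero>\<^bsub>N\<^esub> \<in> carrier N" using subspace_0[OF subU] p.zero by (auto intro: rev_image_eqI)
    next
      fix v w
      assume "v \<in> carrier N" "w \<in> carrier N"
      then show "v \<oplus>\<^bsub>N\<^esub> w \<in> carrier N" using subspace_add[OF subU] by (auto simp flip: p.add)
    qed (auto simp: add_ac)
  next
    fix a v
    assume "v \<in> carrier N"
    then show "a \<odot>\<^bsub>N\<^esub> v \<in> carrier N" using subspace_scale[OF subU] by (auto simp flip: p.scale)
  qed (auto simp: ring_of_type_algebra_def scale_left_distrib scale_right_distrib)
  then have sN: "smooth_rep N"
  proof (rule smooth_rep.intro, unfold_locales)
    fix v
    assume "v \<in> carrier N"
    then obtain u where u: "u \<in> U" "v = p u" by auto
    then have "smooth_vector v" using smooth pU by auto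
    then obtain n where "\<And>g. g \<in> sym_fix n \<Longrightarrow> gact g v = v" by (auto simp: smooth_vector_def)
    then have "act N g v = v" if "g \<in> sym_fix n" for g using that u(2) by simp
    then show "\<exists>n. \<forall>g\<in>sym_fix n. act N g v = v" by blast
  next
    fix v g h
    assume "v \<in> carrier N"
    then show "act N (g * h) v = act N g (act N h v)" by (simp add: gact_times pgact)
  qed (use pU stable_gact[OF st(2)] in \<open>auto simp: gact_add gact_scale p.add p.scale\<close>)
  have "rep_map U N p"
    by (auto simp: rep_map_def p.add p.scale pgact)
  then have pres: "presents L U N p" using st p(2) by (simp add: presents_def)
  interpret presentation scale gact N L U p by (rule presentationI[OF sN pres])
  obtain F where F: "finite F" "F \<subseteq> U" "U = span (L \<union> orbits 0 F)"
    using fg by (rule fin_gen_over_obtain)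
  have orb: "orbits 0 F \<subseteq> U" by (rule orbits_subset[OF st(2) F(2)])
  have "{act N g v |g v. v \<in> p ` F} = p ` orbits 0 F"
  proof (intro equalityI subsetI)
    fix x
    assume "x \<in> p ` orbits 0 F"
    then obtain g u where "x = p (gact g u)" "u \<in> F" by blast
    then have "x = act N g (p u)" "p u \<in> p ` F" by (simp_all add: pgact)
    then show "x \<in> {act N g v |g v. v \<in> p ` F}" by blast
  next
    fix x
    assume "x \<in> {act N g v |g v. v \<in> p ` F}"
    then obtain g u where "x = p (gact g u)" "u \<in> F" by (auto simp: pgact)
    then show "x \<in> p ` orbits 0 F" by auto
  qed
  then have "gen_submodule N {act N g v |g v. v \<in> p ` F} = p ` span (orbits 0 F)"
    using gen_submodule_image[OF orb] by simp
  also have "\<dots> = p ` U"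
  proof
    show "p ` span (orbits 0 F) \<subseteq> p ` U" using span_minimal[OF orb subU] by blast
    show "p ` U \<subseteq> p ` span (orbits 0 F)"
    proof clarify
      fix u
      assume "u \<in> U"
      then obtain z w where zw: "z \<in> span L" "w \<in> span (orbits 0 F)" "u = z + w"
        using F(3) unfolding span_Un by blast
      moreover have "span L = L" using subL by simp
      ultimately have "p u = p w" by (simp add: p_eq)
      then show "p u \<in> p ` span (orbits 0 F)" using zw(2) by blast
    qed
  qed
  finally have "fin_gen N"
    unfolding fin_gen_def using F(1,2) by (intro exI[of _ "p ` F"]) auto
  then obtain M :: "('k ratfun, nat set \<Rightarrow>\<^sub>0 'k ratfun) sym_module" where M: "M \<in> fg_reps" "rep_iso N M"
    using fg_rep_iso_in_universe[OF sN] by blast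
  then obtain k where "k \<in> rep_hom N M" "bij_betw k (carrier N) (carrier M)"
    by (auto simp: rep_iso_def)
  then have "presents L U M (\<lambda>u. k (p u))"
    using M(1) by (intro presents_iso[OF sN _ pres]) (auto simp: fg_reps_def)
  then show ?thesis using M(1) by blast
qed

end

lemma poly_mapping_keys_induct [consumes 1, case_names zero single add]:
  fixes f :: "'a \<Rightarrow>\<^sub>0 'b::comm_monoid_add"
  assumes "Poly_Mapping.keys f \<subseteq> A" "P 0" "\<And>x a. x \<in> A \<Longrightarrow> P (Poly_Mapping.single x a)"
    and "\<And>f h. Poly_Mapping.keys f \<subseteq> A \<Longrightarrow> Poly_Mapping.keys h \<subseteq> A \<Longrightarrow> P f \<Longrightarrow> P h \<Longrightarrow> P (f + h)"
  shows "P f"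
proof -
  have "P (\<Sum>x\<in>B. Poly_Mapping.single x (Poly_Mapping.lookup f x)) \<and>
      Poly_Mapping.keys (\<Sum>x\<in>B. Poly_Mapping.single x (Poly_Mapping.lookup f x)) \<subseteq> A"
    if "finite B" "B \<subseteq> A" for B
    using that
  proof (induction B rule: finite_induct)
    case (insert x B)
    let ?s = "Poly_Mapping.single x (Poly_Mapping.lookup f x)"
      and ?t = "\<Sum>x\<in>B. Poly_Mapping.single x (Poly_Mapping.lookup f x)"
    have "Poly_Mapping.keys ?s \<subseteq> A" "Poly_Mapping.keys ?t \<subseteq> A" "P ?s" "P ?t"
      using insert assms(3) by auto
    then show ?case using insert.hyps assms(4)[of ?s ?t] keys_add[of ?s ?t] by auto
  qed (use assms(2) in simp)
  from this[OF finite_keys assms(1)]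
  have "P (\<Sum>x\<in>Poly_Mapping.keys f. Poly_Mapping.single x (Poly_Mapping.lookup f x))" ..
  then show ?thesis by (simp flip: poly_mapping_eq_sum)
qed

section \<open>The canonical presentation\<close>

context smooth_rep
begin

text \<open>Outside the carrier \<open>act M g\<close> is unspecified, so it is replaced by the identity there.\<close>

definition ix_act :: "nat perm \<Rightarrow> 'v \<Rightarrow> 'v" where
  "ix_act g x = (if x \<in> carrier M then act M g x else x)"

lemma ix_act_one [simp]: "ix_act 1 x = x"
  by (simp add: ix_act_def act_one)

lemma ix_act_times: "ix_act (g * h) x = ix_act g (ix_act h x)"
  by (simp add: ix_act_def act_times act_closed)

lemma ix_act_inverse [simp]: "ix_act (inverse g) (ix_act g x) = x" "ix_act g (ix_act (inverse g) x) = x"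
  by (simp_all flip: ix_act_times)

lemma inj_ix_act: "inj (ix_act g)"
  by (rule inj_on_inverseI[of _ "ix_act (inverse g)"]) simp

text \<open>The free vector space on the elements of \<open>M\<close>, with the group permuting
  basis vectors and acting on coefficients. It turns an object, whose operations make sense only on
  its carrier, into a quotient of a representation on a whole type.\<close>

definition free_act :: "nat perm \<Rightarrow> ('v \<Rightarrow>\<^sub>0 'k ratfun) \<Rightarrow> ('v \<Rightarrow>\<^sub>0 'k ratfun)" where
  "free_act g f = Poly_Mapping.map (perm_ratfun g) (Poly_Mapping.map_key (ix_act (inverse g)) f)"

lemma lookup_free_act:
  "Poly_Mapping.lookup (free_act g f) x = perm_ratfun g (Poly_Mapping.lookup f (ix_act (inverse g) x))"
  by (simp add: free_act_def map.rep_eq map_key.rep_eq inj_ix_act when_def)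

abbreviation free_scale :: "'k ratfun \<Rightarrow> ('v \<Rightarrow>\<^sub>0 'k ratfun) \<Rightarrow> ('v \<Rightarrow>\<^sub>0 'k ratfun)" where
  "free_scale a \<equiv> Poly_Mapping.map ((*) a)"

lemma semilinear_free: "semilinear free_scale free_act"
proof unfold_locales
  fix a b :: "'k ratfun" and f h :: "'v \<Rightarrow>\<^sub>0 'k ratfun" and g g' :: "nat perm"
  show "free_scale a (f + h) = free_scale a f + free_scale a h"
    by (rule poly_mapping_eqI) (simp add: lookup_smult lookup_add algebra_simps)
  show "free_scale (a + b) f = free_scale a f + free_scale b f"
    by (rule poly_mapping_eqI) (simp add: lookup_smult lookup_add algebra_simps)
  show "free_scale a (free_scale b f) = free_scale (a * b) f"
    by (rule poly_mapping_eqI) (simp add: lookup_smult)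
  show "free_scale 1 f = f"
    by (rule poly_mapping_eqI) (simp add: lookup_smult)
  show "free_act 1 f = f"
    by (rule poly_mapping_eqI) (simp add: lookup_free_act)
  show "free_act (g * g') f = free_act g (free_act g' f)"
    by (rule poly_mapping_eqI) (simp add: lookup_free_act perm_ratfun_times ix_act_times)
  show "free_act g (f + h) = free_act g f + free_act g h"
    by (rule poly_mapping_eqI) (simp add: lookup_free_act lookup_add perm_ratfun_add)
  show "free_act g (free_scale a f) = free_scale (perm_ratfun g a) (free_act g f)"
    by (rule poly_mapping_eqI) (simp add: lookup_free_act lookup_smult perm_ratfun_mult)
qed

lemma free_act_single: "free_act g (Poly_Mapping.single x a) = Poly_Mapping.single (ix_act g x) (perm_ratfun g a)"
proof (rule poly_mapping_eqI)
  fix y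
  have "x = ix_act (inverse g) y \<longleftrightarrow> ix_act g x = y" by auto
  then show "Poly_Mapping.lookup (free_act g (Poly_Mapping.single x a)) y =
      Poly_Mapping.lookup (Poly_Mapping.single (ix_act g x) (perm_ratfun g a)) y"
    by (simp add: lookup_free_act lookup_single when_def)
qed

definition free_carrier :: "('v \<Rightarrow>\<^sub>0 'k ratfun) set" where
  "free_carrier = {f. Poly_Mapping.keys f \<subseteq> carrier M}"

definition eval :: "('v \<Rightarrow>\<^sub>0 'k ratfun) \<Rightarrow> 'v" where
  "eval f = (\<Oplus>x\<in>Poly_Mapping.keys f. Poly_Mapping.lookup f x \<odot> x)"

lemma eval_superset:
  assumes "finite A" "Poly_Mapping.keys f \<subseteq> A" "A \<subseteq> carrier M"
  shows "eval f = (\<Oplus>x\<in>A. Poly_Mapping.lookup f x \<odot> x)"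
  unfolding eval_def
  by (rule add.finprod_mono_neutral_cong_left) (use assms in \<open>auto simp: in_keys_iff\<close>)

lemma eval_closed: "f \<in> free_carrier \<Longrightarrow> eval f \<in> carrier M"
  unfolding eval_def free_carrier_def by (rule finsum_closed) auto

lemma eval_add:
  assumes "f \<in> free_carrier" "h \<in> free_carrier"
  shows "eval (f + h) = eval f \<oplus> eval h"
proof -
  let ?A = "Poly_Mapping.keys f \<union> Poly_Mapping.keys h"
  have A: "?A \<subseteq> carrier M" using assms by (auto simp: free_carrier_def)
  have "eval (f + h) = (\<Oplus>x\<in>?A. Poly_Mapping.lookup (f + h) x \<odot> x)"
    by (rule eval_superset) (use A keys_add[of f h] in auto)
  also have "\<dots> = (\<Oplus>x\<in>?A. Poly_Mapping.lookup f x \<odot> x \<oplus> Poly_Mapping.lookup h x \<odot> x)"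
    by (rule finsum_cong') (use A in \<open>auto simp: lookup_add scalar_add\<close>)
  also have "\<dots> = (\<Oplus>x\<in>?A. Poly_Mapping.lookup f x \<odot> x) \<oplus> (\<Oplus>x\<in>?A. Poly_Mapping.lookup h x \<odot> x)"
    by (rule finsum_addf) (use A in auto)
  also have "\<dots> = eval f \<oplus> eval h"
    using A by (simp add: eval_superset[of ?A])
  finally show ?thesis .
qed

lemma eval_0 [simp]: "eval 0 = \<zero>"
  by (simp add: eval_def)

lemma eval_single: "x \<in> carrier M \<Longrightarrow> eval (Poly_Mapping.single x a) = a \<odot> x"
  by (subst eval_superset[of "{x}"]) (auto simp: finsum_singleton)

lemma free_carrier_scale: "f \<in> free_carrier \<Longrightarrow> free_scale a f \<in> free_carrier"
  by (auto simp: free_carrier_def in_keys_iff lookup_smult subset_iff)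

lemma free_carrier_add: "f \<in> free_carrier \<Longrightarrow> h \<in> free_carrier \<Longrightarrow> f + h \<in> free_carrier"
  using keys_add[of f h] by (auto simp: free_carrier_def)

lemma free_carrier_act: "f \<in> free_carrier \<Longrightarrow> free_act g f \<in> free_carrier"
proof -
  assume f: "f \<in> free_carrier"
  have "x \<in> carrier M" if "Poly_Mapping.lookup (free_act g f) x \<noteq> 0" for x
  proof -
    have "Poly_Mapping.lookup f (ix_act (inverse g) x) \<noteq> 0" using that by (auto simp: lookup_free_act)
    then have "ix_act (inverse g) x \<in> carrier M" using f by (auto simp: free_carrier_def in_keys_iff)
    then show ?thesis by (auto simp: ix_act_def split: if_splits)
  qed
  then show ?thesis by (auto simp: free_carrier_def in_keys_iff)
qed

lemma eval_scale:
  assumes "f \<in> free_carrier"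
  shows "eval (free_scale a f) = a \<odot> eval f"
  using assms unfolding free_carrier_def mem_Collect_eq
proof (induction f rule: poly_mapping_keys_induct)
  case (single x b)
  then show ?case by (simp add: map_times_single eval_single scalar_mult)
next
  case (add f h)
  interpret free: semilinear free_scale free_act by (rule semilinear_free)
  have "f \<in> free_carrier" "h \<in> free_carrier" using add by (auto simp: free_carrier_def)
  then show ?case
    using add.IH eval_closed smult_r_distr[of a "eval f" "eval h"] free_carrier_scale
    by (simp add: free.scale_right_distrib eval_add ring_of_type_algebra_def)
next
  case zero
  have "free_scale a 0 = (0 :: 'v \<Rightarrow>\<^sub>0 'k ratfun)" by (rule poly_mapping_eqI) (simp add: lookup_smult)
  then show ?case by simp
qed

lemma eval_act:
  assumes "f \<in> free_carrier"
  shows "eval (free_act g f) = act M g (eval f)"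
  using assms unfolding free_carrier_def mem_Collect_eq
proof (induction f rule: poly_mapping_keys_induct)
  case (single x b)
  then show ?case by (simp add: free_act_single eval_single ix_act_def act_closed act_smult)
next
  case (add f h)
  interpret free: semilinear free_scale free_act by (rule semilinear_free)
  have "f \<in> free_carrier" "h \<in> free_carrier" using add by (auto simp: free_carrier_def)
  then show ?case
    using add.IH eval_closed free_carrier_act by (simp add: free.gact_add eval_add act_add)
next
  case zero
  interpret free: semilinear free_scale free_act by (rule semilinear_free)
  show ?case by simp
qed

lemma free_presents:
  "semilinear.presents free_scale free_act {f \<in> free_carrier. eval f = \<zero>} free_carrier M eval"
proof -
  interpret free: semilinear free_scale free_act by (rule semilinear_free)
  have U: "free.subspace free_carrier"
    by (rule free.subspaceI) (auto simp: free_carrier_add free_carrier_scale, simp add: free_carrier_def)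
  then have "free.stable 0 free_carrier"
    by (simp add: free.stable_def free_carrier_act)
  moreover have "free.stable 0 {f \<in> free_carrier. eval f = \<zero>}"
    unfolding free.stable_def
    using free.subspace_0[OF U]
    by (auto intro!: free.subspaceI simp: free_carrier_add free_carrier_scale free_carrier_act eval_add
        eval_scale eval_act)
  moreover have "eval ` free_carrier = carrier M"
  proof
    show "carrier M \<subseteq> eval ` free_carrier"
    proof
      fix v
      assume "v \<in> carrier M"
      then have "v = eval (Poly_Mapping.single v 1)" "Poly_Mapping.single v 1 \<in> free_carrier"
        by (simp_all add: eval_single free_carrier_def)
      then show "v \<in> eval ` free_carrier" by blast
    qed
  qed (auto simp: eval_closed)
  moreover have "free.rep_map free_carrier M eval"
    by (auto simp: free.rep_map_def eval_closed eval_add eval_scale eval_act)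
  ultimately show ?thesis by (auto simp: free.presents_def)
qed

lemma free_smooth:
  assumes "f \<in> free_carrier"
  shows "semilinear.smooth_vector free_act f"
proof -
  interpret free: semilinear free_scale free_act by (rule semilinear_free)
  show ?thesis
    using assms unfolding free_carrier_def mem_Collect_eq
  proof (induction f rule: poly_mapping_keys_induct)
    case (single x a)
    obtain n where n: "\<forall>g\<in>sym_fix n. act M g x = x" using smooth[OF single] by blast
    obtain m where m: "\<forall>g\<in>sym_fix m. perm_ratfun g a = a" using smooth_ratfun by blast
    have "free_act g (Poly_Mapping.single x a) = Poly_Mapping.single x a" if "g \<in> sym_fix (max n m)" for g
    proof -
      have "g \<in> sym_fix n" "g \<in> sym_fix m"
        using that sym_fix_mono[of n "max n m"] sym_fix_mono[of m "max n m"] by auto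
      then show ?thesis using n m single by (simp add: free_act_single ix_act_def)
    qed
    then show ?case unfolding free.smooth_vector_def by blast
  next
    case (add f h)
    then obtain n m where n: "\<forall>g\<in>sym_fix n. free_act g f = f" "\<forall>g\<in>sym_fix m. free_act g h = h"
      by (auto simp: free.smooth_vector_def)
    have "free_act g (f + h) = f + h" if "g \<in> sym_fix (max n m)" for g
    proof -
      have "g \<in> sym_fix n" "g \<in> sym_fix m"
        using that sym_fix_mono[of n "max n m"] sym_fix_mono[of m "max n m"] by auto
      then show ?thesis using n by (simp add: free.gact_add)
    qed
    then show ?case unfolding free.smooth_vector_def by blast
  qed (simp add: free.smooth_vector_def)
qed

end

context semilinear
begin

lemma presents_ex_chain:
  assumes "smooth_rep M" "fin_gen M" "presents L U M f" "\<And>v. v \<in> U \<Longrightarrow> smooth_vector v"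
  shows "\<exists>n l. chain n L U l \<and> head_max l"
proof -
  interpret presentation scale gact M L U f by (rule presentationI[OF assms(1,3)])
  obtain d Q where Q: "lower 0 d Q" "U = span (L \<union> Q)"
    using fin_gen_over_lower[OF fin_gen_over[OF assms(2)] assms(4)] by blast
  show ?thesis using ex_chain[OF stL Q(1)] Q(2) by blast
qed

text \<open>\<open>V\<close> is the preimage of the kernel of the second map. A presentation of the
  middle term thus presents the outer terms in the same ambient space, where filtrations can be put
  on top of each other.\<close>

lemma presents_of_short_exact:
  assumes "smooth_rep M1" "smooth_rep M2" "smooth_rep M3" "short_exact M1 M2 M3" "presents L U M2 f"
  shows "\<exists>V f1 f3. presents L V M1 f1 \<and> presents V U M3 f3 \<and> V \<subseteq> U"
proof -
  interpret presentation scale gact M2 L U f by (rule presentationI[OF assms(2,5)])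
  interpret A: smooth_rep M1 by fact
  interpret C: smooth_rep M3 by fact
  obtain i q where i: "i \<in> rep_hom M1 M2" "inj_on i (carrier M1)" and q: "q \<in> rep_hom M2 M3"
    and ex: "i ` carrier M1 = a_kernel M2 M3 q" "q ` carrier M2 = carrier M3"
    using assms(4) by (auto simp: short_exact_def)
  have iadd: "i (v \<oplus>\<^bsub>M1\<^esub> w) = i v \<oplus>\<^bsub>M2\<^esub> i w" if "v \<in> carrier M1" "w \<in> carrier M1" for v w
    using i(1) that by (auto simp: rep_hom_def hom_def)
  have iscale: "i (a \<odot>\<^bsub>M1\<^esub> v) = a \<odot>\<^bsub>M2\<^esub> i v" and iact: "i (act M1 g v) = act M2 g (i v)"
    if "v \<in> carrier M1" for a g v
    using i(1) that by (auto simp: rep_hom_def)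
  have qadd: "q (v \<oplus>\<^bsub>M2\<^esub> w) = q v \<oplus>\<^bsub>M3\<^esub> q w" if "v \<in> carrier M2" "w \<in> carrier M2" for v w
    using q that by (auto simp: rep_hom_def hom_def)
  have qscale: "q (a \<odot>\<^bsub>M2\<^esub> v) = a \<odot>\<^bsub>M3\<^esub> q v" and qact: "q (act M2 g v) = act M3 g (q v)"
    if "v \<in> carrier M2" for a g v
    using q that by (auto simp: rep_hom_def)
  have qc: "q v \<in> carrier M3" if "v \<in> carrier M2" for v using that ex(2) by blast
  have q0: "q \<zero>\<^bsub>M2\<^esub> = \<zero>\<^bsub>M3\<^esub>"
    using qscale[of "\<zero>\<^bsub>M2\<^esub>" 0] qc[of "\<zero>\<^bsub>M2\<^esub>"] by simp
  have i0: "i \<zero>\<^bsub>M1\<^esub> = \<zero>\<^bsub>M2\<^esub>"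
  proof -
    have "i \<zero>\<^bsub>M1\<^esub> \<in> carrier M2" using i(1) by (auto simp: rep_hom_def hom_def)
    then show ?thesis using iscale[of "\<zero>\<^bsub>M1\<^esub>" 0] by simp
  qed
  define V where "V = {u \<in> U. q (f u) = \<zero>\<^bsub>M3\<^esub>}"
  have qrep: "rep_map U M3 (\<lambda>u. q (f u))"
    by (auto simp: rep_map_def qc f_add f_scale f_gact qadd qscale qact)
  have "subspace V"
    unfolding V_def using subU
    by (auto intro!: subspaceI simp: subspace_0 subspace_add subspace_scale f_add f_scale qadd qscale
        f_zero_iff[THEN iffD2] subspace_0[OF subL] q0)
  moreover have "gact g u \<in> V" if "u \<in> V" for g u
    using that stable_gact[OF stU, of g u] by (simp add: V_def f_gact qact)
  ultimately have stV: "stable 0 V" by (simp add: stable_def)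
  have LV: "L \<subseteq> V"
  proof
    fix u
    assume "u \<in> L"
    moreover from this have "u \<in> U" using LU by blast
    ultimately have "f u = \<zero>\<^bsub>M2\<^esub>" using f_zero_iff by blast
    then show "u \<in> V" using \<open>u \<in> U\<close> q0 by (simp add: V_def)
  qed
  have VU: "V \<subseteq> U" by (auto simp: V_def)
  have "presents V U M3 (\<lambda>u. q (f u))"
    using stV stU VU qrep ex(2) by (auto simp: presents_def V_def f_onto[symmetric] image_image)
  define f1 where "f1 u = the_inv_into (carrier M1) i (f u)" for u
  have fV: "f u \<in> i ` carrier M1" if "u \<in> V" for u
    using that unfolding ex(1) by (simp add: V_def a_kernel_def')
  have if1: "i (f1 u) = f u" and f1c: "f1 u \<in> carrier M1" if "u \<in> V" for u
    using fV[OF that] i(2) by (auto simp: f1_def f_the_inv_into_f the_inv_into_into)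
  have f1_eq: "f1 u = v" if "u \<in> V" "v \<in> carrier M1" "i v = f u" for u v
    using that i(2) if1 f1c by (metis inj_on_eq_iff)
  note subV = stable_subspace[OF stV]
  have "rep_map V M1 f1"
    unfolding rep_map_def
  proof (intro conjI ballI allI)
    fix u w
    assume uw: "u \<in> V" "w \<in> V"
    then show "f1 (u + w) = f1 u \<oplus>\<^bsub>M1\<^esub> f1 w"
      using VU subspace_add[OF subV uw] by (intro f1_eq) (auto simp: f1c iadd if1 f_add subset_iff)
  next
    fix a u
    assume u: "u \<in> V"
    then show "f1 (a *s u) = a \<odot>\<^bsub>M1\<^esub> f1 u"
      using VU subspace_scale[OF subV u] by (intro f1_eq) (auto simp: f1c iscale if1 f_scale subset_iff)
  next
    fix g u
    assume u: "u \<in> V"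
    then show "f1 (gact g u) = act M1 g (f1 u)"
      using VU stable_gact[OF stV _ u, of g]
      by (intro f1_eq) (auto simp: f1c iact if1 f_gact A.act_closed subset_iff)
  qed (use f1c in auto)
  moreover have "f1 ` V = carrier M1"
  proof (intro equalityI subsetI)
    fix v
    assume v: "v \<in> carrier M1"
    then have "i v \<in> a_kernel M2 M3 q" using ex(1) by blast
    then have iv: "i v \<in> carrier M2" "q (i v) = \<zero>\<^bsub>M3\<^esub>" by (auto simp: a_kernel_def')
    then obtain u where u: "u \<in> U" "i v = f u" using f_onto by blast
    then have "u \<in> V" using iv by (simp add: V_def)
    then have "f1 u = v" using v u(2) by (intro f1_eq)
    then show "v \<in> f1 ` V" using \<open>u \<in> V\<close> by blast
  qed (use f1c in auto)
  moreover have "f1 u = \<zero>\<^bsub>M1\<^esub> \<longleftrightarrow> u \<in> L" if "u \<in> V" for u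
  proof -
    have "f1 u = \<zero>\<^bsub>M1\<^esub> \<longleftrightarrow> f u = \<zero>\<^bsub>M2\<^esub>"
      using if1[OF that] i0 f1_eq[OF that, of "\<zero>\<^bsub>M1\<^esub>"] by auto
    then show ?thesis using f_zero_iff that VU by auto
  qed
  ultimately have "presents L V M1 f1" using stL stV LV by (simp add: presents_def)
  then show ?thesis using \<open>presents V U M3 _\<close> VU by blast
qed

end

lemma inv_dim_chain:
  assumes "M \<in> fg_reps"
  shows "\<exists>n l. \<forall>N\<ge>n. inv_dim N M = (\<Sum>d\<leftarrow>l. (N - n) choose d)"
proof -
  interpret smooth_rep M using assms by (simp add: fg_reps_def)
  interpret free: semilinear free_scale free_act by (rule semilinear_free)
  obtain n l where "free.chain n {f \<in> free_carrier. eval f = \<zero>\<^bsub>M\<^esub>} free_carrier l"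
    using free.presents_ex_chain[OF smooth_rep_axioms _ free_presents free_smooth] assms
    by (auto simp: fg_reps_def)
  then show ?thesis
    using presentation.inv_dim_eq[OF free.presentationI[OF smooth_rep_axioms free_presents]] by blast
qed

text \<open>Filtrations of the two outer terms, restricted to a common group, concatenate to one of
  the middle term, and the count of \<open>inv_dim_eq\<close> is additive in the list of
  degrees.\<close>

lemma inv_dim_short_exact:
  assumes "M1 \<in> fg_reps" "M2 \<in> fg_reps" "M3 \<in> fg_reps" "short_exact M1 M2 M3"
  shows "\<forall>\<^sub>F N in sequentially. inv_dim N M2 = inv_dim N M1 + inv_dim N M3"
proof -
  have M: "smooth_rep M1" "smooth_rep M2" "smooth_rep M3" "fin_gen M1" "fin_gen M2" "fin_gen M3"
    using assms by (simp_all add: fg_reps_def)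
  interpret smooth_rep M2 by fact
  interpret free: semilinear free_scale free_act by (rule semilinear_free)
  let ?L = "{f \<in> free_carrier. eval f = \<zero>\<^bsub>M2\<^esub>}" and ?U = free_carrier
  obtain V f1 f3 where V: "free.presents ?L V M1 f1" "free.presents V ?U M3 f3" "V \<subseteq> ?U"
    using free.presents_of_short_exact[OF M(1-3) assms(4) free_presents] by blast
  obtain n1 l1 where l1: "free.chain n1 ?L V l1"
    using free.presents_ex_chain[OF M(1,4) V(1)] free_smooth V(3) by blast
  obtain n3 l3 where l3: "free.chain n3 V ?U l3"
    using free.presents_ex_chain[OF M(3,6) V(2)] free_smooth by blast
  obtain l1' where l1': "free.chain (max n1 n3) ?L V l1'"
    using free.chain_mono[OF l1, of "max n1 n3"] by auto
  obtain l3' where l3': "free.chain (max n1 n3) V ?U l3'"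
    using free.chain_mono[OF l3, of "max n1 n3"] by auto
  note l2 = free.chain_append[OF l3' l1']
  show ?thesis
  proof (rule eventually_sequentiallyI[of "max n1 n3"])
    fix N
    assume N: "max n1 n3 \<le> N"
    show "inv_dim N M2 = inv_dim N M1 + inv_dim N M3"
      using presentation.inv_dim_eq[OF free.presentationI[OF M(1) V(1)] l1' N]
        presentation.inv_dim_eq[OF free.presentationI[OF M(2) free_presents] l2 N]
        presentation.inv_dim_eq[OF free.presentationI[OF M(3) V(2)] l3' N]
      by simp
  qed
qed

section \<open>The induced modules\<close>

lemma tail_sets_eq_r_subsets: "tail_sets 0 r = r_subsets r"
  by (auto simp: tail_sets_def r_subsets_def)

lemma carrier_I_rep: "carrier (I_rep r) = {f. Poly_Mapping.keys f \<subseteq> tail_sets 0 r}"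
  by (simp add: I_rep_def tail_sets_eq_r_subsets)

lemma comb_single_one: "subs.comb (\<lambda>T. Poly_Mapping.single T 1) f = f"
  by (simp add: subs.comb_def map_times_single flip: poly_mapping_eq_sum)

lemma fam_single_one: "subs.fam n d (\<lambda>T. Poly_Mapping.single T 1)"
  by (simp add: subs.fam_def act_I_rep_single)

lemma span_single_one:
  "subs.span ((\<lambda>T. Poly_Mapping.single T 1) ` B) = {f :: nat set \<Rightarrow>\<^sub>0 'k::field ratfun. Poly_Mapping.keys f \<subseteq> B}"
proof (intro equalityI subsetI)
  fix f :: "nat set \<Rightarrow>\<^sub>0 'k ratfun"
  assume "f \<in> subs.span ((\<lambda>T. Poly_Mapping.single T 1) ` B)"
  then obtain h where "Poly_Mapping.keys h \<subseteq> B" "f = subs.comb (\<lambda>T. Poly_Mapping.single T 1) h"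
    using subs.span_image_comb by blast
  then show "f \<in> {f. Poly_Mapping.keys f \<subseteq> B}" by (simp add: comb_single_one)
next
  fix f :: "nat set \<Rightarrow>\<^sub>0 'k ratfun"
  assume "f \<in> {f. Poly_Mapping.keys f \<subseteq> B}"
  then show "f \<in> subs.span ((\<lambda>T. Poly_Mapping.single T 1) ` B)"
    using subs.comb_in_span[of f B "\<lambda>T. Poly_Mapping.single T 1"] by (simp add: comb_single_one)
qed

lemma I_rep_simps [simp]:
  "\<zero>\<^bsub>I_rep r\<^esub> = 0" "f \<oplus>\<^bsub>I_rep r\<^esub> h = f + h" "a \<odot>\<^bsub>I_rep r\<^esub> f = Poly_Mapping.map ((*) a) f"
  by (simp_all add: I_rep_def)

lemma chain_I_rep: "subs.chain 0 {0} (carrier (I_rep r :: ('k::field ratfun, _) sym_module)) [r]"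
proof -
  let ?e = "\<lambda>T. Poly_Mapping.single T (1 :: 'k ratfun)"
  have "subs.stable 0 {0 :: nat set \<Rightarrow>\<^sub>0 'k ratfun}" by (simp add: subs.stable_def)
  moreover have "subs.indep_over {0} (tail_sets 0 r) ?e"
    by (simp add: subs.indep_over_def comb_single_one)
  ultimately have "subs.chain 0 {0} (subs.span ({0} \<union> ?e ` tail_sets 0 r)) [r]"
    by (rule subs.chain_singleton[OF _ fam_single_one])
  then show ?thesis by (simp add: span_single_one carrier_I_rep subs.span_insert_0)
qed

lemma presents_I_rep:
  "subs.presents {0} (carrier (I_rep r :: ('k::field ratfun, _) sym_module)) (I_rep r) (\<lambda>f. f)"
  using subs.chain_stable[OF chain_I_rep[of r, where 'k = 'k]]
  by (simp add: subs.presents_def subs.rep_map_def act_I_rep_eq[of r])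

lemma smooth_I_rep: "f \<in> carrier (I_rep r) \<Longrightarrow> subs.smooth_vector f"
  using smooth_rep.smooth[OF smooth_rep_I_rep, of f r] by (simp add: subs.smooth_vector_def act_I_rep_eq[of r])

lemma inv_dim_I_rep: "inv_dim N (I_rep r) = N choose r"
  using presentation.inv_dim_eq[OF subs.presentationI[OF smooth_rep_I_rep presents_I_rep] chain_I_rep, of N r] by simp

text \<open>A nonzero element of \<open>J\<close> is a nontrivial relation between the basis vectors
  modulo \<open>J\<close>, so the single family that generates the quotient can be rewritten in
  degrees below \<open>d\<close>.\<close>

lemma ex_chain_quotient_I_rep:
  fixes J :: "(nat set \<Rightarrow>\<^sub>0 'a::field ratfun) set"
  assumes "subs.stable 0 J" "J \<subseteq> carrier (I_rep d)" "j \<in> J" "j \<noteq> 0"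
  shows "\<exists>n l. subs.chain n J (carrier (I_rep d)) l \<and> (\<forall>i\<in>set l. i < d)"
proof -
  let ?e = "\<lambda>T. Poly_Mapping.single T (1 :: 'a ratfun)"
  have "\<not> subs.indep_over J (tail_sets 0 d) ?e"
    using assms by (auto simp: subs.indep_over_def comb_single_one carrier_I_rep)
  then obtain n Q where Q: "subs.lower n d Q" "subs.span (J \<union> ?e ` tail_sets 0 d) = subs.span (J \<union> Q)"
    using subs.dependent_fam_lower[OF fam_single_one assms(1)] by blast
  have "subs.span (J \<union> ?e ` tail_sets 0 d) = carrier (I_rep d)"
  proof
    have "subs.stable 0 (carrier (I_rep d :: ('a ratfun, _) sym_module))"
      using presents_I_rep[of d, where 'k = 'a] by (simp add: subs.presents_def)
    then show "subs.span (J \<union> ?e ` tail_sets 0 d) \<subseteq> carrier (I_rep d)"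
      using assms(2) by (intro subs.span_minimal subs.stable_subspace) (auto simp: carrier_I_rep)
    show "carrier (I_rep d) \<subseteq> subs.span (J \<union> ?e ` tail_sets 0 d)"
      unfolding carrier_I_rep span_single_one[symmetric] by (rule subs.span_mono) simp
  qed
  then show ?thesis
    using subs.ex_chain[OF subs.stable_mono[OF assms(1)] Q(1)] Q(2) by force
qed

section \<open>Growth of the number of invariants\<close>

lemma choose_over_power_tendsto: "(\<lambda>N. real ((N - n) choose d) / real N ^ d) \<longlonglongrightarrow> 1 / fact d"
proof -
  have "(\<lambda>N. (\<Prod>i = 0..<d. (1 - (real n + real i) / real N)) / fact d) \<longlonglongrightarrow> (\<Prod>i = 0..<d. (1 - 0)) / fact d"
    by (intro tendsto_intros lim_const_over_n) simp
  then have lim: "(\<lambda>N. (\<Prod>i = 0..<d. (1 - (real n + real i) / real N)) / fact d) \<longlonglongrightarrow> 1 / fact d"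
    by simp
  have "\<forall>\<^sub>F N in sequentially. (\<Prod>i = 0..<d. (1 - (real n + real i) / real N)) / fact d = real ((N - n) choose d) / real N ^ d"
    using eventually_ge_at_top[of "Suc n"]
  proof eventually_elim
    case (elim N)
    have "real ((N - n) choose d) = (\<Prod>i = 0..<d. real (N - n) - real i) / fact d"
      by (simp add: binomial_gbinomial gbinomial_prod_rev)
    also have "(\<Prod>i = 0..<d. real (N - n) - real i) = (\<Prod>i = 0..<d. real N * (1 - (real n + real i) / real N))"
      by (rule prod.cong) (use elim in \<open>auto simp: of_nat_diff field_simps\<close>)
    also have "\<dots> = real N ^ d * (\<Prod>i = 0..<d. (1 - (real n + real i) / real N))"
      by (simp add: prod.distrib)
    finally show ?case using elim by simp
  qed
  then show ?thesis by (rule Lim_transform_eventually[OF lim])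
qed

lemma over_power_tendsto_0:
  assumes "(\<lambda>N. f N / real N ^ j) \<longlonglongrightarrow> c" "j < d"
  shows "(\<lambda>N. f N / real N ^ d) \<longlonglongrightarrow> 0"
proof -
  have "(\<lambda>N. 1 / real N ^ (d - j)) \<longlonglongrightarrow> 0"
    using tendsto_power[OF lim_1_over_n[where 'a = real], of "d - j"] assms(2) by (simp add: power_divide zero_power)
  then have "(\<lambda>N. f N / real N ^ j * (1 / real N ^ (d - j))) \<longlonglongrightarrow> c * 0"
    by (intro tendsto_mult assms(1))
  moreover have "real N ^ j * real N ^ (d - j) = real N ^ d" for N
    using assms(2) by (simp flip: power_add)
  ultimately show ?thesis by simp
qed

lemma choose_over_power_tendsto_le:
  assumes "j \<le> d"
  shows "(\<lambda>N. real ((N - n) choose j) / real N ^ d) \<longlonglongrightarrow> (if j = d then 1 else 0) / fact d"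
proof (cases "j = d")
  case False
  then show ?thesis using over_power_tendsto_0[OF choose_over_power_tendsto, of j d n] assms by simp
qed (use choose_over_power_tendsto in simp)

lemma sum_list_choose_tendsto:
  assumes "\<forall>j\<in>set l. j \<le> d"
  shows "(\<lambda>N. real (\<Sum>j\<leftarrow>l. (N - n) choose j) / real N ^ d) \<longlonglongrightarrow> real (count_list l d) / fact d"
  using assms
proof (induction l)
  case (Cons j l)
  have "(\<lambda>N. real ((N - n) choose j) / real N ^ d + real (\<Sum>j\<leftarrow>l. (N - n) choose j) / real N ^ d)
      \<longlonglongrightarrow> (if j = d then 1 else 0) / fact d + real (count_list l d) / fact d"
    using Cons by (intro tendsto_add choose_over_power_tendsto_le) auto
  then show ?case by (auto simp: add_divide_distrib split: if_splits)
qed simp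

text \<open>The factorial makes \<open>m\<close> the number of pieces of degree \<open>d\<close>
  when no piece has larger degree; \<open>m = 0\<close> then means that all degrees are below
  \<open>d\<close>. Defined by growth alone, the number is independent of the filtration and behaves
  well in exact sequences.\<close>

definition leading_mult :: "nat \<Rightarrow> real \<Rightarrow> ('k::field ratfun, 'v) sym_module \<Rightarrow> bool" where
  "leading_mult d m M \<longleftrightarrow> (\<lambda>N. real (inv_dim N M) / real N ^ d) \<longlonglongrightarrow> m / fact d"

lemma leading_mult_unique: "leading_mult d m M \<Longrightarrow> leading_mult d m' M \<Longrightarrow> m = m'"
  using LIMSEQ_unique[of "\<lambda>N. real (inv_dim N M) / real N ^ d" "m / fact d" "m' / fact d"]
  by (simp add: leading_mult_def)

lemma leading_mult_less: "leading_mult j m M \<Longrightarrow> j < d \<Longrightarrow> leading_mult d 0 M"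
  using over_power_tendsto_0[of "\<lambda>N. real (inv_dim N M)" j "m / fact j" d] by (simp add: leading_mult_def)

lemma leading_mult_chain:
  assumes "\<And>N. n \<le> N \<Longrightarrow> inv_dim N M = (\<Sum>j\<leftarrow>l. (N - n) choose j)" "\<forall>j\<in>set l. j \<le> d"
  shows "leading_mult d (count_list l d) M"
proof -
  have "\<forall>\<^sub>F N in sequentially. real (\<Sum>j\<leftarrow>l. (N - n) choose j) / real N ^ d = real (inv_dim N M) / real N ^ d"
    by (rule eventually_sequentiallyI[of n]) (simp add: assms(1))
  then show ?thesis
    unfolding leading_mult_def by (rule Lim_transform_eventually[OF sum_list_choose_tendsto[OF assms(2)]])
qed

lemma leading_mult_diff:
  assumes "M1 \<in> fg_reps" "M2 \<in> fg_reps" "M3 \<in> fg_reps" "short_exact M1 M2 M3"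
    and "leading_mult d m2 M2" "leading_mult d m3 M3"
  shows "leading_mult d (m2 - m3) M1"
proof -
  have "(\<lambda>N. real (inv_dim N M2) / real N ^ d - real (inv_dim N M3) / real N ^ d) \<longlonglongrightarrow> m2 / fact d - m3 / fact d"
    using assms(5,6) unfolding leading_mult_def by (rule tendsto_diff)
  moreover have "\<forall>\<^sub>F N in sequentially. real (inv_dim N M2) / real N ^ d - real (inv_dim N M3) / real N ^ d
      = real (inv_dim N M1) / real N ^ d"
    using inv_dim_short_exact[OF assms(1-4)]
    by eventually_elim (simp add: diff_divide_distrib[symmetric])
  ultimately show ?thesis
    unfolding leading_mult_def diff_divide_distrib by (rule Lim_transform_eventually)
qed

section \<open>The Grothendieck group\<close>

type_synonym 'k urep = "('k ratfun, nat set \<Rightarrow>\<^sub>0 'k ratfun) sym_module"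

abbreviation free_group :: "('k::field urep \<Rightarrow>\<^sub>0 int) monoid" where
  "free_group \<equiv> free_Abelian_group fg_reps"

abbreviation coset :: "('k::field urep \<Rightarrow>\<^sub>0 int) \<Rightarrow> ('k urep \<Rightarrow>\<^sub>0 int) set" where
  "coset x \<equiv> groth_kernel #>\<^bsub>free_group\<^esub> x"

lemma groth_relations_subset: "groth_relations \<subseteq> carrier free_group"
  by (auto simp: groth_relations_def
      dest!: subsetD[OF keys_diff] subsetD[OF keys_add] split: if_splits)

lemma subgroup_groth_kernel: "subgroup groth_kernel free_group"
  unfolding groth_kernel_def
  by (rule group.generate_is_subgroup[OF group_free_Abelian_group groth_relations_subset])

lemma coset_hom: "coset \<in> hom free_group groth_group"
proof -
  have "groth_kernel \<lhd> free_group"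
    by (rule comm_group.subgroup_imp_normal[OF abelian_free_Abelian_group subgroup_groth_kernel])
  then show ?thesis unfolding groth_group_def by (rule normal.r_coset_hom_Mod)
qed

lemma group_groth_group: "group groth_group"
  using abelian_groth_group by (rule comm_group.axioms(2))

lemma coset_eq_one_iff: "x \<in> carrier free_group \<Longrightarrow> coset x = \<one>\<^bsub>groth_group\<^esub> \<longleftrightarrow> x \<in> groth_kernel"
  using group.coset_join1[OF group_free_Abelian_group _ _ subgroup_groth_kernel]
    group.coset_join2[OF group_free_Abelian_group _ subgroup_groth_kernel]
    subgroup.subset[OF subgroup_groth_kernel]
  by (auto simp: groth_group_def FactGroup_def)

lemma coset_add: "x \<in> carrier free_group \<Longrightarrow> y \<in> carrier free_group \<Longrightarrow> coset (x + y) = coset x \<otimes>\<^bsub>groth_group\<^esub> coset y"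
  using hom_mult[OF coset_hom] by simp

lemma groth_class_short_exact:
  fixes M1 :: "'k::field urep"
  assumes "M1 \<in> fg_reps" "M2 \<in> fg_reps" "M3 \<in> fg_reps" "short_exact M1 M2 M3"
  shows "groth_class M2 = groth_class M1 \<otimes>\<^bsub>groth_group\<^esub> groth_class M3"
proof -
  interpret group groth_group by (rule group_groth_group)
  let ?y = "frag_of M1 + frag_of M3" and ?x = "frag_of M2 - (frag_of M1 + frag_of M3)"
  have y: "?y \<in> carrier free_group"
    using assms keys_add[of "frag_of M1" "frag_of M3"] by (auto split: if_splits)
  have "?x \<in> groth_relations" using assms by (auto simp: groth_relations_def)
  then have x: "?x \<in> groth_kernel" "?x \<in> carrier free_group"
    using subsetD[OF groth_relations_subset] unfolding groth_kernel_def by (blast intro: generate.incl)+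
  have "coset (?x + ?y) = coset ?x \<otimes>\<^bsub>groth_group\<^esub> coset ?y" by (rule coset_add[OF x(2) y])
  also have "coset ?x = \<one>\<^bsub>groth_group\<^esub>" using x coset_eq_one_iff by blast
  also have "\<one>\<^bsub>groth_group\<^esub> \<otimes>\<^bsub>groth_group\<^esub> coset ?y = coset ?y"
    using hom_in_carrier[OF coset_hom y] by simp
  also have "\<dots> = coset (frag_of M1) \<otimes>\<^bsub>groth_group\<^esub> coset (frag_of M3)"
    using assms by (intro coset_add) auto
  finally show ?thesis by (simp add: groth_class_def)
qed

definition inv_char :: "nat \<Rightarrow> ('k::field urep \<Rightarrow>\<^sub>0 int) \<Rightarrow> int" where
  "inv_char N x = (\<Sum>M\<in>Poly_Mapping.keys x. Poly_Mapping.lookup x M * int (inv_dim N M))"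

lemma inv_char_superset:
  "finite A \<Longrightarrow> Poly_Mapping.keys x \<subseteq> A \<Longrightarrow> inv_char N x = (\<Sum>M\<in>A. Poly_Mapping.lookup x M * int (inv_dim N M))"
  unfolding inv_char_def by (rule sum.mono_neutral_left) (auto simp: in_keys_iff)

lemma inv_char_add: "inv_char N (x + y) = inv_char N x + inv_char N y"
proof -
  let ?A = "Poly_Mapping.keys x \<union> Poly_Mapping.keys y"
  have "inv_char N (x + y) = (\<Sum>M\<in>?A. Poly_Mapping.lookup (x + y) M * int (inv_dim N M))"
    by (rule inv_char_superset) (use keys_add[of x y] in auto)
  then show ?thesis
    by (simp add: inv_char_superset[of ?A x] inv_char_superset[of ?A y] lookup_add distrib_right sum.distrib)
qed

lemma inv_char_0 [simp]: "inv_char N 0 = 0"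
  by (simp add: inv_char_def)

lemma inv_char_uminus: "inv_char N (- x) = - inv_char N x"
  using inv_char_add[of N x "- x"] by simp

lemma inv_char_diff: "inv_char N (x - y) = inv_char N x - inv_char N y"
  using inv_char_add[of N x "- y"] by (simp add: inv_char_uminus)

lemma inv_char_sum: "inv_char N (\<Sum>i\<in>A. x i) = (\<Sum>i\<in>A. inv_char N (x i))"
  by (induction A rule: infinite_finite_induct) (simp_all add: inv_char_add)

lemma inv_char_frag_of [simp]: "inv_char N (frag_of M) = int (inv_dim N M)"
  by (simp add: inv_char_def)

lemma inv_char_cmul_frag_of: "inv_char N (frag_cmul c (frag_of M)) = c * int (inv_dim N M)"
  by (simp add: inv_char_superset[of "{M}"] keys_cmul subset_trans[OF keys_cmul])

text \<open>Vanishing for all large \<open>N\<close> is preserved by sums and negatives, so it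
  passes from the relations to the subgroup that they generate.\<close>

lemma inv_char_groth_kernel:
  fixes x :: "'k::field urep \<Rightarrow>\<^sub>0 int"
  assumes "x \<in> groth_kernel"
  shows "\<forall>\<^sub>F N in sequentially. inv_char N x = 0"
proof -
  let ?H = "{x \<in> carrier (free_group :: ('k urep \<Rightarrow>\<^sub>0 int) monoid). \<forall>\<^sub>F N in sequentially. inv_char N x = 0}"
  interpret G: comm_group "free_group :: ('k urep \<Rightarrow>\<^sub>0 int) monoid" by (rule abelian_free_Abelian_group)
  have "subgroup ?H free_group"
  proof (rule G.subgroupI)
    show "?H \<noteq> {}" by (auto intro!: exI[of _ 0])
    fix x y :: "'k urep \<Rightarrow>\<^sub>0 int"
    assume x: "x \<in> ?H"
    then have x': "Poly_Mapping.keys x \<subseteq> fg_reps" "\<forall>\<^sub>F N in sequentially. inv_char N x = 0" by auto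
    then show "inv\<^bsub>free_group\<^esub> x \<in> ?H" by (simp add: inv_char_uminus)
    assume y: "y \<in> ?H"
    then have y': "\<forall>\<^sub>F N in sequentially. inv_char N y = 0" by auto
    have "\<forall>\<^sub>F N in sequentially. inv_char N (x + y) = 0"
      using x'(2) y' by eventually_elim (simp add: inv_char_add)
    moreover have "x + y \<in> carrier free_group" using G.m_closed[of x y] x y by auto
    ultimately show "x \<otimes>\<^bsub>free_group\<^esub> y \<in> ?H" by simp
  qed auto
  moreover have "groth_relations \<subseteq> ?H"
  proof
    fix x :: "'k urep \<Rightarrow>\<^sub>0 int"
    assume x: "x \<in> groth_relations"
    then obtain L M N where "x = frag_of M - (frag_of L + frag_of N)" "L \<in> fg_reps" "M \<in> fg_reps" "N \<in> fg_reps"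
      "short_exact L M N"
      unfolding groth_relations_def by blast
    then have x_eq: "x = frag_of M - (frag_of L + frag_of N)"
      and "\<forall>\<^sub>F n in sequentially. inv_dim n M = inv_dim n L + inv_dim n N"
      using inv_dim_short_exact[of L M N] by auto
    from this(2) have "\<forall>\<^sub>F n in sequentially. inv_char n x = 0"
      by eventually_elim (simp add: x_eq inv_char_diff inv_char_add)
    then show "x \<in> ?H" using x subsetD[OF groth_relations_subset] by blast
  qed
  ultimately have "groth_kernel \<subseteq> ?H"
    unfolding groth_kernel_def by (intro G.generate_subgroup_incl)
  then show ?thesis using assms by auto
qed

section \<open>The subgroup generated by the classes of the induced modules\<close>

abbreviation I_span :: "('k::field urep \<Rightarrow>\<^sub>0 int) set set" where
  "I_span \<equiv> generate groth_group (range (\<lambda>r. groth_class (I_rep r)))"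

lemma subgroup_I_span: "subgroup I_span groth_group"
  by (rule group.generate_is_subgroup[OF group_groth_group]) (auto intro: groth_class_closed I_rep_in_fg_reps)

lemma I_span_short_exact:
  fixes M1 :: "'k::field urep"
  assumes "M1 \<in> fg_reps" "M2 \<in> fg_reps" "M3 \<in> fg_reps" "short_exact M1 M2 M3"
  shows "groth_class M1 \<in> I_span \<Longrightarrow> groth_class M3 \<in> I_span \<Longrightarrow> groth_class M2 \<in> I_span"
    and "groth_class M2 \<in> I_span \<Longrightarrow> groth_class M3 \<in> I_span \<Longrightarrow> groth_class M1 \<in> I_span"
proof -
  interpret group "groth_group :: ('k urep \<Rightarrow>\<^sub>0 int) set monoid" by (rule group_groth_group)
  interpret S: subgroup I_span "groth_group :: ('k urep \<Rightarrow>\<^sub>0 int) set monoid" by (rule subgroup_I_span)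
  have eq: "groth_class M2 = groth_class M1 \<otimes>\<^bsub>groth_group\<^esub> groth_class M3"
    by (rule groth_class_short_exact[OF assms])
  show "groth_class M2 \<in> I_span" if "groth_class M1 \<in> I_span" "groth_class M3 \<in> I_span"
    unfolding eq using that by (rule S.m_closed)
  show "groth_class M1 \<in> I_span" if "groth_class M2 \<in> I_span" "groth_class M3 \<in> I_span"
  proof -
    have "groth_class M1 = groth_class M2 \<otimes>\<^bsub>groth_group\<^esub> inv\<^bsub>groth_group\<^esub> groth_class M3"
      unfolding eq using assms by (simp add: m_assoc groth_class_closed)
    then show ?thesis using that by simp
  qed
qed

text \<open>A nonzero map \<open>h\<close> from the object presented by \<open>(L, U)\<close> to \<open>I_rep d\<close>, with kernel \<open>M1\<close>, image \<open>M3\<close>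
  and cokernel \<open>C\<close>.\<close>

lemma equivariant_split:
  fixes M :: "'k::field urep"
  assumes S: "semilinear scale gact" and M: "M \<in> fg_reps" and pres: "semilinear.presents scale gact L U M f"
    and smooth: "\<And>v. v \<in> U \<Longrightarrow> semilinear.smooth_vector gact v"
    and h: "semilinear.equivariant scale gact 0 d L U h" and nz: "\<exists>v\<in>U. h v \<noteq> 0"
  shows "\<exists>(M1 :: 'k urep) (M3 :: 'k urep) (C :: 'k urep). M1 \<in> fg_reps \<and> M3 \<in> fg_reps \<and> C \<in> fg_reps \<and> short_exact M1 M M3 \<and>
    short_exact M3 (I_rep d) C \<and> leading_mult d 0 C"
proof -
  interpret semilinear scale gact by fact
  have sM: "smooth_rep M" "fin_gen M" using M by (simp_all add: fg_reps_def)
  interpret presentation scale gact M L U f by (rule presentationI[OF sM(1) pres])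
  have h_add: "h (u + w) = h u + h w" if "u \<in> U" "w \<in> U" for u w
    using h that by (simp add: equivariant_def)
  have h_scale: "h (scale a u) = Poly_Mapping.map ((*) a) (h u)" and h_gact: "h (gact g u) = subset_act g (h u)"
    and h_keys: "h u \<in> carrier (I_rep d)" if "u \<in> U" for a g u
    using h that by (simp_all add: equivariant_def carrier_I_rep)
  have h_L: "h u = 0" if "u \<in> L" for u using h that by (simp add: equivariant_def)
  have h_diff: "h (u - w) = h u - h w" if "u \<in> U" "w \<in> U" for u w
    using h_add[of "u - w" w] that subspace_diff[OF subU] by (simp add: algebra_simps)
  define V where "V = {u \<in> U. h u = 0}"
  have "subspace V"
    unfolding V_def using subU h_L[OF subspace_0[OF subL]]
    by (auto intro!: subspaceI simp: subspace_0 subspace_add subspace_scale h_add h_scale)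
  then have V: "stable 0 V" "L \<subseteq> V" "V \<subseteq> U"
    using LU h_L stable_gact[OF stU] by (auto simp: stable_def V_def h_gact)
  have fg: "fin_gen_over 0 L U" using sM(2) by (rule fin_gen_over)
  then have "fin_gen_over 0 L V"
    using smooth stL V by (rule fin_gen_over_subspace)
  then obtain M1 :: "'k urep" and f1 where M1: "M1 \<in> fg_reps" "presents L V M1 f1"
    using ex_presents[OF stL V(1,2)] smooth V(3) by blast
  obtain F where F: "finite F" "F \<subseteq> U" "U = span (L \<union> orbits 0 F)"
    using fg by (rule fin_gen_over_obtain)
  have "U \<subseteq> span (V \<union> orbits 0 F)"
    by (subst F(3), rule span_mono) (use V(2) in blast)
  then have "fin_gen_over 0 V U" using F(1,2) by (rule_tac fin_gen_overI[OF stU V(3)])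
  then obtain M3 :: "'k urep" and f3 where M3: "M3 \<in> fg_reps" "presents V U M3 f3"
    using ex_presents[OF V(1) stU V(3)] smooth by blast
  have s13: "smooth_rep M1" "smooth_rep M3" using M1(1) M3(1) by (simp_all add: fg_reps_def)
  have ex1: "short_exact M1 M M3"
    by (rule presents_short_exact[OF s13(1) sM(1) s13(2) M1(2) pres M3(2)])
  interpret C: presentation scale gact M3 V U f3 by (rule presentationI[OF s13(2) M3(2)])
  define J where "J = h ` U"
  have JI: "J \<subseteq> carrier (I_rep d)" using h_keys by (auto simp: J_def)
  have "subs.subspace J"
  proof (rule subs.subspaceI)
    show "0 \<in> J" using h_L[OF subspace_0[OF subL]] subspace_0[OF subU] by (force simp: J_def)
  qed (use subspace_add[OF subU] subspace_scale[OF subU] in \<open>auto simp: J_def simp flip: h_add h_scale\<close>)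
  moreover have "subset_act g j \<in> J" if "j \<in> J" for g j
    using that stable_gact[OF stU] by (auto simp: J_def simp flip: h_gact)
  ultimately have J: "subs.stable 0 J" by (simp add: subs.stable_def)
  \<comment> \<open>The inverse of the isomorphism that \<open>h\<close> induces from
    \<open>U / V\<close> to its image \<open>J\<close>. It presents \<open>M3\<close> a second time,
    inside \<open>I_rep d\<close>, which links the two exact sequences.\<close>
  define k where "k j = f3 (SOME u. u \<in> U \<and> h u = j)" for j
  have k: "k (h u) = f3 u" if "u \<in> U" for u
  proof -
    let ?w = "SOME w. w \<in> U \<and> h w = h u"
    have w: "?w \<in> U \<and> h ?w = h u" by (rule someI[of _ u]) (use that in simp)
    then have "?w - u \<in> V" using that subspace_diff[OF subU] by (simp add: V_def h_diff)
    then show ?thesis unfolding k_def using C.f_eq_iff w that by blast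
  qed
  have "subs.rep_map J M3 k"
    unfolding subs.rep_map_def J_def
    using subspace_add[OF subU] subspace_scale[OF subU] stable_gact[OF stU]
    by (auto simp: k C.f_add C.f_scale C.f_gact simp flip: h_add h_scale h_gact)
  moreover have "k ` J = carrier M3"
    using k by (auto simp: J_def C.f_onto[symmetric] image_image)
  moreover have "k j = \<zero>\<^bsub>M3\<^esub> \<longleftrightarrow> j \<in> {0}" if "j \<in> J" for j
  proof -
    obtain u where u: "u \<in> U" "j = h u" using \<open>j \<in> J\<close> unfolding J_def by blast
    then have "k j = \<zero>\<^bsub>M3\<^esub> \<longleftrightarrow> u \<in> V" using k C.f_zero_iff by simp
    then show ?thesis using u by (simp add: V_def)
  qed
  moreover have "subs.stable 0 {0 :: nat set \<Rightarrow>\<^sub>0 'k ratfun}" "{0} \<subseteq> J"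
    using subs.subspace_0[OF subs.stable_subspace[OF J]] by (auto simp: subs.stable_def)
  ultimately have presJ: "subs.presents {0} J M3 k" using J by (simp add: subs.presents_def)
  obtain j where j: "j \<in> J" "j \<noteq> 0" using nz by (auto simp: J_def)
  have I: "subs.stable 0 (carrier (I_rep d :: 'k urep))" "subs.fin_gen_over 0 {0} (carrier (I_rep d :: 'k urep))"
    using presents_I_rep[of d, where 'k = 'k]
      presentation.fin_gen_over[OF subs.presentationI[OF smooth_rep_I_rep presents_I_rep], of d]
      I_rep_in_fg_reps[of d]
    by (auto simp: subs.presents_def fg_reps_def)
  obtain G where G: "finite G" "G \<subseteq> carrier (I_rep d :: 'k urep)" "carrier (I_rep d) = subs.span ({0} \<union> subs.orbits 0 G)"
    using I(2) by (rule subs.fin_gen_over_obtain)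
  have "carrier (I_rep d) \<subseteq> subs.span (J \<union> subs.orbits 0 G)"
    by (subst G(3), rule subs.span_mono) (use \<open>{0} \<subseteq> J\<close> in blast)
  then have "subs.fin_gen_over 0 J (carrier (I_rep d))"
    using G(1,2) by (rule_tac subs.fin_gen_overI[OF I(1) JI])
  then obtain C :: "'k urep" and fC where C: "C \<in> fg_reps" "subs.presents J (carrier (I_rep d)) C fC"
    using subs.ex_presents[OF J I(1) JI] smooth_I_rep by blast
  have sC: "smooth_rep C" using C(1) by (simp add: fg_reps_def)
  have ex2: "short_exact M3 (I_rep d) C"
    by (rule subs.presents_short_exact[OF s13(2) smooth_rep_I_rep sC presJ presents_I_rep C(2)])
  \<comment> \<open>Because \<open>h\<close> is nonzero, so is \<open>J\<close>, and this pushes the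
    cokernel into degrees below \<open>d\<close>.\<close>
  obtain n l where l: "subs.chain n J (carrier (I_rep d)) l" "\<forall>i\<in>set l. i < d"
    using ex_chain_quotient_I_rep[OF J JI j] by blast
  have "leading_mult d (count_list l d) C"
    using presentation.inv_dim_eq[OF subs.presentationI[OF sC C(2)] l(1)] l(2)
    by (intro leading_mult_chain) (auto intro: less_imp_le)
  moreover have "count_list l d = 0" using l(2) by (auto simp: count_list_0_iff)
  ultimately have "leading_mult d 0 C" by simp
  then show ?thesis using M1(1) M3(1) C(1) ex1 ex2
    by blast
qed

lemma leading_mult_I_rep: "leading_mult d 1 (I_rep d)"
  using leading_mult_chain[of 0 "I_rep d" "[d]" d] by (simp add: inv_dim_I_rep)

text \<open>Lexicographic induction on the degree and the multiplicity. Either the degree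
  \<open>d\<close> exceeds the true top degree \<open>D\<close> and is replaced by it, or they agree
  and a map to \<open>I_rep d\<close> splits \<open>M\<close> into pieces with smaller
  pairs.\<close>

lemma groth_class_in_I_span:
  fixes M :: "'k::field urep"
  assumes "M \<in> fg_reps" "leading_mult d (real m) M"
  shows "groth_class M \<in> I_span"
  using assms
proof (induction "(d, m)" arbitrary: d m M rule: wf_induct_rule[OF wf_lex_prod[OF wf_less_than wf_less_than]])
  case (1 d m M)
  note M = 1(2)
  have IH: "groth_class M' \<in> I_span"
    if "d' < d \<or> d' = d \<and> m' < m" "M' \<in> fg_reps" "leading_mult d' (real m') M'" for d' m' and M' :: "'k urep"
    using 1(1)[of d' m' M'] that by auto
  interpret group "groth_group :: ('k urep \<Rightarrow>\<^sub>0 int) set monoid" by (rule group_groth_group)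
  interpret M: smooth_rep M using M by (simp add: fg_reps_def)
  interpret free: semilinear M.free_scale M.free_act by (rule M.semilinear_free)
  let ?L = "{f \<in> M.free_carrier. M.eval f = \<zero>\<^bsub>M\<^esub>}" and ?U = M.free_carrier
  obtain n l where l: "free.chain n ?L ?U l" "head_max l"
    using free.presents_ex_chain[OF M.smooth_rep_axioms _ M.free_presents M.free_smooth] M
    by (auto simp: fg_reps_def)
  note dim = presentation.inv_dim_eq[OF free.presentationI[OF M.smooth_rep_axioms M.free_presents] l(1)]
  show ?case
  proof (cases l)
    case Nil
    \<comment> \<open>An empty filtration means that \<open>M\<close> is zero. Then
      \<open>M\<close>, \<open>M\<close>, \<open>M\<close> is a short exact sequence, which forces
      the class to be neutral.\<close>
    then have "?L = ?U" using l(1) by (auto elim: free.chain.cases)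
    then have "free.presents ?L ?L M M.eval" using M.free_presents by simp
    then have "short_exact M M M"
      using free.presents_short_exact[OF M.smooth_rep_axioms M.smooth_rep_axioms M.smooth_rep_axioms] by blast
    then have "groth_class M = groth_class M \<otimes>\<^bsub>groth_group\<^esub> groth_class M"
      by (rule groth_class_short_exact[OF M M M])
    then have "groth_class M = \<one>\<^bsub>groth_group\<^esub>"
      using groth_class_closed[OF M] by (metis r_cancel_one')
    then show ?thesis using subgroup.one_closed[OF subgroup_I_span] by simp
  next
    case (Cons D l')
    have le: "\<forall>j\<in>set l. j \<le> D" using l(2) Cons by (simp add: head_max_def)
    define c where "c = count_list l D"
    have c: "leading_mult D (real c) M"
      unfolding c_def using dim le by (intro leading_mult_chain) auto
    have "c > 0" using Cons by (simp add: c_def)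
    consider "D < d" | "d < D" | "d = D" by linarith
    then show ?thesis
    proof cases
      case 1
      then show ?thesis using IH M c by blast
    next
      case 2
      \<comment> \<open>Growth of order \<open>d\<close> below \<open>D\<close> contradicts the
        positive multiplicity \<open>c\<close> of the head.\<close>
      then have "leading_mult D 0 M" using leading_mult_less[OF \<open>leading_mult d (real m) M\<close>] by blast
      then have "real c = 0" by (rule leading_mult_unique[OF c])
      then show ?thesis using \<open>c > 0\<close> by simp
    next
      case 3
      then have "m = c" using leading_mult_unique[OF c, of "real m"] \<open>leading_mult d (real m) M\<close> by simp
      have st: "free.stable 0 ?U" "free.stable 0 ?L" using M.free_presents by (auto simp: free.presents_def)
      obtain h where h: "free.equivariant 0 D ?L ?U h" "\<exists>v\<in>?U. h v \<noteq> 0"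
        using free.chain_ex_equivariant[OF st, of n D l'] l Cons by auto
      obtain M1 M3 C :: "'k urep" where *: "M1 \<in> fg_reps" "M3 \<in> fg_reps" "C \<in> fg_reps" "short_exact M1 M M3"
        "short_exact M3 (I_rep d) C" "leading_mult d 0 C"
        using equivariant_split[OF M.semilinear_free M M.free_presents M.free_smooth h] 3 by blast
      \<comment> \<open>The image takes up the whole multiplicity 1 of \<open>I_rep d\<close>, since
        the cokernel has none; the kernel is therefore left with \<open>m - 1\<close>.\<close>
      have "leading_mult d (1 - 0) M3"
        by (rule leading_mult_diff[OF *(2) I_rep_in_fg_reps *(3,5) leading_mult_I_rep *(6)])
      then have "leading_mult d (real m - 1) M1"
        using leading_mult_diff[OF *(1) M *(2,4) \<open>leading_mult d (real m) M\<close>] by simp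
      then have "groth_class M1 \<in> I_span"
        using \<open>m = c\<close> \<open>c > 0\<close> by (intro IH[of d "m - 1"] *(1)) (auto simp: of_nat_diff)
      \<comment> \<open>The pair with multiplicity 0 precedes the current one because
        \<open>m\<close> is positive; the true degree of the cokernel need not be
        determined.\<close>
      moreover have "groth_class C \<in> I_span"
        using \<open>m = c\<close> \<open>c > 0\<close> *(6) by (intro IH[of d 0] *(3)) auto
      then have "groth_class M3 \<in> I_span"
        using I_span_short_exact(2)[OF *(2) I_rep_in_fg_reps *(3,5)]
        by (blast intro: generate.incl)
      ultimately show ?thesis using I_span_short_exact(1)[OF *(1) M *(2,4)] by blast
    qed
  qed
qed

lemma fg_rep_in_I_span:
  fixes M :: "'k::field urep"
  assumes "M \<in> fg_reps"
  shows "groth_class M \<in> I_span"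
proof -
  obtain n l where "\<forall>N\<ge>n. inv_dim N M = (\<Sum>d\<leftarrow>l. (N - n) choose d)"
    using inv_dim_chain[OF assms] by blast
  \<comment> \<open>Adjoining 0 gives the maximum a meaning for the empty list.\<close>
  then have "leading_mult (Max (set l \<union> {0})) (real (count_list l (Max (set l \<union> {0})))) M"
    by (intro leading_mult_chain[of n]) (auto intro: Max_ge)
  then show ?thesis by (rule groth_class_in_I_span[OF assms])
qed

lemma I_span_eq_carrier: "(I_span :: ('k::field urep \<Rightarrow>\<^sub>0 int) set set) = carrier groth_group"
proof
  show "I_span \<subseteq> carrier groth_group" by (rule subgroup.subset[OF subgroup_I_span])
  interpret G: group "groth_group :: ('k urep \<Rightarrow>\<^sub>0 int) set monoid" by (rule group_groth_group)
  have "coset x \<in> I_span" if "Poly_Mapping.keys x \<subseteq> fg_reps" for x :: "'k urep \<Rightarrow>\<^sub>0 int"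
    using that
  proof (induction x rule: free_Abelian_group_induct[consumes 1, case_names zero diff gen])
    case zero
    have "coset (0 :: 'k urep \<Rightarrow>\<^sub>0 int) = \<one>\<^bsub>groth_group\<^esub>"
      using subgroup.one_closed[OF subgroup_groth_kernel] by (subst coset_eq_one_iff) auto
    then show ?case using subgroup.one_closed[OF subgroup_I_span] by simp
  next
    case (diff x y)
    have "coset (- y) = inv\<^bsub>groth_group\<^esub> coset y"
    proof -
      have y: "y \<in> carrier free_group" "- y \<in> carrier free_group" using diff(2) by auto
      have "coset (- y + y) = \<one>\<^bsub>groth_group\<^esub>"
        using subgroup.one_closed[OF subgroup_groth_kernel] by (subst coset_eq_one_iff) auto
      then show ?thesis
        using coset_add[OF y(2,1)] hom_in_carrier[OF coset_hom] y by (metis G.inv_equality)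
    qed
    moreover have "coset (x - y) = coset x \<otimes>\<^bsub>groth_group\<^esub> coset (- y)"
      using coset_add[of x "- y"] diff(1,2) by simp
    ultimately show ?case
      using subgroup.m_closed[OF subgroup_I_span diff(3)] subgroup.m_inv_closed[OF subgroup_I_span diff(4)] by simp
  next
    case (gen M)
    then show ?case using fg_rep_in_I_span[of M] by (simp add: groth_class_def)
  qed
  then show "carrier groth_group \<subseteq> (I_span :: ('k urep \<Rightarrow>\<^sub>0 int) set set)"
    by (auto simp: groth_group_def FactGroup_def RCOSETS_def)
qed

section \<open>Linear independence of the classes\<close>

lemma finprod_groth_class:
  assumes "finite F"
  shows "finprod groth_group (\<lambda>i. groth_class (I_rep i :: 'k::field urep) [^]\<^bsub>groth_group\<^esub> (c i :: int)) F =
      coset (\<Sum>i\<in>F. frag_cmul (c i) (frag_of (I_rep i))) \<and>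
    (\<Sum>i\<in>F. frag_cmul (c i) (frag_of (I_rep i :: 'k urep))) \<in> carrier free_group"
  using assms
proof (induction F rule: finite_induct)
  case empty
  interpret G: comm_group "groth_group :: ('k urep \<Rightarrow>\<^sub>0 int) set monoid" by (rule abelian_groth_group)
  have "coset (0 :: 'k urep \<Rightarrow>\<^sub>0 int) = \<one>\<^bsub>groth_group\<^esub>"
    using subgroup.one_closed[OF subgroup_groth_kernel] by (subst coset_eq_one_iff) auto
  then show ?case by simp
next
  case (insert i F)
  interpret G: comm_group "groth_group :: ('k urep \<Rightarrow>\<^sub>0 int) set monoid" by (rule abelian_groth_group)
  let ?f = "frag_of (I_rep i :: 'k urep)" and ?s = "\<Sum>i\<in>F. frag_cmul (c i) (frag_of (I_rep i :: 'k urep))"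
  have f: "?f \<in> carrier free_group" using I_rep_in_fg_reps by auto
  have cf: "frag_cmul (c i) ?f \<in> carrier free_group" using I_rep_in_fg_reps keys_cmul[of "c i" ?f] by auto
  have "groth_class (I_rep i) [^]\<^bsub>groth_group\<^esub> c i = coset (?f [^]\<^bsub>free_group\<^esub> c i)"
    unfolding groth_class_def
    by (rule hom_int_pow[OF coset_hom f, symmetric]) (simp_all add: group_groth_group)
  also have "?f [^]\<^bsub>free_group\<^esub> c i = frag_cmul (c i) ?f"
    using I_rep_in_fg_reps by (intro int_pow_free_Abelian_group) auto
  finally have pow: "groth_class (I_rep i) [^]\<^bsub>groth_group\<^esub> c i = coset (frag_cmul (c i) ?f)" .
  have s: "?s \<in> carrier free_group" using insert by blast
  have "finprod groth_group (\<lambda>i. groth_class (I_rep i :: 'k urep) [^]\<^bsub>groth_group\<^esub> c i) (insert i F) =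
      coset (frag_cmul (c i) ?f) \<otimes>\<^bsub>groth_group\<^esub> coset ?s"
  proof (subst G.finprod_insert[OF insert.hyps])
    have "groth_class (I_rep j :: 'k urep) [^]\<^bsub>groth_group\<^esub> c j \<in> carrier groth_group" for j
      by (intro G.int_pow_closed groth_class_closed I_rep_in_fg_reps)
    then show "(\<lambda>i. groth_class (I_rep i :: 'k urep) [^]\<^bsub>groth_group\<^esub> c i) \<in> F \<rightarrow> carrier groth_group"
      "groth_class (I_rep i :: 'k urep) [^]\<^bsub>groth_group\<^esub> c i \<in> carrier groth_group" by auto
  qed (use insert.IH pow in simp)
  also have "\<dots> = coset (frag_cmul (c i) ?f + ?s)" by (rule coset_add[OF cf s, symmetric])
  finally have "finprod groth_group (\<lambda>i. groth_class (I_rep i :: 'k urep) [^]\<^bsub>groth_group\<^esub> c i) (insert i F) =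
      coset (\<Sum>i\<in>insert i F. frag_cmul (c i) (frag_of (I_rep i)))"
    using insert by simp
  moreover have "frag_cmul (c i) ?f + ?s \<in> carrier free_group"
    using cf s keys_add[of "frag_cmul (c i) ?f" ?s] by auto
  ultimately show ?case using insert by simp
qed

text \<open>Division by \<open>N ^ r\<close>, where \<open>r\<close> is the largest index with
  nonzero coefficient, leaves only the term \<open>c r / fact r\<close> in the limit.\<close>

lemma choose_combination_eventually_0:
  fixes c :: "nat \<Rightarrow> int"
  assumes "finite F" and ev: "\<forall>\<^sub>F N in sequentially. (\<Sum>i\<in>F. c i * int (N choose i)) = 0"
  shows "\<forall>i\<in>F. c i = 0"
proof (rule ccontr)
  assume "\<not> ?thesis"
  then have ne: "{i \<in> F. c i \<noteq> 0} \<noteq> {}" by auto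
  define r where "r = Max {i \<in> F. c i \<noteq> 0}"
  have r: "r \<in> {i \<in> F. c i \<noteq> 0}" unfolding r_def using ne assms(1) by (intro Max_in) auto
  have r_max: "i \<le> r" if "i \<in> F" "c i \<noteq> 0" for i
    unfolding r_def using that assms(1) by (intro Max_ge) auto
  have "(\<lambda>N. \<Sum>i\<in>F. real_of_int (c i) * (real (N choose i) / real N ^ r)) \<longlonglongrightarrow>
      (\<Sum>i\<in>F. if i = r then real_of_int (c r) / fact r else 0)"
  proof (rule tendsto_sum)
    fix i
    assume i: "i \<in> F"
    show "(\<lambda>N. real_of_int (c i) * (real (N choose i) / real N ^ r)) \<longlonglongrightarrow> (if i = r then real_of_int (c r) / fact r else 0)"
    proof (cases "c i = 0")
      case True
      then show ?thesis using r by auto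
    next
      case False
      have "(\<lambda>N. real_of_int (c i) * (real ((N - 0) choose i) / real N ^ r)) \<longlonglongrightarrow>
          real_of_int (c i) * ((if i = r then 1 else 0) / fact r)"
        by (intro tendsto_mult tendsto_const choose_over_power_tendsto_le r_max i False)
      then show ?thesis by (auto split: if_splits)
    qed
  qed
  then have lim: "(\<lambda>N. \<Sum>i\<in>F. real_of_int (c i) * (real (N choose i) / real N ^ r)) \<longlonglongrightarrow> real_of_int (c r) / fact r"
    using r assms(1) by simp
  have "\<forall>\<^sub>F N in sequentially. (\<Sum>i\<in>F. real_of_int (c i) * (real (N choose i) / real N ^ r)) = 0"
    using ev
  proof eventually_elim
    case (elim N)
    have "(\<Sum>i\<in>F. real_of_int (c i) * (real (N choose i) / real N ^ r)) =
        real_of_int (\<Sum>i\<in>F. c i * int (N choose i)) / real N ^ r"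
      by (simp add: sum_divide_distrib)
    then show ?case using elim by simp
  qed
  then have "real_of_int (c r) / fact r = 0"
    by (intro LIMSEQ_unique[OF lim] tendsto_eventually)
  then show False using r by simp
qed

theorem theorem4p18:
  shows "Z_basis
    (groth_group :: (('k::field ratfun, nat set \<Rightarrow>\<^sub>0 'k ratfun) sym_module \<Rightarrow>\<^sub>0 int) set monoid)
    (UNIV :: nat set)
    (\<lambda>r. groth_class (I_rep r))"
  unfolding Z_basis_def
proof (intro conjI allI impI)
  show "(\<lambda>r. groth_class (I_rep r :: 'k urep)) \<in> UNIV \<rightarrow> carrier groth_group"
    by (auto intro: groth_class_closed I_rep_in_fg_reps)
  show "I_span = carrier (groth_group :: ('k urep \<Rightarrow>\<^sub>0 int) set monoid)" by (rule I_span_eq_carrier)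
  fix F and c :: "nat \<Rightarrow> int"
  assume F: "finite F \<and> F \<subseteq> UNIV \<and>
    finprod groth_group (\<lambda>i. groth_class (I_rep i :: 'k urep) [^]\<^bsub>groth_group\<^esub> c i) F = \<one>\<^bsub>groth_group\<^esub>"
  let ?x = "\<Sum>i\<in>F. frag_cmul (c i) (frag_of (I_rep i :: 'k urep))"
  have "coset ?x = \<one>\<^bsub>groth_group\<^esub>" "?x \<in> carrier free_group"
    using finprod_groth_class[of F c, where 'k = 'k] F by auto
  then have "?x \<in> groth_kernel" using coset_eq_one_iff by blast
  then have "\<forall>\<^sub>F N in sequentially. inv_char N ?x = 0" by (rule inv_char_groth_kernel)
  then have "\<forall>\<^sub>F N in sequentially. (\<Sum>i\<in>F. c i * int (N choose i)) = 0"
    by (simp add: inv_char_sum inv_char_cmul_frag_of inv_dim_I_rep)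
  then show "\<forall>i\<in>F. c i = 0" using choose_combination_eventually_0 F by blast
qed

end
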